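(* Let $K$ be a field, $n\le r$ integers, $p\ge 4$, and let $(A_1,\ldots,A_p)$ be a tuple of matrices in $M_n(K)$ such that for every $2\le l\le p$ there is some $m\notin\{1,l\}$ for which hypothesis $(H_{1lm})$ holds. Then the algorithm described in the context runs in polynomial time and outputs a commuting extension of size $r$ of $(A_1,\ldots,A_p)$ if such an extension exists; otherwise it rejects.
   Context: $[A,B]=AB-BA$; $\operatorname{Im}A$ is the column space. A tuple $(Z_1,\ldots,Z_p)$ of $r\times r$ matrices is a commuting extension of size $r$ of $(A_1,\ldots,A_p)$ ($n\times n$) if the $Z_i$ pairwise commute and $Z_i=\begin{pmatrix} A_i & B_i\\ C_i & D_i\end{pmatrix}$ with $B_i$ of size $n\times(r-n)$, $C_i$ of size $(r-n)\times n$, $D_i$ of size $(r-n)\times(r-n)$. Hypothesis $(H_{klm})$ for distinct $k,l,m$: (i) $\operatorname{Im}[A_k,A_l]$, $\operatorname{Im}[A_k,A_m]$, $\operatorname{Im}[A_l,A_m]$ have dimension $2(r-n)$; (ii) $\operatorname{Im}[A_k,A_l]+\operatorname{Im}[A_k,A_m]$, $\operatorname{Im}[A_l,A_k]+\operatorname{Im}[A_l,A_m]$, $\operatorname{Im}[A_m,A_k]+\operatorname{Im}[A_m,A_l]$ have dimension $3(r-n)$. Three-matrix procedure on a triple $(A_a,A_b,A_c)$ (written with indices $1,2,3$ for $a,b,c$): Step 1: let $B_1$ (size $n\times(r-n)$) have as columns an arbitrary basis of $\operatorname{Im}[A_1,A_2]\cap\operatorname{Im}[A_1,A_3]$. Step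 2: with $V_2=\operatorname{Im}[A_2,A_1]\cap\operatorname{Im}[A_2,A_3]$, write $[A_1,A_2]=M_1-M_2$, $\operatorname{Im}M_1\subseteq\operatorname{Im}B_1$, $\operatorname{Im}M_2\subseteq V_2$, and solve $B_1C_2=M_2$. Step 3: with $V_3=\operatorname{Im}[A_3,A_1]\cap\operatorname{Im}[A_3,A_2]$, write $[A_2,A_3]=N_3-N_2$, $\operatorname{Im}N_3\subseteq V_3$, $\operatorname{Im}N_2\subseteq V_2$, and solve $B_3C_2=N_3$. Step 4: write $[A_1,A_3]=P_3-P_1$, $\operatorname{Im}P_3\subseteq V_3$, $\operatorname{Im}P_1\subseteq\operatorname{Im}B_1$, and solve $P_3=B_3C_1$. Step 5: solve $P_1=B_1C_3$. Step 6: solve $N_2=B_2C_3$. Step 7: solve $B_3X-B_2Y=A_2B_3-A_3B_2$, set $D_2=X$, $D_3=Y$. Step 8: solve $B_2D_1-B_1D_2=A_1B_2-A_2B_1$ for $D_1$. The procedure rejects if a system is unsolvable or a solution in Steps 2–8 is not unique. Algorithm: (1) find $m$ with $(H_{12m})$; (2) run Steps 1–8 on $(A_1,A_2,A_m)$ to get candidates $Z_1,Z_2,Z_m$; (3) for $l=3,\ldots,p$, if $Z_l$ has not yet been computed: find $m$ with $(H_{1lm})$ and run Steps 2–7 on $(A_1,A_l,A_m)$, using the already computed blocks $B_1$, $C_1$, $D_1$ of $Z_1$ (not recomputing $C_1$ in Step 4, but computing $P_1$), to obtain $Z_l,Z_m$; (4) output $(Z_1,\ldots,Z_p)$ if these matrices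 pairwise commute, reject otherwise. Polynomial time means the number of arithmetic operations and equality tests in $K$ is polynomially bounded.
   Formalization: In Step 2 the two inclusions are swapped (Im M_1 ⊆ V_2 and Im M_2 ⊆ Im B_1), since with the inclusions as printed B_1C_2 = M_2 is unsolvable whenever r > n and an extension exists. *)

theory Defs
  imports
    "Jordan_Normal_Form.DL_Rank"
    "Jordan_Normal_Form.Gauss_Jordan_Elimination"
    "HOL-Library.Monad_Syntax"
begin

section \<open>Commuting extensions and the rank hypothesis\<close>

definition commutator :: "'a::ring mat \<Rightarrow> 'a mat \<Rightarrow> 'a mat" where
  "commutator A B = A * B - B * A"

definition commuting_extension ::
  "nat \<Rightarrow> nat \<Rightarrow> nat \<Rightarrow> (nat \<Rightarrow> 'a::field mat) \<Rightarrow> (nat \<Rightarrow> 'a mat) \<Rightarrow> bool" where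
  "commuting_extension n r p A Z \<longleftrightarrow>
     (\<forall>i\<in>{1..p}. \<forall>j\<in>{1..p}. Z i * Z j = Z j * Z i) \<and>
     (\<forall>i\<in>{1..p}. \<exists>B C D.
        B \<in> carrier_mat n (r - n) \<and> C \<in> carrier_mat (r - n) n \<and> D \<in> carrier_mat (r - n) (r - n) \<and>
        Z i = four_block_mat (A i) B C D)"

definition subspace_dim :: "nat \<Rightarrow> 'a::field vec set \<Rightarrow> nat" where
  "subspace_dim n W = vectorspace.dim class_ring ((module_vec TYPE('a) n)\<lparr>carrier := W\<rparr>)"

definition Im_comm :: "nat \<Rightarrow> 'a::field mat \<Rightarrow> 'a mat \<Rightarrow> 'a vec set" where
  "Im_comm n A B = vec_space.col_space n (commutator A B)"

definition sum_dim :: "nat \<Rightarrow> 'a::field vec set \<Rightarrow> 'a vec set \<Rightarrow> nat" where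
  "sum_dim n V W = subspace_dim n (module.submodule_sum (module_vec TYPE('a) n) V W)"

definition hyp_H ::
  "nat \<Rightarrow> nat \<Rightarrow> (nat \<Rightarrow> 'a::field mat) \<Rightarrow> nat \<Rightarrow> nat \<Rightarrow> nat \<Rightarrow> bool" where
  "hyp_H n r A k l m \<longleftrightarrow>
     subspace_dim n (Im_comm n (A k) (A l)) = 2 * (r - n) \<and>
     subspace_dim n (Im_comm n (A k) (A m)) = 2 * (r - n) \<and>
     subspace_dim n (Im_comm n (A l) (A m)) = 2 * (r - n) \<and>
     sum_dim n (Im_comm n (A k) (A l)) (Im_comm n (A k) (A m)) = 3 * (r - n) \<and>
     sum_dim n (Im_comm n (A l) (A k)) (Im_comm n (A l) (A m)) = 3 * (r - n) \<and>
     sum_dim n (Im_comm n (A m) (A k)) (Im_comm n (A m) (A l)) = 3 * (r - n)"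

definition basis_matrix :: "nat \<Rightarrow> 'a::field mat \<Rightarrow> 'a vec set \<Rightarrow> bool" where
  "basis_matrix n B W \<longleftrightarrow>
     dim_row B = n \<and> distinct (cols B) \<and>
     module.lin_indpt class_ring (module_vec TYPE('a) n) (set (cols B)) \<and>
     vec_space.col_space n B = W"


section \<open>Computations that count field operations\<close>

text \<open>
  A run ends with a value or with a rejection (\<^term>\<open>None\<close>). Its second component is the number of
  arithmetic operations and equality tests performed in the field. All programs below compute with
  field elements only through the five primitives \<open>add\<close>, \<open>sub\<close>, \<open>mul\<close>, \<open>quot\<close> and \<open>is_eq\<close>;
  copying, rearranging entries and index arithmetic are free.
\<close>

datatype 'a run = Run (outcome: "'a option") (ops: nat)

definition ret :: "'a \<Rightarrow> 'a run" where
  "ret x = Run (Some x) 0"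

definition reject :: "'a run" where
  "reject = Run None 0"

fun bind_run :: "'a run \<Rightarrow> ('a \<Rightarrow> 'b run) \<Rightarrow> 'b run" where
  "bind_run (Run None k) f = Run None k"
| "bind_run (Run (Some x) k) f = (case f x of Run y k' \<Rightarrow> Run y (k + k'))"

adhoc_overloading Monad_Syntax.bind \<rightleftharpoons> bind_run

definition require :: "bool \<Rightarrow> unit run" where
  "require b = (if b then ret () else reject)"

fun map_run :: "('a \<Rightarrow> 'b run) \<Rightarrow> 'a list \<Rightarrow> 'b list run" where
  "map_run f [] = ret []"
| "map_run f (x # xs) = do { y \<leftarrow> f x; ys \<leftarrow> map_run f xs; ret (y # ys) }"

fun filter_run :: "('a \<Rightarrow> bool run) \<Rightarrow> 'a list \<Rightarrow> 'a list run" where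
  "filter_run P [] = ret []"
| "filter_run P (x # xs) =
     do { b \<leftarrow> P x; ys \<leftarrow> filter_run P xs; ret (if b then x # ys else ys) }"

definition add :: "'a::field \<Rightarrow> 'a \<Rightarrow> 'a run" where "add x y = Run (Some (x + y)) 1"
definition sub :: "'a::field \<Rightarrow> 'a \<Rightarrow> 'a run" where "sub x y = Run (Some (x - y)) 1"
definition mul :: "'a::field \<Rightarrow> 'a \<Rightarrow> 'a run" where "mul x y = Run (Some (x * y)) 1"
definition quot :: "'a::field \<Rightarrow> 'a \<Rightarrow> 'a run" where "quot x y = Run (Some (x / y)) 1"
definition is_eq :: "'a::field \<Rightarrow> 'a \<Rightarrow> bool run" where "is_eq x y = Run (Some (x = y)) 1"


section \<open>Linear algebra\<close>

definition mat_run :: "nat \<Rightarrow> nat \<Rightarrow> (nat \<Rightarrow> nat \<Rightarrow> 'a run) \<Rightarrow> 'a mat run" where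
  "mat_run nr nc f = do {
     rows \<leftarrow> map_run (\<lambda>i. map_run (f i) [0..<nc]) [0..<nr];
     ret (mat_of_rows_list nc rows) }"

definition mat_add :: "'a::field mat \<Rightarrow> 'a mat \<Rightarrow> 'a mat run" where
  "mat_add A B = mat_run (dim_row A) (dim_col A) (\<lambda>i j. add (A $$ (i,j)) (B $$ (i,j)))"

definition mat_sub :: "'a::field mat \<Rightarrow> 'a mat \<Rightarrow> 'a mat run" where
  "mat_sub A B = mat_run (dim_row A) (dim_col A) (\<lambda>i j. sub (A $$ (i,j)) (B $$ (i,j)))"

definition mat_neg :: "'a::field mat \<Rightarrow> 'a mat run" where
  "mat_neg A = mat_run (dim_row A) (dim_col A) (\<lambda>i j. sub 0 (A $$ (i,j)))"

fun entry_mul :: "'a::field mat \<Rightarrow> 'a mat \<Rightarrow> nat \<Rightarrow> nat \<Rightarrow> nat list \<Rightarrow> 'a run" where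
  "entry_mul A B i j [] = ret 0"
| "entry_mul A B i j (k # ks) = do {
     s \<leftarrow> entry_mul A B i j ks;
     t \<leftarrow> mul (A $$ (i,k)) (B $$ (k,j));
     add t s }"

definition mat_mul :: "'a::field mat \<Rightarrow> 'a mat \<Rightarrow> 'a mat run" where
  "mat_mul A B = mat_run (dim_row A) (dim_col B) (\<lambda>i j. entry_mul A B i j [0..<dim_col A])"

definition mat_comm :: "'a::field mat \<Rightarrow> 'a mat \<Rightarrow> 'a mat run" where
  "mat_comm A B = do { P \<leftarrow> mat_mul A B; Q \<leftarrow> mat_mul B A; mat_sub P Q }"

definition hcat :: "'a mat \<Rightarrow> 'a mat \<Rightarrow> 'a mat" where
  "hcat A B = mat (dim_row A) (dim_col A + dim_col B)
     (\<lambda>(i,j). if j < dim_col A then A $$ (i,j) else B $$ (i, j - dim_col A))"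

definition sub_rows :: "'a mat \<Rightarrow> nat \<Rightarrow> nat \<Rightarrow> 'a mat" where
  "sub_rows A s k = mat k (dim_col A) (\<lambda>(i,j). A $$ (s + i, j))"

definition all_zero :: "'a::field mat \<Rightarrow> nat list \<Rightarrow> nat list \<Rightarrow> bool run" where
  "all_zero A is js = do {
     bs \<leftarrow> map_run (\<lambda>i. map_run (\<lambda>j. is_eq (A $$ (i,j)) 0) js) is;
     ret (\<forall>b\<in>set (concat bs). b) }"

fun find_pivot :: "'a::field mat \<Rightarrow> nat \<Rightarrow> nat list \<Rightarrow> nat option run" where
  "find_pivot A j [] = ret None"
| "find_pivot A j (i # is) = do {
     z \<leftarrow> is_eq (A $$ (i,j)) 0;
     if z then find_pivot A j is else ret (Some i) }"

definition clear_column :: "'a::field mat \<Rightarrow> nat \<Rightarrow> nat \<Rightarrow> 'a mat run" where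
  "clear_column A i j = mat_run (dim_row A) (dim_col A) (\<lambda>i' j'. do {
     q \<leftarrow> quot (A $$ (i,j')) (A $$ (i,j));
     if i' = i then ret q else do { t \<leftarrow> mul (A $$ (i',j)) q; sub (A $$ (i',j')) t } })"

text \<open>
  Gauss-Jordan elimination, processing the columns in the third argument; \<open>ps\<close> lists the pivot
  columns found so far, the pivot in column \<open>ps ! i\<close> being in row \<open>i\<close>.
\<close>

fun gauss_jordan_run :: "'a::field mat \<Rightarrow> nat list \<Rightarrow> nat list \<Rightarrow> ('a mat \<times> nat list) run" where
  "gauss_jordan_run A ps [] = ret (A, ps)"
| "gauss_jordan_run A ps (j # js) = do {
     piv \<leftarrow> find_pivot A j [length ps..<dim_row A];
     case piv of
       None \<Rightarrow> gauss_jordan_run A ps js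
     | Some i \<Rightarrow> do {
         A' \<leftarrow> clear_column (swaprows (length ps) i A) (length ps) j;
         gauss_jordan_run A' (ps @ [j]) js } }"

definition mat_rank :: "'a::field mat \<Rightarrow> nat run" where
  "mat_rank A = do { (R, ps) \<leftarrow> gauss_jordan_run A [] [0..<dim_col A]; ret (length ps) }"

text \<open>The pivot columns of \<open>A\<close>, a basis of its column space.\<close>

definition image_basis :: "'a::field mat \<Rightarrow> 'a mat run" where
  "image_basis A = do {
     (R, ps) \<leftarrow> gauss_jordan_run A [] [0..<dim_col A];
     ret (mat (dim_row A) (length ps) (\<lambda>(i,k). A $$ (i, ps ! k))) }"

definition kernel_basis :: "'a::field mat \<Rightarrow> 'a mat run" where
  "kernel_basis A = do {
     (R, ps) \<leftarrow> gauss_jordan_run A [] [0..<dim_col A];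
     let fs = filter (\<lambda>j. j \<notin> set ps) [0..<dim_col A] in
     mat_run (dim_col A) (length fs) (\<lambda>i k.
       if i \<in> set ps then sub 0 (R $$ (length (takeWhile (\<lambda>j. j \<noteq> i) ps), fs ! k))
       else ret (if i = fs ! k then 1 else 0)) }"

text \<open>A basis of the intersection of the column spaces of \<open>A\<close> and \<open>B\<close>.\<close>

definition inter_basis :: "'a::field mat \<Rightarrow> 'a mat \<Rightarrow> 'a mat run" where
  "inter_basis A B = do {
     N \<leftarrow> kernel_basis (hcat A B);
     S \<leftarrow> mat_mul A (sub_rows N 0 (dim_col A));
     image_basis S }"

text \<open>
  The unique \<open>X\<close> with \<open>A X = B\<close>; rejects if there is no solution or more than one. The system is
  determined iff \<open>A\<close> has full column rank, or trivially if \<open>X\<close> has no columns.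
\<close>

definition solve :: "'a::field mat \<Rightarrow> 'a mat \<Rightarrow> 'a mat run" where
  "solve A B = (let k = dim_col A; b = dim_col B in do {
     (R, ps) \<leftarrow> gauss_jordan_run (hcat A B) [] [0..<k];
     consistent \<leftarrow> all_zero R [length ps..<dim_row A] [k..<k + b];
     require consistent;
     require (length ps = k \<or> b = 0);
     ret (mat k b (\<lambda>(i,j). R $$ (i, k + j))) })"

text \<open>The unique \<open>X\<close> with \<open>X A = B\<close>.\<close>

definition solve_left :: "'a::field mat \<Rightarrow> 'a mat \<Rightarrow> 'a mat run" where
  "solve_left A B = do { X \<leftarrow> solve (transpose_mat A) (transpose_mat B); ret (transpose_mat X) }"

text \<open>
  The unique pair \<open>(X, Y)\<close> with \<open>U X - V Y = M\<close>.
\<close>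

definition solve_diff :: "'a::field mat \<Rightarrow> 'a mat \<Rightarrow> 'a mat \<Rightarrow> ('a mat \<times> 'a mat) run" where
  "solve_diff U V M = do {
     V' \<leftarrow> mat_neg V;
     S \<leftarrow> solve (hcat U V') M;
     ret (sub_rows S 0 (dim_col U), sub_rows S (dim_col U) (dim_col V)) }"

text \<open>
  The unique decomposition \<open>M = P - Q\<close> with \<open>Im P \<subseteq> Im U\<close> and \<open>Im Q \<subseteq> Im V\<close>, where the columns of
  \<open>U\<close> and those of \<open>V\<close> are linearly independent.
\<close>

definition split_diff :: "'a::field mat \<Rightarrow> 'a mat \<Rightarrow> 'a mat \<Rightarrow> ('a mat \<times> 'a mat) run" where
  "split_diff U V M = do {
     (X, Y) \<leftarrow> solve_diff U V M;
     P \<leftarrow> mat_mul U X;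
     Q \<leftarrow> mat_mul V Y;
     ret (P, Q) }"


section \<open>The three-matrix procedure\<close>

text \<open>
  Step 1. \<open>bas\<close> models the arbitrary choice of a basis: it may replace the basis found by elimination
  by any other basis of the same space.
\<close>

definition step1 :: "('a::field mat \<Rightarrow> 'a mat) \<Rightarrow> 'a mat \<Rightarrow> 'a mat \<Rightarrow> 'a mat \<Rightarrow> 'a mat run" where
  "step1 bas A1 A2 A3 = do {
     K12 \<leftarrow> mat_comm A1 A2;
     K13 \<leftarrow> mat_comm A1 A3;
     W \<leftarrow> inter_basis K12 K13;
     ret (bas W) }"

text \<open>
  Steps 2--7. If \<open>C1\<close> is already known, it is not recomputed in Step 4.

  The upper left blocks of \<open>Z1 Z2 = Z2 Z1\<close> give \<open>[A1, A2] = B2 C1 - B1 C2\<close>. Hence in the decomposition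
  \<open>[A1, A2] = M1 - M2\<close> of Step 2 the matrix \<open>M2 = B1 C2\<close> has its image in \<open>Im B1\<close> and \<open>M1 = B2 C1\<close>
  has its image in \<open>V2\<close>, in line with \<open>N3 = B3 C2\<close>, \<open>N2 = B2 C3\<close>, \<open>P3 = B3 C1\<close>, \<open>P1 = B1 C3\<close> later on.
\<close>

definition steps2_7 ::
  "'a::field mat \<Rightarrow> 'a mat \<Rightarrow> 'a mat \<Rightarrow> 'a mat \<Rightarrow> 'a mat option \<Rightarrow>
   ('a mat \<times> ('a mat \<times> 'a mat \<times> 'a mat) \<times> ('a mat \<times> 'a mat \<times> 'a mat)) run" where
  "steps2_7 A1 A2 A3 B1 C1_known = do {
     K12 \<leftarrow> mat_comm A1 A2;
     K21 \<leftarrow> mat_comm A2 A1;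
     K23 \<leftarrow> mat_comm A2 A3;
     V2 \<leftarrow> inter_basis K21 K23;
     (M1, M2) \<leftarrow> split_diff V2 B1 K12;
     C2 \<leftarrow> solve B1 M2;
     K31 \<leftarrow> mat_comm A3 A1;
     K32 \<leftarrow> mat_comm A3 A2;
     V3 \<leftarrow> inter_basis K31 K32;
     (N3, N2) \<leftarrow> split_diff V3 V2 K23;
     B3 \<leftarrow> solve_left C2 N3;
     K13 \<leftarrow> mat_comm A1 A3;
     (P3, P1) \<leftarrow> split_diff V3 B1 K13;
     C1 \<leftarrow> (case C1_known of None \<Rightarrow> solve B3 P3 | Some C \<Rightarrow> ret C);
     C3 \<leftarrow> solve B1 P1;
     B2 \<leftarrow> solve_left C3 N2;
     A2B3 \<leftarrow> mat_mul A2 B3;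
     A3B2 \<leftarrow> mat_mul A3 B2;
     E \<leftarrow> mat_sub A2B3 A3B2;
     (D2, D3) \<leftarrow> solve_diff B3 B2 E;
     ret (C1, (B2, C2, D2), (B3, C3, D3)) }"

definition step8 ::
  "'a::field mat \<Rightarrow> 'a mat \<Rightarrow> 'a mat \<Rightarrow> 'a mat \<Rightarrow> 'a mat \<Rightarrow> 'a mat run" where
  "step8 A1 A2 B1 B2 D2 = do {
     A1B2 \<leftarrow> mat_mul A1 B2;
     A2B1 \<leftarrow> mat_mul A2 B1;
     E \<leftarrow> mat_sub A1B2 A2B1;
     B1D2 \<leftarrow> mat_mul B1 D2;
     F \<leftarrow> mat_add E B1D2;
     solve B2 F }"


section \<open>The algorithm\<close>

definition test_H ::
  "nat \<Rightarrow> nat \<Rightarrow> (nat \<Rightarrow> 'a::field mat) \<Rightarrow> nat \<Rightarrow> nat \<Rightarrow> nat \<Rightarrow> bool run" where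
  "test_H n r A k l m = do {
     Kkl \<leftarrow> mat_comm (A k) (A l);
     Kkm \<leftarrow> mat_comm (A k) (A m);
     Klk \<leftarrow> mat_comm (A l) (A k);
     Klm \<leftarrow> mat_comm (A l) (A m);
     Kmk \<leftarrow> mat_comm (A m) (A k);
     Kml \<leftarrow> mat_comm (A m) (A l);
     d1 \<leftarrow> mat_rank Kkl;
     d2 \<leftarrow> mat_rank Kkm;
     d3 \<leftarrow> mat_rank Klm;
     e1 \<leftarrow> mat_rank (hcat Kkl Kkm);
     e2 \<leftarrow> mat_rank (hcat Klk Klm);
     e3 \<leftarrow> mat_rank (hcat Kmk Kml);
     ret (d1 = 2 * (r - n) \<and> d2 = 2 * (r - n) \<and> d3 = 2 * (r - n) \<and>
          e1 = 3 * (r - n) \<and> e2 = 3 * (r - n) \<and> e3 = 3 * (r - n)) }"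

text \<open>
  Search for an \<open>m\<close> satisfying the rank hypothesis for \<open>1, l, m\<close>; \<open>pick\<close> models the arbitrary
  choice among the suitable indices.
\<close>

definition find_m ::
  "(nat \<Rightarrow> nat list \<Rightarrow> nat) \<Rightarrow> nat \<Rightarrow> nat \<Rightarrow> nat \<Rightarrow> (nat \<Rightarrow> 'a::field mat) \<Rightarrow> nat \<Rightarrow> nat run" where
  "find_m pick n r p A l = do {
     ms \<leftarrow> filter_run (\<lambda>m. test_H n r A 1 l m) (filter (\<lambda>m. m \<notin> {1, l}) [1..<p + 1]);
     require (ms \<noteq> []);
     ret (pick l ms) }"

fun extend_run ::
  "(nat \<Rightarrow> nat list \<Rightarrow> nat) \<Rightarrow> nat \<Rightarrow> nat \<Rightarrow> nat \<Rightarrow> (nat \<Rightarrow> 'a::field mat) \<Rightarrow> 'a mat \<Rightarrow> 'a mat \<Rightarrow>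
   nat list \<Rightarrow> (nat \<rightharpoonup> 'a mat) \<Rightarrow> (nat \<rightharpoonup> 'a mat) run" where
  "extend_run pick n r p A B1 C1 [] Z = ret Z"
| "extend_run pick n r p A B1 C1 (l # ls) Z =
     (if Z l \<noteq> None then extend_run pick n r p A B1 C1 ls Z
      else do {
        m \<leftarrow> find_m pick n r p A l;
        (_, (Bl, Cl, Dl), (Bm, Cm, Dm)) \<leftarrow> steps2_7 (A 1) (A l) (A m) B1 (Some C1);
        extend_run pick n r p A B1 C1 ls
          (Z(l \<mapsto> four_block_mat (A l) Bl Cl Dl, m \<mapsto> four_block_mat (A m) Bm Cm Dm)) })"

definition commute_run :: "'a::field mat \<Rightarrow> 'a mat \<Rightarrow> bool run" where
  "commute_run X Y = do {
     K \<leftarrow> mat_comm X Y;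
     all_zero K [0..<dim_row K] [0..<dim_col K] }"

definition algorithm ::
  "('a::field mat \<Rightarrow> 'a mat) \<Rightarrow> (nat \<Rightarrow> nat list \<Rightarrow> nat) \<Rightarrow> nat \<Rightarrow> nat \<Rightarrow> nat \<Rightarrow> (nat \<Rightarrow> 'a mat) \<Rightarrow>
   (nat \<Rightarrow> 'a mat) run" where
  "algorithm bas pick n r p A = do {
     m \<leftarrow> find_m pick n r p A 2;
     B1 \<leftarrow> step1 bas (A 1) (A 2) (A m);
     (C1, (B2, C2, D2), (Bm, Cm, Dm)) \<leftarrow> steps2_7 (A 1) (A 2) (A m) B1 None;
     D1 \<leftarrow> step8 (A 1) (A 2) B1 B2 D2;
     Z \<leftarrow> extend_run pick n r p A B1 C1 [3..<p + 1]
            [1 \<mapsto> four_block_mat (A 1) B1 C1 D1,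
             2 \<mapsto> four_block_mat (A 2) B2 C2 D2,
             m \<mapsto> four_block_mat (A m) Bm Cm Dm];
     cs \<leftarrow> map_run (\<lambda>i. map_run (\<lambda>j. commute_run (the (Z i)) (the (Z j))) [1..<p + 1]) [1..<p + 1];
     require (\<forall>c\<in>set (concat cs). c);
     ret (\<lambda>i. the (Z i)) }"

definition basis_choice :: "nat \<Rightarrow> ('a::field mat \<Rightarrow> 'a mat) \<Rightarrow> bool" where
  "basis_choice n bas \<longleftrightarrow> (\<forall>B W. basis_matrix n B W \<longrightarrow> basis_matrix n (bas B) W)"

definition index_choice :: "(nat \<Rightarrow> nat list \<Rightarrow> nat) \<Rightarrow> bool" where
  "index_choice pick \<longleftrightarrow> (\<forall>l ms. ms \<noteq> [] \<longrightarrow> pick l ms \<in> set ms)"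

end

theory Submission
  imports Defs
begin

text \<open>
  If a commuting extension with blocks \<open>B\<^sub>i, C\<^sub>i, D\<^sub>i\<close> exists, then \<open>[A\<^sub>i, A\<^sub>j] = B\<^sub>j C\<^sub>i - B\<^sub>i C\<^sub>j\<close>. The rank
  hypothesis for three indices forces \<open>[B\<^sub>1 B\<^sub>2 B\<^sub>3]\<close> to have independent columns and each \<open>C\<^sub>i\<close> to have
  independent rows, so that \<open>Im [A\<^sub>1, A\<^sub>2] \<inter> Im [A\<^sub>1, A\<^sub>3] = Im B\<^sub>1\<close>, and similarly for the other indices.
  Conjugating the extension by \<open>diag(1, G)\<close> one may assume that \<open>B\<^sub>1\<close> is the basis chosen in Step 1; from
  then on every linear system that is solved has the block of the extension as its only solution.
  Conversely, an output always consists of blocks of the right sizes, because the dimension formula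
  gives \<open>B\<^sub>1\<close> exactly \<open>r - n\<close> columns, and it commutes by the final test.
\<close>

section \<open>Cost-counting computations\<close>

text \<open>Output and cost live under different assumptions. Soundness and the cost bound must hold
  for every input satisfying the rank hypothesis, where systems may be unsolvable; they are proved
  with a judgement that tolerates rejection and records only block sizes. Completeness fixes an
  extension and follows exact outcomes. The linear algebra is done with matrix identities:
  independence is a one-sided inverse, inclusion of images is a factorization. With s = r - n, the
  rank hypothesis acts through two products, \<open>[A1,A2] = [B2 -B1] [C1; C2]\<close> of rank 2s
  with inner size 2s, and \<open>[[A1,A2] [A1,A3]]\<close> of rank 3s with left factor
  \<open>[B1 B2 B3]\<close>: if the rank of a product equals its inner size, both factors have full
  rank. That 2s is the rank of an n x n matrix also bounds s by n, which keeps r out of the cost.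
  The exponent 5 comes from the p^2 commutation tests and the up to p searches among p indices, each
  at cubic cost.\<close>

lemma outcome_ret [simp]: "outcome (ret x) = Some x" and ops_ret [simp]: "ops (ret x) = 0"
  by (simp_all add: ret_def)

lemma outcome_reject [simp]: "outcome reject = None" and ops_reject [simp]: "ops reject = 0"
  by (simp_all add: reject_def)

lemma outcome_bind [simp]:
  "outcome (bind_run f g) = (case outcome f of None \<Rightarrow> None | Some x \<Rightarrow> outcome (g x))"
  by (cases "(f, g)" rule: bind_run.cases) (auto split: run.splits)

lemma ops_bind [simp]:
  "ops (bind_run f g) = ops f + (case outcome f of None \<Rightarrow> 0 | Some x \<Rightarrow> ops (g x))"
  by (cases "(f, g)" rule: bind_run.cases) (auto split: run.splits)

lemma outcome_require [simp]: "outcome (require b) = (if b then Some () else None)"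
  and ops_require [simp]: "ops (require b) = 0"
  by (simp_all add: require_def)

lemma field_op_runs [simp]:
  "outcome (add x y) = Some (x + y)" "ops (add x y) = 1"
  "outcome (sub x y) = Some (x - y)" "ops (sub x y) = 1"
  "outcome (mul x y) = Some (x * y)" "ops (mul x y) = 1"
  "outcome (quot x y) = Some (x / y)" "ops (quot x y) = 1"
  "outcome (is_eq x y) = Some (x = y)" "ops (is_eq x y) = 1"
  by (simp_all add: add_def sub_def mul_def quot_def is_eq_def)

definition computes :: "'b run \<Rightarrow> 'b \<Rightarrow> nat \<Rightarrow> bool" where
  "computes f x c \<longleftrightarrow> outcome f = Some x \<and> ops f \<le> c"

text \<open>A rejecting run satisfies every postcondition, so this judgement covers inputs without
  an extension; the cost is bounded either way. \<open>computes\<close>, in contrast, excludes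
  rejection.\<close>

definition run_ensures :: "'b run \<Rightarrow> nat \<Rightarrow> ('b \<Rightarrow> bool) \<Rightarrow> bool" where
  "run_ensures f c Q \<longleftrightarrow> ops f \<le> c \<and> (\<forall>x. outcome f = Some x \<longrightarrow> Q x)"

lemma computes_ret [simp]: "computes (ret x) y c \<longleftrightarrow> x = y"
  by (auto simp: computes_def)

lemma computes_bind:
  "computes f x a \<Longrightarrow> computes (g x) y b \<Longrightarrow> a + b \<le> c \<Longrightarrow> computes (bind_run f g) y c"
  by (auto simp: computes_def)

lemma computes_mono: "computes f x a \<Longrightarrow> a \<le> b \<Longrightarrow> computes f x b"
  by (auto simp: computes_def)

lemma computes_outcome: "computes f x a \<Longrightarrow> outcome f = Some x"
  by (auto simp: computes_def)

lemma run_ensures_ret: "Q x \<Longrightarrow> run_ensures (ret x) c Q"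
  by (auto simp: run_ensures_def)

lemma run_ensures_mono:
  "run_ensures f a P \<Longrightarrow> a \<le> b \<Longrightarrow> (\<And>x. P x \<Longrightarrow> Q x) \<Longrightarrow> run_ensures f b Q"
  by (auto simp: run_ensures_def)

lemma run_ensures_weaken: "run_ensures f a P \<Longrightarrow> a \<le> b \<Longrightarrow> run_ensures f b P"
  by (rule run_ensures_mono)

lemma run_ensures_bind:
  assumes "run_ensures f a P" "\<And>x. P x \<Longrightarrow> run_ensures (g x) b Q" "a + b \<le> c"
  shows "run_ensures (bind_run f g) c Q"
  using assms by (cases "outcome f") (fastforce simp: run_ensures_def)+

lemma run_ensures_computes:
  assumes "computes f x a" "run_ensures (g x) b Q" "a + b \<le> c"
  shows "run_ensures (bind_run f g) c Q"
  using assms by (auto simp: run_ensures_def computes_def)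

lemma run_ensures_require:
  assumes "b \<Longrightarrow> run_ensures f c Q"
  shows "run_ensures (require b \<bind> (\<lambda>_. f)) c Q"
  using assms by (auto simp: run_ensures_def)

lemma computes_map_run:
  assumes "\<And>x. x \<in> set xs \<Longrightarrow> computes (f x) (g x) c"
  shows "computes (map_run f xs) (map g xs) (length xs * c)"
  using assms by (induction xs) (auto simp: computes_def intro!: add_mono)

lemma computes_filter_run:
  assumes "\<And>x. x \<in> set xs \<Longrightarrow> computes (f x) (P x) c"
  shows "computes (filter_run f xs) (filter P xs) (length xs * c)"
  using assms by (induction xs) (auto simp: computes_def intro!: add_mono)

section \<open>Cost of entrywise operations, products and commutators\<close>

lemma computes_mat_run:
  assumes "\<And>i j. i < nr \<Longrightarrow> j < nc \<Longrightarrow> computes (f i j) (M $$ (i,j)) c" "M \<in> carrier_mat nr nc"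
  shows "computes (mat_run nr nc f) M (nr * (nc * c))"
proof -
  have *: "mat_of_rows_list nc (map (\<lambda>i. map (\<lambda>j. M $$ (i,j)) [0..<nc]) [0..<nr]) = M"
    using assms(2) by (intro eq_matI) (auto simp: mat_of_rows_list_def)
  have "computes (map_run (\<lambda>i. map_run (f i) [0..<nc]) [0..<nr])
      (map (\<lambda>i. map (\<lambda>j. M $$ (i,j)) [0..<nc]) [0..<nr]) (length [0..<nr] * (length [0..<nc] * c))"
    by (intro computes_map_run) (auto intro!: assms(1))
  then show ?thesis unfolding mat_run_def
    by (intro computes_bind[of _ _ "nr * (nc * c)" _ _ 0]) (auto simp: *)
qed

lemma mat_run_cost:
  assumes "\<And>i j. i < nr \<Longrightarrow> j < nc \<Longrightarrow> computes (f i j) (M $$ (i,j)) c" "M \<in> carrier_mat nr nc"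
    and "nr \<le> N" "nc \<le> N"
  shows "computes (mat_run nr nc f) M (c * N ^ 2)"
proof (rule computes_mono[OF computes_mat_run[OF assms(1,2)]])
  have "nr * (nc * c) \<le> N * (N * c)" using assms by (intro mult_le_mono) auto
  then show "nr * (nc * c) \<le> c * N ^ 2" by (simp add: power2_eq_square mult_ac)
qed

text \<open>The quadratic cost is rounded up to a cube: with all matrix operations priced in units
  of \<open>N ^ 3\<close>, budgets add up as plain numerals.\<close>

lemma computes_mat_add:
  assumes "A \<in> carrier_mat nr nc" "B \<in> carrier_mat nr nc" "nr \<le> N" "nc \<le> N"
  shows "computes (mat_add A B) (A + B) (N ^ 3)"
  unfolding mat_add_def using assms
  by (intro computes_mono[OF mat_run_cost[of _ _ _ _ 1 N]])
    (auto simp: computes_def power2_eq_square power3_eq_cube)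

lemma computes_mat_sub:
  assumes "A \<in> carrier_mat nr nc" "B \<in> carrier_mat nr nc" "nr \<le> N" "nc \<le> N"
  shows "computes (mat_sub A B) (A - B) (N ^ 3)"
  unfolding mat_sub_def using assms
  by (intro computes_mono[OF mat_run_cost[of _ _ _ _ 1 N]])
    (auto simp: computes_def power2_eq_square power3_eq_cube)

lemma computes_mat_neg:
  assumes "A \<in> carrier_mat nr nc" "nr \<le> N" "nc \<le> N"
  shows "computes (mat_neg A) (- A) (N ^ 3)"
  unfolding mat_neg_def using assms
  by (intro computes_mono[OF mat_run_cost[of _ _ _ _ 1 N]])
    (auto simp: computes_def power2_eq_square power3_eq_cube)

lemma computes_entry_mul:
  "computes (entry_mul A B i j ks) (\<Sum>k\<leftarrow>ks. A $$ (i,k) * B $$ (k,j)) (2 * length ks)"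
  by (induction ks) (auto simp: computes_def)

lemma computes_mat_mul:
  assumes "A \<in> carrier_mat nr k" "B \<in> carrier_mat k nc" "nr \<le> N" "nc \<le> N" "k \<le> N"
  shows "computes (mat_mul A B) (A * B) (2 * N ^ 3)"
  unfolding mat_mul_def
proof (rule computes_mono[OF mat_run_cost[of _ _ _ _ "2 * N" N]])
  fix i j assume "i < dim_row A" "j < dim_col B"
  then have "(A * B) $$ (i,j) = (\<Sum>k\<leftarrow>[0..<dim_col A]. A $$ (i,k) * B $$ (k,j))"
    using assms by (simp add: scalar_prod_def interv_sum_list_conv_sum_set_nat)
  with computes_entry_mul[of A B i j "[0..<dim_col A]"]
  show "computes (entry_mul A B i j [0..<dim_col A]) ((A * B) $$ (i,j)) (2 * N)"
    using assms by (auto elim!: computes_mono)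
qed (use assms in \<open>auto simp: power2_eq_square power3_eq_cube\<close>)

lemma commutator_carrier [simp]:
  "A \<in> carrier_mat n n \<Longrightarrow> B \<in> carrier_mat n n \<Longrightarrow> commutator A B \<in> carrier_mat n n"
  by (auto simp: commutator_def)

lemma computes_mat_comm:
  assumes "A \<in> carrier_mat n n" "B \<in> carrier_mat n n" "n \<le> N"
  shows "computes (mat_comm A B) (commutator A B) (5 * N ^ 3)"
  unfolding mat_comm_def commutator_def
  by (rule computes_bind[OF computes_mat_mul computes_bind[OF computes_mat_mul computes_mat_sub]])
    (use assms in auto)

lemma computes_all_zero:
  assumes "length is \<le> N" "length js \<le> N"
  shows "computes (all_zero A is js) (\<forall>i\<in>set is. \<forall>j\<in>set js. A $$ (i,j) = 0) (N ^ 2)"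
proof -
  have *: "computes (map_run (\<lambda>i. map_run (\<lambda>j. is_eq (A $$ (i,j)) 0) js) is)
      (map (\<lambda>i. map (\<lambda>j. A $$ (i,j) = 0) js) is) (length is * (length js * 1))"
    by (intro computes_map_run) (auto simp: computes_def)
  have "length is * (length js * 1) \<le> N ^ 2"
    using assms by (auto simp: power2_eq_square intro: mult_le_mono)
  then show ?thesis unfolding all_zero_def
    by (intro computes_bind[OF *, of _ _ 0]) auto
qed

section \<open>Gauss-Jordan elimination\<close>

text \<open>Two-way transfer matrices instead of an invertible one: \<open>P\<close> and
  \<open>Q\<close> need not be inverse to each other. The two factorizations compose directly and
  are all that is used to carry column relations between \<open>A\<close> and
  \<open>R\<close>.\<close>

definition row_equiv :: "'a::field mat \<Rightarrow> 'a mat \<Rightarrow> bool" where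
  "row_equiv A R \<longleftrightarrow> R \<in> carrier_mat (dim_row A) (dim_col A) \<and>
     (\<exists>P \<in> carrier_mat (dim_row A) (dim_row A). R = P * A) \<and>
     (\<exists>Q \<in> carrier_mat (dim_row A) (dim_row A). A = Q * R)"

lemma row_equiv_refl: "row_equiv A A"
  unfolding row_equiv_def by (auto intro!: bexI[of _ "1\<^sub>m (dim_row A)"])

lemma row_equivE:
  assumes "row_equiv A R" "A \<in> carrier_mat nr nc"
  obtains P Q where "P \<in> carrier_mat nr nr" "Q \<in> carrier_mat nr nr" "R = P * A" "A = Q * R"
    "R \<in> carrier_mat nr nc"
  using assms unfolding row_equiv_def carrier_matD[OF assms(2)] by blast

lemma row_equivI:
  assumes "A \<in> carrier_mat nr nc" "P \<in> carrier_mat nr nr" "Q \<in> carrier_mat nr nr" "R = P * A" "A = Q * R"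
  shows "row_equiv A R"
  unfolding row_equiv_def carrier_matD[OF assms(1)]
  using assms mult_carrier_mat[OF assms(2,1)] by blast

lemma row_equiv_trans:
  assumes "row_equiv A B" "row_equiv B C" shows "row_equiv A C"
proof -
  obtain nr nc where A: "A \<in> carrier_mat nr nc" by blast
  obtain P Q where 1: "P \<in> carrier_mat nr nr" "Q \<in> carrier_mat nr nr" "B = P * A" "A = Q * B"
    and B: "B \<in> carrier_mat nr nc" using row_equivE[OF assms(1) A] .
  obtain P' Q' where 2: "P' \<in> carrier_mat nr nr" "Q' \<in> carrier_mat nr nr" "C = P' * B" "B = Q' * C"
    and C: "C \<in> carrier_mat nr nc" using row_equivE[OF assms(2) B] .
  have "C = (P' * P) * A" "A = (Q * Q') * C"
    using assoc_mult_mat[OF 2(1) 1(1) A] assoc_mult_mat[OF 1(2) 2(2) C] 1 2 by metis+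
  then show ?thesis
    by (rule row_equivI[OF A mult_carrier_mat[OF 2(1) 1(1)] mult_carrier_mat[OF 1(2) 2(2)]])
qed

text \<open>A Gauss (Frobenius) elimination matrix: acting from the left it scales row k by
  \<open>f k\<close> and adds \<open>f i\<close> times row k to each other row i. Both a pivot step
  and its reversal have this form.\<close>

definition replace_col_mat :: "nat \<Rightarrow> nat \<Rightarrow> (nat \<Rightarrow> 'a::field) \<Rightarrow> 'a mat" where
  "replace_col_mat n k f = mat n n (\<lambda>(i,j). if j = k then f i else if i = j then 1 else 0)"

lemma replace_col_mat_carrier [simp]: "replace_col_mat n k f \<in> carrier_mat n n"
  "dim_row (replace_col_mat n k f) = n" "dim_col (replace_col_mat n k f) = n"
  by (simp_all add: replace_col_mat_def)

lemma index_replace_col_mat_mult: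
  assumes "A \<in> carrier_mat n nc" "k < n" "i < n" "j < nc"
  shows "(replace_col_mat n k f * A) $$ (i,j) = f i * A $$ (k,j) + (if i = k then 0 else A $$ (i,j))"
proof -
  have "(replace_col_mat n k f * A) $$ (i,j) =
      (\<Sum>l<n. (if l = k then f i else if i = l then 1 else 0) * A $$ (l,j))"
    using assms by (simp add: replace_col_mat_def scalar_prod_def atLeast0LessThan)
  \<comment> \<open>The summand is split into two single-point terms; the inner case distinction
    avoids counting the index twice when i = k.\<close>
  also have "\<dots> = (\<Sum>l<n. (if l = k then f i * A $$ (k,j) else 0)
      + (if l = i then (if i = k then 0 else A $$ (i,j)) else 0))"
    by (rule sum.cong) auto
  also have "\<dots> = f i * A $$ (k,j) + (if i = k then 0 else A $$ (i,j))"
    using assms unfolding sum.distrib by (simp add: sum.delta)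
  finally show ?thesis .
qed

definition pivot_step :: "'a::field mat \<Rightarrow> nat \<Rightarrow> nat \<Rightarrow> 'a mat" where
  "pivot_step A k c = mat (dim_row A) (dim_col A) (\<lambda>(i,j).
     if i = k then A $$ (k,j) / A $$ (k,c) else A $$ (i,j) - A $$ (i,c) * (A $$ (k,j) / A $$ (k,c)))"

lemma computes_clear_column:
  assumes "dim_row A \<le> N" "dim_col A \<le> N"
  shows "computes (clear_column A k c) (pivot_step A k c) (3 * N ^ 2)"
  unfolding clear_column_def
  by (rule mat_run_cost) (use assms in \<open>auto simp: computes_def pivot_step_def\<close>)

lemma row_equiv_pivot_step:
  assumes "k < dim_row A" "c < dim_col A" "A $$ (k,c) \<noteq> 0"
  shows "row_equiv A (pivot_step A k c)"
proof -
  define nr nc where "nr = dim_row A" and "nc = dim_col A"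
  have A: "A \<in> carrier_mat nr nc" and k: "k < nr" by (simp_all add: nr_def nc_def assms)
  have R: "pivot_step A k c \<in> carrier_mat nr nc" by (simp add: pivot_step_def nr_def nc_def)
  \<comment> \<open>\<open>?P\<close> normalizes the pivot row and clears the column.
    \<open>?Q\<close> restores the old column c: each other row i of \<open>A\<close> is the new row
    i plus \<open>A $$ (i,c)\<close> times the normalized pivot row.\<close>
  let ?P = "replace_col_mat nr k (\<lambda>i. if i = k then 1 / A $$ (k,c) else - A $$ (i,c) / A $$ (k,c))"
  let ?Q = "replace_col_mat nr k (\<lambda>i. A $$ (i,c))"
  have "pivot_step A k c = ?P * A"
  proof (rule eq_matI)
    fix i j assume "i < dim_row (?P * A)" "j < dim_col (?P * A)"
    then have "i < nr" "j < nc" using A by (auto simp: replace_col_mat_def)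
    then show "pivot_step A k c $$ (i,j) = (?P * A) $$ (i,j)"
      using A by (simp add: index_replace_col_mat_mult[OF A k] pivot_step_def del: index_mult_mat)
  qed (use A R in auto)
  moreover have "A = ?Q * pivot_step A k c"
  proof (rule eq_matI)
    fix i j assume "i < dim_row (?Q * pivot_step A k c)" "j < dim_col (?Q * pivot_step A k c)"
    then have "i < nr" "j < nc" using R by (auto simp: replace_col_mat_def)
    then show "A $$ (i,j) = (?Q * pivot_step A k c) $$ (i,j)"
      using A k assms(3) by (subst index_replace_col_mat_mult[OF R k]) (simp_all add: pivot_step_def)
  qed (use A R in auto)
  ultimately show ?thesis by (rule row_equivI[OF A replace_col_mat_carrier(1) replace_col_mat_carrier(1)])
qed

lemma row_equiv_swaprows:
  assumes "k < dim_row A" "l < dim_row A"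
  shows "row_equiv A (swaprows k l A)"
proof -
  define n nc where "n = dim_row A" and "nc = dim_col A"
  have A: "A \<in> carrier_mat n nc" and kl: "k < n" "l < n" by (simp_all add: n_def nc_def assms)
  have S: "swaprows k l A \<in> carrier_mat n nc" using A by auto
  have "swaprows k l (swaprows k l A) = A"
    using A kl by (intro eq_matI) auto
  then have "A = swaprows_mat n k l * swaprows k l A"
    using swaprows_mat[OF S kl] by simp
  with swaprows_mat[OF A kl] show ?thesis
    by (rule row_equivI[OF A swaprows_mat_carrier swaprows_mat_carrier])
qed

text \<open>The loop invariant of the elimination. Only the processed columns \<open>S\<close> are
  constrained, so the right-hand side columns of an augmented matrix, which are never processed, may
  be arbitrary.\<close>

definition reduced_on :: "'a::field mat \<Rightarrow> nat list \<Rightarrow> nat set \<Rightarrow> bool" where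
  "reduced_on A ps S \<longleftrightarrow> distinct ps \<and> length ps \<le> dim_row A \<and> set ps \<subseteq> S \<and> S \<subseteq> {..<dim_col A} \<and>
     (\<forall>k<length ps. \<forall>i<dim_row A. A $$ (i, ps ! k) = (if i = k then 1 else 0)) \<and>
     (\<forall>j\<in>S. \<forall>i. length ps \<le> i \<longrightarrow> i < dim_row A \<longrightarrow> A $$ (i,j) = 0)"

lemma find_pivot_spec:
  "\<exists>piv. computes (find_pivot A j is) piv (length is) \<and>
     (case piv of None \<Rightarrow> \<forall>i\<in>set is. A $$ (i,j) = 0 | Some i \<Rightarrow> i \<in> set is \<and> A $$ (i,j) \<noteq> 0)"
proof (induction "is")
  case (Cons i "is")
  then show ?case
    by (cases "A $$ (i,j) = 0") (auto simp: computes_def split: option.splits)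
qed simp

text \<open>The new pivot row lies below the earlier pivot rows and hence vanishes on
  \<open>S\<close>. Subtracting multiples of it therefore disturbs neither the earlier pivot columns
  nor the zero rows.\<close>

lemma reduced_on_pivot_step:
  assumes red: "reduced_on A ps S" and j: "j \<notin> S" "j < dim_col A"
    and i: "length ps \<le> i" "i < dim_row A" "A $$ (i,j) \<noteq> 0"
  shows "reduced_on (pivot_step (swaprows (length ps) i A) (length ps) j) (ps @ [j]) (insert j S)"
proof -
  let ?R = "pivot_step (swaprows (length ps) i A) (length ps) j"
  have ps: "ps ! k \<in> S" "ps ! k < dim_col A" if "k < length ps" for k
    using red that unfolding reduced_on_def by (auto dest: nth_mem)
  have col: "A $$ (a, ps ! k) = (if a = k then 1 else 0)" if "k < length ps" "a < dim_row A" for a k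
    using red that unfolding reduced_on_def by blast
  have zero: "A $$ (a, c) = 0" if "c \<in> S" "length ps \<le> a" "a < dim_row A" for a c
    using red that unfolding reduced_on_def by blast
  have S: "c < dim_col A" if "c \<in> S" for c using red that unfolding reduced_on_def by auto
  have "?R $$ (a, (ps @ [j]) ! k) = (if a = k then 1 else 0)"
    if "k < Suc (length ps)" "a < dim_row A" for k a
  proof (cases "k < length ps")
    case True
    then show ?thesis using that i j ps[OF True]
      by (auto simp: pivot_step_def nth_append col)
  next
    case False
    then have "k = length ps" using that by simp
    then show ?thesis using that i j by (auto simp: pivot_step_def)
  qed
  moreover have "?R $$ (a, c) = 0" if "c \<in> insert j S" "Suc (length ps) \<le> a" "a < dim_row A" for a c
  proof (cases "c = j")
    case True
    then show ?thesis using that i j by (auto simp: pivot_step_def)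
  next
    case False
    then show ?thesis using that i j S[of c] zero[of c] by (auto simp: pivot_step_def)
  qed
  moreover have "distinct (ps @ [j])" "length (ps @ [j]) \<le> dim_row ?R" "set (ps @ [j]) \<subseteq> insert j S"
    "insert j S \<subseteq> {..<dim_col ?R}" "dim_row ?R = dim_row A"
    using red i j unfolding reduced_on_def by (auto simp: pivot_step_def)
  ultimately show ?thesis unfolding reduced_on_def by auto
qed

text \<open>That the pivots are a filtered copy of the column list records their order: once every
  column is a pivot, the list of pivots is the column list itself, and the reduced block is the
  identity on top of zero rows. Per column, \<open>N ^ 2\<close> covers the pivot search and
  \<open>3 * N ^ 2\<close> the clearing.\<close>

lemma gauss_jordan_run_spec:
  assumes "reduced_on A ps S" "distinct js" "set js \<inter> S = {}" "set js \<subseteq> {..<dim_col A}"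
    "dim_row A \<le> N" "dim_col A \<le> N"
  shows "\<exists>R ps' P. computes (gauss_jordan_run A ps js) (R, ps') (length js * (4 * N ^ 2)) \<and>
     row_equiv A R \<and> reduced_on R ps' (S \<union> set js) \<and> ps' = ps @ filter P js"
  using assms
proof (induction js arbitrary: A ps S)
  case Nil
  then show ?case by (auto intro!: exI[of _ A] row_equiv_refl)
next
  case (Cons j js)
  define k where "k = length ps"
  obtain piv where piv: "computes (find_pivot A j [k..<dim_row A]) piv (length [k..<dim_row A])"
    "case piv of None \<Rightarrow> \<forall>i\<in>set [k..<dim_row A]. A $$ (i,j) = 0
      | Some i \<Rightarrow> i \<in> set [k..<dim_row A] \<and> A $$ (i,j) \<noteq> 0"
    using find_pivot_spec by blast
  have "dim_row A - k \<le> N ^ 2"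
    using Cons.prems(5) by (auto simp: power2_eq_square intro: order_trans[OF _ le_square])
  then have piv1: "computes (find_pivot A j [k..<dim_row A]) piv (N ^ 2)"
    by (auto intro: computes_mono[OF piv(1)])
  show ?case
  proof (cases piv)
    case None
    have "reduced_on A ps (insert j S)"
      using Cons.prems piv(2) None unfolding reduced_on_def by (auto simp: k_def)
    then obtain R ps' P where IH: "computes (gauss_jordan_run A ps js) (R, ps') (length js * (4 * N ^ 2))"
      "row_equiv A R" "reduced_on R ps' (insert j S \<union> set js)" "ps' = ps @ filter P js"
      using Cons.IH[of A ps "insert j S"] Cons.prems by auto
    have "computes (gauss_jordan_run A ps (j # js)) (R, ps') (length (j # js) * (4 * N ^ 2))"
      unfolding gauss_jordan_run.simps k_def[symmetric]
      by (rule computes_bind[OF piv1]) (use IH(1) None in auto)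
    \<comment> \<open>The predicate is corrected at j alone, which is harmless for \<open>js\<close>
      because the columns are distinct.\<close>
    moreover have "ps' = ps @ filter (\<lambda>x. P x \<and> x \<noteq> j) (j # js)"
      using IH(4) Cons.prems(2) by (auto intro: filter_cong)
    ultimately show ?thesis using IH(2,3) unfolding insert_is_Un[of j S]
      by (intro exI conjI) (assumption | simp add: Un_ac)+
  next
    case (Some i)
    then have i: "k \<le> i" "i < dim_row A" "A $$ (i,j) \<noteq> 0" using piv(2) by auto
    have j: "j \<notin> S" "j < dim_col A" using Cons.prems by auto
    let ?A = "swaprows k i A"
    let ?R = "pivot_step ?A k j"
    have "row_equiv A ?A" using i by (intro row_equiv_swaprows) auto
    moreover have "row_equiv ?A ?R" using i j by (intro row_equiv_pivot_step) auto
    ultimately have eq: "row_equiv A ?R" by (rule row_equiv_trans)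
    have dims: "dim_row ?R = dim_row A" "dim_col ?R = dim_col A" by (auto simp: pivot_step_def)
    have "reduced_on ?R (ps @ [j]) (insert j S)"
      using reduced_on_pivot_step[OF Cons.prems(1) j] i by (simp add: k_def)
    then obtain R ps' P where IH:
      "computes (gauss_jordan_run ?R (ps @ [j]) js) (R, ps') (length js * (4 * N ^ 2))"
      "row_equiv ?R R" "reduced_on R ps' (insert j S \<union> set js)" "ps' = (ps @ [j]) @ filter P js"
      using Cons.IH[of ?R "ps @ [j]" "insert j S"] Cons.prems dims by auto
    have clear: "computes (clear_column ?A k j) ?R (3 * N ^ 2)"
      using Cons.prems by (intro computes_clear_column) auto
    have "computes (clear_column ?A k j \<bind> (\<lambda>A'. gauss_jordan_run A' (ps @ [j]) js)) (R, ps')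
        (3 * N ^ 2 + length js * (4 * N ^ 2))"
      by (rule computes_bind[OF clear]) (use IH(1) in auto)
    then have "computes (gauss_jordan_run A ps (j # js)) (R, ps') (length (j # js) * (4 * N ^ 2))"
      unfolding gauss_jordan_run.simps k_def[symmetric]
      by (intro computes_bind[OF piv1]) (use Some in auto)
    moreover have "ps' = ps @ filter (\<lambda>x. P x \<or> x = j) (j # js)"
      using IH(4) Cons.prems(2) by (auto intro: filter_cong)
    ultimately show ?thesis using IH(3) row_equiv_trans[OF eq IH(2)]
      by (intro exI conjI) (assumption | simp add: Un_ac)+
  qed
qed

section \<open>Block matrices\<close>

definition vcat :: "'a mat \<Rightarrow> 'a mat \<Rightarrow> 'a mat" where
  "vcat A B = mat (dim_row A + dim_row B) (dim_col A)
     (\<lambda>(i,j). if i < dim_row A then A $$ (i,j) else B $$ (i - dim_row A, j))"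

lemma hcat_carrier [simp]:
  "A \<in> carrier_mat n a \<Longrightarrow> B \<in> carrier_mat n b \<Longrightarrow> hcat A B \<in> carrier_mat n (a + b)"
  by (auto simp: hcat_def)

lemma hcat_dim [simp]: "dim_row (hcat A B) = dim_row A" "dim_col (hcat A B) = dim_col A + dim_col B"
  by (auto simp: hcat_def)

lemma vcat_carrier [simp]:
  "A \<in> carrier_mat a n \<Longrightarrow> B \<in> carrier_mat b n \<Longrightarrow> vcat A B \<in> carrier_mat (a + b) n"
  by (auto simp: vcat_def)

lemma vcat_dim [simp]: "dim_row (vcat A B) = dim_row A + dim_row B" "dim_col (vcat A B) = dim_col A"
  by (auto simp: vcat_def)

lemma sub_rows_carrier [simp]: "A \<in> carrier_mat m n \<Longrightarrow> sub_rows A i k \<in> carrier_mat k n"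
  by (auto simp: sub_rows_def)

lemma sub_rows_vcat [simp]:
  assumes "A \<in> carrier_mat a n" "B \<in> carrier_mat b n"
  shows "sub_rows (vcat A B) 0 a = A" "sub_rows (vcat A B) a b = B"
  using assms by (auto simp: sub_rows_def vcat_def intro!: eq_matI)

lemma vcat_sub_rows:
  assumes "A \<in> carrier_mat (a + b) n"
  shows "vcat (sub_rows A 0 a) (sub_rows A a b) = A"
  using assms by (auto simp: sub_rows_def vcat_def intro!: eq_matI)

lemma vcat_eq_iff:
  assumes "A \<in> carrier_mat a n" "B \<in> carrier_mat b n" "C \<in> carrier_mat a n" "D \<in> carrier_mat b n"
  shows "vcat A B = vcat C D \<longleftrightarrow> A = C \<and> B = D"
  using assms by (metis sub_rows_vcat)

lemma sum_scalar_split: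
  fixes f :: "nat \<Rightarrow> 'a::comm_monoid_add"
  shows "(\<Sum>k = 0..<a + b. f k) = (\<Sum>k = 0..<a. f k) + (\<Sum>k = 0..<b. f (a + k))"
  by (simp add: sum.atLeastLessThan_concat[of 0 a "a + b", symmetric]
      sum.shift_bounds_nat_ivl[of f 0 a b, simplified, symmetric] add.commute)

lemma hcat_mult_vcat:
  fixes A :: "'a::field mat"
  assumes "A \<in> carrier_mat n a" "B \<in> carrier_mat n b" "C \<in> carrier_mat a m" "D \<in> carrier_mat b m"
  shows "hcat A B * vcat C D = A * C + B * D"
  using assms
  by (intro eq_matI) (auto simp: scalar_prod_def hcat_def vcat_def sum_scalar_split intro!: arg_cong2[of _ _ _ _ "(+)"] sum.cong)

lemma mult_hcat:
  fixes A :: "'a::field mat"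
  assumes "M \<in> carrier_mat m n" "A \<in> carrier_mat n a" "B \<in> carrier_mat n b"
  shows "M * hcat A B = hcat (M * A) (M * B)"
  using assms by (intro eq_matI) (auto simp: scalar_prod_def hcat_def)

lemma vcat_mult:
  fixes A :: "'a::field mat"
  assumes "A \<in> carrier_mat a n" "B \<in> carrier_mat b n" "M \<in> carrier_mat n m"
  shows "vcat A B * M = vcat (A * M) (B * M)"
  using assms by (intro eq_matI) (auto simp: scalar_prod_def vcat_def)

lemma hcat_eq_iff:
  assumes "A \<in> carrier_mat n a" "B \<in> carrier_mat n b" "C \<in> carrier_mat n a" "D \<in> carrier_mat n b"
  shows "hcat A B = hcat C D \<longleftrightarrow> A = C \<and> B = D"
proof
  assume eq: "hcat A B = hcat C D"
  have "A $$ (i,j) = C $$ (i,j)" if "i < n" "j < a" for i j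
    using arg_cong[OF eq, of "\<lambda>M. M $$ (i,j)"] that assms by (simp add: hcat_def)
  moreover have "B $$ (i,j) = D $$ (i,j)" if "i < n" "j < b" for i j
    using arg_cong[OF eq, of "\<lambda>M. M $$ (i,a + j)"] that assms by (simp add: hcat_def)
  ultimately show "A = C \<and> B = D" using assms by (auto intro!: eq_matI)
qed simp

lemma one_mat_blocks:
  "(1\<^sub>m (a + b) :: 'a::field mat) = vcat (hcat (1\<^sub>m a) (0\<^sub>m a b)) (hcat (0\<^sub>m b a) (1\<^sub>m b))"
  by (intro eq_matI) (auto simp: vcat_def hcat_def)

text \<open>A left inverse of \<open>[U V]\<close>, cut into row blocks, is a pair of coordinate
  maps, each reading off the coefficients of one family and killing the other. Independence of two
  families is used in this form.\<close>

lemma vcat_mult_hcat_eq_one_iff: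
  fixes L1 :: "'a::field mat"
  assumes "L1 \<in> carrier_mat a n" "L2 \<in> carrier_mat b n" "U \<in> carrier_mat n a" "V \<in> carrier_mat n b"
  shows "vcat L1 L2 * hcat U V = 1\<^sub>m (a + b) \<longleftrightarrow>
    L1 * U = 1\<^sub>m a \<and> L1 * V = 0\<^sub>m a b \<and> L2 * U = 0\<^sub>m b a \<and> L2 * V = 1\<^sub>m b"
  using assms unfolding one_mat_blocks
  by (simp add: vcat_mult[OF assms(1,2) hcat_carrier[OF assms(3,4)]] mult_hcat[OF _ assms(3,4)]
      vcat_eq_iff[of _ a "a + b" _ b]
      hcat_eq_iff[of _ a a _ b] hcat_eq_iff[of _ b a _ b])

section \<open>Rank factorizations\<close>

text \<open>Independence of the columns as an algebraic certificate, so that it can be used by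
  associativity rather than through linear combinations.\<close>

definition left_inv :: "'a::field mat \<Rightarrow> bool" where
  "left_inv U \<longleftrightarrow> (\<exists>L \<in> carrier_mat (dim_col U) (dim_row U). L * U = 1\<^sub>m (dim_col U))"

lemma left_invI: "L * U = 1\<^sub>m k \<Longrightarrow> L \<in> carrier_mat k n \<Longrightarrow> U \<in> carrier_mat n k \<Longrightarrow> left_inv U"
  unfolding left_inv_def by auto

lemma left_invE:
  assumes "left_inv U" "U \<in> carrier_mat n k"
  obtains L where "L \<in> carrier_mat k n" "L * U = 1\<^sub>m k"
  using assms unfolding left_inv_def by auto

lemma left_inv_cancel:
  assumes "left_inv U" "U \<in> carrier_mat n k" "X \<in> carrier_mat k m" "Y \<in> carrier_mat k m" "U * X = U * Y"
  shows "X = Y"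
proof -
  obtain L where L: "L \<in> carrier_mat k n" "L * U = 1\<^sub>m k" using left_invE[OF assms(1,2)] .
  have "L * (U * X) = L * (U * Y)" using assms(5) by simp
  then show ?thesis using L assms(2-4)
    by (simp add: assoc_mult_mat[OF L(1) assms(2), symmetric])
qed

lemma col_space_alt:
  assumes "A \<in> carrier_mat n m"
  shows "vec_space.col_space n A = (\<lambda>x. A *\<^sub>v x) ` carrier_vec m"
  using assms unfolding vec_space.col_space_eq[OF assms] by auto

text \<open>Solving \<open>B *v x = col A j\<close> column by column assembles \<open>G\<close>.
  This trades inclusions of images for matrix factorizations, and it is the only place where image
  vectors are handled individually for this purpose.\<close>

lemma col_space_subset_iff:
  fixes A :: "'a::field mat"
  assumes A: "A \<in> carrier_mat n a" and B: "B \<in> carrier_mat n b"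
  shows "vec_space.col_space n A \<subseteq> vec_space.col_space n B \<longleftrightarrow> (\<exists>G \<in> carrier_mat b a. A = B * G)"
proof
  assume sub: "vec_space.col_space n A \<subseteq> vec_space.col_space n B"
  have "\<exists>x \<in> carrier_vec b. col A j = B *\<^sub>v x" if "j < a" for j
  proof -
    have "col A j = A *\<^sub>v unit_vec a j" using A that by (intro eq_vecI) auto
    then have "col A j \<in> vec_space.col_space n A" unfolding col_space_alt[OF A] by auto
    then show ?thesis using sub unfolding col_space_alt[OF B] by auto
  qed
  then obtain x where x: "\<And>j. j < a \<Longrightarrow> x j \<in> carrier_vec b" "\<And>j. j < a \<Longrightarrow> col A j = B *\<^sub>v x j"
    by metis
  let ?G = "mat b a (\<lambda>(i,j). x j $ i)"
  have "A = B * ?G"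
  proof (rule eq_matI)
    fix i j assume "i < dim_row (B * ?G)" "j < dim_col (B * ?G)"
    then have ij: "i < n" "j < a" using B by auto
    then have "A $$ (i,j) = col A j $ i" using A by auto
    also have "\<dots> = row B i \<bullet> x j" using x(2)[OF ij(2)] ij B by simp
    also have "x j = col ?G j" using x(1)[OF ij(2)] ij by (intro eq_vecI) auto
    finally show "A $$ (i,j) = (B * ?G) $$ (i,j)" using ij B by simp
  qed (use A B in auto)
  then show "\<exists>G \<in> carrier_mat b a. A = B * G" by (intro bexI[of _ ?G]) auto
next
  assume "\<exists>G \<in> carrier_mat b a. A = B * G"
  then obtain G where G: "G \<in> carrier_mat b a" "A = B * G" by blast
  show "vec_space.col_space n A \<subseteq> vec_space.col_space n B"
    unfolding col_space_alt[OF A] col_space_alt[OF B]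
    unfolding G(2) using assoc_mult_mat_vec[OF B G(1)] G(1) by auto
qed

lemma rank_eq_subspace_dim: "vec_space.rank n A = subspace_dim n (vec_space.col_space n A)"
  unfolding vec_space.rank_def subspace_dim_def vec_space.col_space_def ..

lemma rank_cong_col_space:
  "vec_space.col_space n A = vec_space.col_space n B \<Longrightarrow> vec_space.rank n A = vec_space.rank n B"
  unfolding rank_eq_subspace_dim by simp

text \<open>Multiplying by the left inverse turns equal columns into equal columns of the identity,
  and \<open>U *v v = 0\<close> into \<open>v = 0\<close>. This is the bridge to independence and
  rank of column sets.\<close>

lemma left_inv_imp_indpt:
  fixes U :: "'a::field mat"
  assumes "left_inv U" "U \<in> carrier_mat n k"
  shows "distinct (cols U)" "module.lin_indpt class_ring (module_vec TYPE('a) n) (set (cols U))"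
    "vec_space.rank n U = k"
proof -
  interpret vec_space "TYPE('a)" n .
  obtain L where L: "L \<in> carrier_mat k n" "L * U = 1\<^sub>m k" using left_invE[OF assms] .
  show d: "distinct (cols U)"
    unfolding distinct_conv_nth
  proof (intro allI impI)
    fix i j assume ij: "i < length (cols U)" "j < length (cols U)" "i \<noteq> j"
    show "cols U ! i \<noteq> cols U ! j"
    proof
      assume "cols U ! i = cols U ! j"
      then have "col U i = col U j" using ij by simp
      then have "(L * U) $$ (i,i) = (L * U) $$ (i,j)" using ij assms(2) L(1) by simp
      then show False using ij assms(2) unfolding L(2) by simp
    qed
  qed
  show l: "lin_indpt (set (cols U))"
  proof
    assume "lin_dep (set (cols U))"
    then obtain v where v: "v \<in> carrier_vec k" "v \<noteq> 0\<^sub>v k" "U *\<^sub>v v = 0\<^sub>v n"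
      using lin_depE[OF assms(2) _ d] by blast
    have "v = (L * U) *\<^sub>v v" using v L by simp
    also have "\<dots> = L *\<^sub>v (U *\<^sub>v v)" by (rule assoc_mult_mat_vec[OF L(1) assms(2) v(1)])
    also have "\<dots> = 0\<^sub>v k" using v L by (auto intro!: eq_vecI)
    finally show False using v by simp
  qed
  show "rank U = k" by (rule lin_indpt_full_rank[OF assms(2) d l])
qed

definition select_cols :: "'a mat \<Rightarrow> nat list \<Rightarrow> 'a mat" where
  "select_cols A ps = mat (dim_row A) (length ps) (\<lambda>(i,k). A $$ (i, ps ! k))"

lemma select_cols_carrier [simp]:
  "A \<in> carrier_mat n m \<Longrightarrow> select_cols A ps \<in> carrier_mat n (length ps)"
  by (auto simp: select_cols_def)

lemma select_cols_mult:
  assumes "Q \<in> carrier_mat k n" "A \<in> carrier_mat n m" "set ps \<subseteq> {..<m}"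
  shows "select_cols (Q * A) ps = Q * select_cols A ps"
proof (rule eq_matI)
  fix i j assume "i < dim_row (Q * select_cols A ps)" "j < dim_col (Q * select_cols A ps)"
  then have ij: "i < k" "j < length ps" using assms by (auto simp: select_cols_def)
  then have *: "ps ! j < m" using assms(3) nth_mem by blast
  then have "col (select_cols A ps) j = col A (ps ! j)"
    using ij assms by (intro eq_vecI) (auto simp: select_cols_def)
  then show "select_cols (Q * A) ps $$ (i,j) = (Q * select_cols A ps) $$ (i,j)"
    using ij * assms by (simp add: select_cols_def)
qed (use assms in \<open>auto simp: select_cols_def\<close>)

text \<open>In \<open>R\<close> the pivot columns are the first unit vectors and the rows below them
  vanish, so \<open>R\<close> is its pivot columns times its top rows. Multiplying by
  \<open>Q\<close> gives the factorization of \<open>A\<close>. The top rows of \<open>P\<close>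
  invert the pivot columns of \<open>A\<close>, since \<open>P\<close> maps these to the pivot
  columns of \<open>R\<close>.\<close>

lemma rank_factorization_of_reduced:
  assumes A: "A \<in> carrier_mat n m" and eq: "row_equiv A R" and red: "reduced_on R ps {..<m}"
  shows "left_inv (select_cols A ps)"
    and "A = select_cols A ps * sub_rows R 0 (length ps)"
    and "vec_space.col_space n (select_cols A ps) = vec_space.col_space n A"
    and "vec_space.rank n A = length ps"
proof -
  obtain P Q where P: "P \<in> carrier_mat n n" and Q: "Q \<in> carrier_mat n n"
    and RP: "R = P * A" and AQ: "A = Q * R" and R: "R \<in> carrier_mat n m"
    using row_equivE[OF eq A] .
  let ?k = "length ps"
  let ?U = "select_cols A ps" and ?X = "sub_rows R 0 ?k"
  have ps: "set ps \<subseteq> {..<m}" and k: "?k \<le> n" using red R unfolding reduced_on_def by auto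
  have piv: "R $$ (i, ps ! c) = (if i = c then 1 else 0)" if "i < n" "c < ?k" for i c
    using red R that unfolding reduced_on_def by auto
  have zero: "R $$ (i, j) = 0" if "?k \<le> i" "i < n" "j < m" for i j
    using red R that unfolding reduced_on_def by auto
  have U: "?U \<in> carrier_mat n ?k" and X: "?X \<in> carrier_mat ?k m" using A R by auto
  have "sub_rows P 0 ?k * ?U = 1\<^sub>m ?k"
  proof (rule eq_matI)
    fix i j assume "i < dim_row (1\<^sub>m ?k)" "j < dim_col (1\<^sub>m ?k)"
    then have ij: "i < ?k" "j < ?k" "i < n" using k by auto
    have "row (sub_rows P 0 ?k) i = row P i"
      using ij k P by (intro eq_vecI) (auto simp: sub_rows_def)
    then have "(sub_rows P 0 ?k * ?U) $$ (i,j) = (P * ?U) $$ (i,j)"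
      using ij P U by (simp add: sub_rows_def)
    also have "P * ?U = select_cols R ps" using select_cols_mult[OF P A ps] RP by simp
    finally show "(sub_rows P 0 ?k * ?U) $$ (i,j) = 1\<^sub>m ?k $$ (i,j)"
      using ij R piv[OF ij(3) ij(2)] by (simp add: select_cols_def)
  qed (use U in \<open>auto simp: sub_rows_def\<close>)
  then show linv: "left_inv ?U" using U P by (intro left_invI[of "sub_rows P 0 ?k" _ ?k n]) auto
  have SX: "select_cols R ps * ?X = R"
  proof (rule eq_matI)
    fix i j assume "i < dim_row R" "j < dim_col R"
    then have ij: "i < n" "j < m" using R by auto
    have "(select_cols R ps * ?X) $$ (i,j) = (\<Sum>c = 0..<?k. (if i = c then 1 else 0) * R $$ (c,j))"
      using ij R by (simp add: scalar_prod_def select_cols_def sub_rows_def piv)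
    also have "\<dots> = (\<Sum>c = 0..<?k. (if i = c then R $$ (i,j) else 0))" by (rule sum.cong) auto
    also have "\<dots> = R $$ (i,j)" using zero[of i j] ij by (auto simp: sum.delta)
    finally show "(select_cols R ps * ?X) $$ (i,j) = R $$ (i,j)" .
  qed (use R in \<open>auto simp: select_cols_def sub_rows_def\<close>)
  have "?U = Q * select_cols R ps" using select_cols_mult[OF Q R ps] AQ by simp
  then have "?U * ?X = Q * (select_cols R ps * ?X)"
    using assoc_mult_mat[OF Q select_cols_carrier[OF R] X] by simp
  then show fac: "A = ?U * ?X" using SX AQ by simp
  have "?U = A * select_cols (1\<^sub>m m) ps" using select_cols_mult[OF A one_carrier_mat ps] A by simp
  then have "vec_space.col_space n ?U \<subseteq> vec_space.col_space n A"
    using col_space_subset_iff[OF U A] select_cols_carrier[OF one_carrier_mat] by blast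
  moreover have "vec_space.col_space n A \<subseteq> vec_space.col_space n ?U"
    using col_space_subset_iff[OF A U] X fac by blast
  ultimately show eq: "vec_space.col_space n ?U = vec_space.col_space n A" by simp
  show "vec_space.rank n A = ?k"
    using left_inv_imp_indpt(3)[OF linv U] rank_cong_col_space[OF eq] by simp
qed

lemma reduced_on_Nil: "reduced_on A [] {}"
  by (simp add: reduced_on_def)

lemma hcat_empty: "A \<in> carrier_mat n m \<Longrightarrow> hcat A (0\<^sub>m n 0) = A"
  by (auto simp: hcat_def intro!: eq_matI)

text \<open>Pivots are sought only in the left block, but one and the same \<open>P\<close> acts on
  both blocks. Hence the right block records \<open>P * B\<close>, which is what solving
  \<open>A * X = B\<close> needs.\<close>

lemma gauss_jordan_run_hcat:
  assumes A: "A \<in> carrier_mat n k" and B: "B \<in> carrier_mat n b" and N: "n \<le> N" "k + b \<le> N"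
  obtains R S ps P where "computes (gauss_jordan_run (hcat A B) [] [0..<k]) (hcat R S, ps) (4 * N ^ 3)"
    "R \<in> carrier_mat n k" "S \<in> carrier_mat n b" "P \<in> carrier_mat n n" "R = P * A" "S = P * B"
    "row_equiv A R" "reduced_on R ps {..<k}" "\<exists>Q. ps = filter Q [0..<k]"
    "length ps = vec_space.rank n A"
proof -
  have M: "hcat A B \<in> carrier_mat n (k + b)" using A B by simp
  have js: "set [0..<k] \<subseteq> {..<dim_col (hcat A B)}" and dims: "dim_row (hcat A B) \<le> N" "dim_col (hcat A B) \<le> N"
    using A B N by auto
  obtain T ps Q where run: "computes (gauss_jordan_run (hcat A B) [] [0..<k]) (T, ps) (length [0..<k] * (4 * N ^ 2))"
    and eq: "row_equiv (hcat A B) T" and red: "reduced_on T ps ({} \<union> set [0..<k])"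
    and ps: "ps = [] @ filter Q [0..<k]"
    using gauss_jordan_run_spec[OF reduced_on_Nil distinct_upt Int_empty_right js dims] by blast
  obtain P P' where P: "P \<in> carrier_mat n n" and P': "P' \<in> carrier_mat n n"
    and TP: "T = P * hcat A B" and PT: "hcat A B = P' * T"
    using row_equivE[OF eq M] .
  let ?R = "P * A" and ?S = "P * B"
  have T: "T = hcat ?R ?S" unfolding TP by (rule mult_hcat[OF P A B])
  have R: "?R \<in> carrier_mat n k" and S: "?S \<in> carrier_mat n b" using P A B by auto
  have "hcat A B = hcat (P' * ?R) (P' * ?S)" using PT unfolding T mult_hcat[OF P' R S] .
  then have "A = P' * ?R" using hcat_eq_iff[OF A B mult_carrier_mat[OF P' R] mult_carrier_mat[OF P' S]] by simp
  then have eq': "row_equiv A ?R" by (rule row_equivI[OF A P P' refl])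
  have "T $$ (i,j) = ?R $$ (i,j)" if "i < n" "j < k" for i j
    unfolding T using that A P by (auto simp: hcat_def)
  moreover have "ps ! c < k" if "c < length ps" for c using nth_mem[OF that] unfolding ps by simp
  ultimately have red': "reduced_on ?R ps {..<k}" using red A P unfolding reduced_on_def T
    by (auto simp: lessThan_atLeast0)
  have "k * (4 * N ^ 2) \<le> N * (4 * N ^ 2)" using N by (intro mult_le_mono) auto
  then have "computes (gauss_jordan_run (hcat A B) [] [0..<k]) (hcat ?R ?S, ps) (4 * N ^ 3)"
    using run unfolding T by (auto intro: computes_mono simp: power2_eq_square power3_eq_cube mult_ac)
  moreover have "ps = filter Q [0..<k]" using ps by simp
  ultimately show thesis using rank_factorization_of_reduced(4)[OF A eq' red']
    by (intro that[OF _ R S P refl refl eq' red']) (assumption | simp add: exI)+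
qed

lemma gauss_jordan_run_full:
  assumes A: "A \<in> carrier_mat n m" and N: "n \<le> N" "m \<le> N"
  obtains R ps where "computes (gauss_jordan_run A [] [0..<m]) (R, ps) (4 * N ^ 3)"
    "row_equiv A R" "R \<in> carrier_mat n m" "reduced_on R ps {..<m}" "length ps = vec_space.rank n A"
    "length ps \<le> n"
proof -
  \<comment> \<open>Plain elimination is the augmented case with an empty right block.\<close>
  have 0: "0\<^sub>m n 0 \<in> carrier_mat n 0" by simp
  have "m + 0 \<le> N" using N by simp
  from gauss_jordan_run_hcat[OF A 0 N(1) this]
  obtain R S ps P where *: "computes (gauss_jordan_run (hcat A (0\<^sub>m n 0)) [] [0..<m]) (hcat R S, ps) (4 * N ^ 3)"
    "R \<in> carrier_mat n m" "S \<in> carrier_mat n 0"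
    "row_equiv A R" "reduced_on R ps {..<m}" "length ps = vec_space.rank n A"
    by metis
  have "S = 0\<^sub>m n 0" using *(3) by (auto intro!: eq_matI)
  then have "computes (gauss_jordan_run A [] [0..<m]) (R, ps) (4 * N ^ 3)"
    using * hcat_empty[OF A] hcat_empty[OF *(2)] by simp
  moreover have "length ps \<le> n" using *(2,5) unfolding reduced_on_def by auto
  ultimately show thesis using that * by blast
qed

text \<open>The pivot columns are images of \<open>A\<close>, say \<open>U = A * Y\<close>. Then
  \<open>U = U * (X * Y)\<close>, and cancelling \<open>U\<close> shows that \<open>Y\<close> is a
  right inverse of \<open>X\<close>.\<close>

lemma rank_factorization:
  assumes A: "A \<in> carrier_mat n m"
  obtains U X Y where "U \<in> carrier_mat n (vec_space.rank n A)" "X \<in> carrier_mat (vec_space.rank n A) m"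
    "Y \<in> carrier_mat m (vec_space.rank n A)" "left_inv U" "A = U * X" "X * Y = 1\<^sub>m (vec_space.rank n A)"
    "U = A * Y" "vec_space.col_space n U = vec_space.col_space n A"
proof -
  obtain R ps where red: "row_equiv A R" "reduced_on R ps {..<m}" "R \<in> carrier_mat n m"
    and k: "length ps = vec_space.rank n A"
    using gauss_jordan_run_full[OF A, of "n + m"] by (metis le_add1 le_add2)
  note f = rank_factorization_of_reduced[OF A red(1,2), unfolded k]
  let ?U = "select_cols A ps" and ?X = "sub_rows R 0 (vec_space.rank n A)"
  have U: "?U \<in> carrier_mat n (vec_space.rank n A)" and X: "?X \<in> carrier_mat (vec_space.rank n A) m"
    using A red(3) k by (auto simp flip: k)
  obtain Y where Y: "Y \<in> carrier_mat m (vec_space.rank n A)" "?U = A * Y"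
    using col_space_subset_iff[OF U A] f(3) by auto
  have "?U * (?X * Y) = ?U * 1\<^sub>m (vec_space.rank n A)"
    using assoc_mult_mat[OF U X Y(1)] f(2) Y(2) U by (metis right_mult_one_mat)
  then have "?X * Y = 1\<^sub>m (vec_space.rank n A)"
    using left_inv_cancel[OF f(1) U mult_carrier_mat[OF X Y(1)] one_carrier_mat] by simp
  then show thesis using that U X Y f by blast
qed

text \<open>This is how the rank hypothesis yields independent blocks. Comparing with a rank
  factorization \<open>U' * X'\<close> of the same product, with right inverse \<open>Y\<close> of
  \<open>X'\<close> and left inverse \<open>L\<close> of \<open>U'\<close>, gives
  \<open>(L * U) * (X * Y) = 1\<close>. These two matrices are square, so they also commute to the
  identity, which exhibits a left inverse of \<open>U\<close> and a right inverse of
  \<open>X\<close>.\<close>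

lemma full_rank_factors:
  assumes U: "U \<in> carrier_mat n k" and X: "X \<in> carrier_mat k m" and r: "vec_space.rank n (U * X) = k"
  shows "left_inv U" "\<exists>Y \<in> carrier_mat m k. X * Y = 1\<^sub>m k"
proof -
  have A: "U * X \<in> carrier_mat n m" using U X by simp
  obtain U' X' Y where f: "U' \<in> carrier_mat n k" "X' \<in> carrier_mat k m" "Y \<in> carrier_mat m k"
    "left_inv U'" "U * X = U' * X'" "X' * Y = 1\<^sub>m k" "U' = U * X * Y"
    using rank_factorization[OF A, unfolded r] by metis
  obtain L where L: "L \<in> carrier_mat k n" "L * U' = 1\<^sub>m k" using left_invE[OF f(4,1)] .
  have LU: "L * U \<in> carrier_mat k k" and XY: "X * Y \<in> carrier_mat k k" using L(1) U X f(3) by auto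
  have "(L * U) * (X * Y) = L * U'"
    using assoc_mult_mat[OF L(1) U XY] assoc_mult_mat[OF U X f(3)] f(7) by simp
  then have 1: "(L * U) * (X * Y) = 1\<^sub>m k" using L by simp
  then have 2: "(X * Y) * (L * U) = 1\<^sub>m k" by (rule mat_mult_left_right_inverse[OF LU XY])
  have "((X * Y) * L) * U = 1\<^sub>m k" using assoc_mult_mat[OF XY L(1) U] 2 by simp
  then show "left_inv U" using XY L U by (intro left_invI[of "X * Y * L" U k n]) auto
  have "X * (Y * (L * U)) = 1\<^sub>m k" using assoc_mult_mat[OF X f(3) LU] 2 by simp
  then show "\<exists>Y \<in> carrier_mat m k. X * Y = 1\<^sub>m k" using f(3) LU by (meson mult_carrier_mat)
qed

lemma left_inv_if_full_rank:
  assumes U: "U \<in> carrier_mat n k" and r: "vec_space.rank n U = k"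
  shows "left_inv U"
  using full_rank_factors(1)[OF U one_carrier_mat] r U by simp

lemma col_space_hcat:
  fixes A :: "'a::field mat"
  assumes A: "A \<in> carrier_mat n a" and B: "B \<in> carrier_mat n b"
  shows "vec_space.col_space n (hcat A B) =
    module.submodule_sum (module_vec TYPE('a) n) (vec_space.col_space n A) (vec_space.col_space n B)"
proof -
  interpret vec_space "TYPE('a)" n .
  have split: "hcat A B *\<^sub>v (x @\<^sub>v y) = A *\<^sub>v x + B *\<^sub>v y" if "x \<in> carrier_vec a" "y \<in> carrier_vec b" for x y
    using that A B by (intro eq_vecI)
      (auto simp: scalar_prod_def hcat_def sum_scalar_split intro!: arg_cong2[of _ _ _ _ "(+)"] sum.cong)
  have "z \<in> carrier_vec (a + b) \<longleftrightarrow> (\<exists>x\<in>carrier_vec a. \<exists>y\<in>carrier_vec b. z = x @\<^sub>v y)" for z :: "'a vec"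
    by (metis append_carrier_vec vec_first_last_append vec_first_carrier vec_last_carrier)
  then have "(\<lambda>z. hcat A B *\<^sub>v z) ` carrier_vec (a + b)
      = {hcat A B *\<^sub>v (x @\<^sub>v y) | x y. x \<in> carrier_vec a \<and> y \<in> carrier_vec b}"
    unfolding image_def by (intro Collect_cong) metis
  also have "\<dots> = {A *\<^sub>v x + B *\<^sub>v y | x y. x \<in> carrier_vec a \<and> y \<in> carrier_vec b}"
    using split by (metis (no_types, lifting))
  finally show ?thesis unfolding submodule_sum_def col_space_alt[OF A] col_space_alt[OF B]
      col_space_alt[OF hcat_carrier[OF A B]]
    by (auto simp: module_vec_simps image_def)
qed

lemma sum_dim_col_space:
  fixes A :: "'a::field mat"
  assumes A: "A \<in> carrier_mat n a" and B: "B \<in> carrier_mat n b"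
  shows "sum_dim n (vec_space.col_space n A) (vec_space.col_space n B) = vec_space.rank n (hcat A B)"
  unfolding sum_dim_def rank_eq_subspace_dim col_space_hcat[OF A B] ..

section \<open>Kernels and intersections of images\<close>

lemma computes_mat_rank:
  assumes "A \<in> carrier_mat n m" "n \<le> N" "m \<le> N"
  shows "computes (mat_rank A) (vec_space.rank n A) (4 * N ^ 3)"
proof -
  obtain R ps where "computes (gauss_jordan_run A [] [0..<m]) (R, ps) (4 * N ^ 3)"
    "length ps = vec_space.rank n A"
    using gauss_jordan_run_full[OF assms] by metis
  then show ?thesis unfolding mat_rank_def using assms(1) by (intro computes_bind) auto
qed

lemma image_basis_spec:
  assumes A: "A \<in> carrier_mat n m" and N: "n \<le> N" "m \<le> N"
  obtains U where "computes (image_basis A) U (4 * N ^ 3)" "U \<in> carrier_mat n (vec_space.rank n A)" "left_inv U"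
    "vec_space.col_space n U = vec_space.col_space n A" "vec_space.rank n A \<le> n"
proof -
  obtain R ps where g: "computes (gauss_jordan_run A [] [0..<m]) (R, ps) (4 * N ^ 3)"
    "row_equiv A R" "reduced_on R ps {..<m}" "length ps = vec_space.rank n A" "length ps \<le> n"
    using gauss_jordan_run_full[OF A N] by metis
  note f = rank_factorization_of_reduced[OF A g(2,3)]
  have "computes (image_basis A) (select_cols A ps) (4 * N ^ 3)"
    unfolding image_basis_def using A g(1) by (intro computes_bind) (auto simp: select_cols_def)
  then show thesis using that f(1,3) g(4,5) select_cols_carrier[OF A, of ps] by simp
qed

lemma length_takeWhile_nth:
  assumes "distinct ps" "c < length ps"
  shows "length (takeWhile (\<lambda>j. j \<noteq> ps ! c) ps) = c"
proof -
  have "takeWhile (\<lambda>j. j \<noteq> ps ! c) ps = take c ps"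
    using assms by (intro takeWhile_eq_take_P_nth) (auto simp: nth_eq_iff_index_eq)
  then show ?thesis using assms by simp
qed

text \<open>The sum is split into pivot and free columns; unit pivot columns leave a single entry of
  \<open>X\<close>. Thus \<open>R * X = 0\<close> expresses the pivot rows of \<open>X\<close>
  through its free rows.\<close>

lemma index_reduced_mult:
  assumes red: "reduced_on R ps {..<m}" and R: "R \<in> carrier_mat n m" and X: "X \<in> carrier_mat m t"
    and ij: "i < n" "j < t" and fs: "fs = filter (\<lambda>j. j \<notin> set ps) [0..<m]"
  shows "(R * X) $$ (i,j) = (if i < length ps
    then X $$ (ps ! i, j) + (\<Sum>k<length fs. R $$ (i, fs ! k) * X $$ (fs ! k, j)) else 0)"
proof (cases "i < length ps")
  case False
  then have "R $$ (i,c) = 0" if "c < m" for c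
    using red R that ij unfolding reduced_on_def by auto
  then show ?thesis using False ij R X by (simp add: scalar_prod_def)
next
  case True
  have ps: "distinct ps" "set ps \<subseteq> {..<m}" and piv: "\<And>c. c < length ps \<Longrightarrow> R $$ (i, ps ! c) = (if i = c then 1 else 0)"
    using red R ij unfolding reduced_on_def by auto
  have U: "{0..<m} = set ps \<union> set fs" using ps(2) unfolding fs by auto
  have "(R * X) $$ (i,j) = (\<Sum>c\<in>{0..<m}. R $$ (i,c) * X $$ (c,j))"
    using ij R X by (simp add: scalar_prod_def)
  also have "\<dots> = (\<Sum>c\<in>set ps. R $$ (i,c) * X $$ (c,j)) + (\<Sum>c\<in>set fs. R $$ (i,c) * X $$ (c,j))"
    unfolding U by (rule sum.union_disjoint) (auto simp: fs)
  also have "(\<Sum>c\<in>set ps. R $$ (i,c) * X $$ (c,j)) = (\<Sum>k<length ps. R $$ (i,ps ! k) * X $$ (ps ! k,j))"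
    by (rule sum.reindex_bij_betw[OF bij_betw_nth[OF ps(1) refl refl], symmetric])
  also have "\<dots> = (\<Sum>k<length ps. if i = k then X $$ (ps ! i, j) else 0)"
    by (rule sum.cong) (auto simp: piv)
  also have "\<dots> = X $$ (ps ! i, j)" using True by (simp add: sum.delta)
  also have "(\<Sum>c\<in>set fs. R $$ (i,c) * X $$ (c,j)) = (\<Sum>k<length fs. R $$ (i,fs ! k) * X $$ (fs ! k,j))"
    by (rule sum.reindex_bij_betw[OF bij_betw_nth[OF _ refl refl], symmetric]) (simp add: fs)
  finally show ?thesis using True by simp
qed

text \<open>Each free variable in turn is set to 1 and the pivot variables are solved for.
  Completeness is stated for matrices \<open>X\<close> of arbitrary width, as a factorization
  through \<open>K\<close>; the factor consists of the free rows of \<open>X\<close>.\<close>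

lemma kernel_basis_spec:
  assumes A: "A \<in> carrier_mat n m" and N: "n \<le> N" "m \<le> N"
  obtains K where "computes (kernel_basis A) K (5 * N ^ 3)" "K \<in> carrier_mat m (m - vec_space.rank n A)"
    "left_inv K" "A * K = 0\<^sub>m n (m - vec_space.rank n A)" "vec_space.rank n A \<le> m"
    "\<forall>t. \<forall>X \<in> carrier_mat m t. A * X = 0\<^sub>m n t \<longrightarrow> (\<exists>Y \<in> carrier_mat (m - vec_space.rank n A) t. X = K * Y)"
proof -
  obtain R ps where g: "computes (gauss_jordan_run A [] [0..<m]) (R, ps) (4 * N ^ 3)"
    "row_equiv A R" "reduced_on R ps {..<m}" "length ps = vec_space.rank n A"
    and R: "R \<in> carrier_mat n m"
    using gauss_jordan_run_full[OF A N] by metis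
  obtain P Q where P: "P \<in> carrier_mat n n" and Q: "Q \<in> carrier_mat n n"
    and RP: "R = P * A" and AQ: "A = Q * R"
    using row_equivE[OF g(2) A] by metis
  define fs where "fs = filter (\<lambda>j. j \<notin> set ps) [0..<m]"
  define f where "f = length fs"
  have ps: "distinct ps" "set ps \<subseteq> {..<m}" "length ps \<le> n"
    using g(3) R unfolding reduced_on_def by auto
  have ps_m: "length ps \<le> m" using card_mono[OF _ ps(2)] distinct_card[OF ps(1)] by simp
  have "set fs = {..<m} - set ps" by (auto simp: fs_def)
  moreover have dfs: "distinct fs" by (simp add: fs_def)
  ultimately have f: "f = m - length ps"
    using distinct_card[OF dfs] distinct_card[OF ps(1)] ps(2) by (simp add: f_def card_Diff_subset)
  have fs_m: "fs ! k < m" "fs ! k \<notin> set ps" if "k < f" for k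
    using nth_mem[of k fs] that by (auto simp: fs_def f_def)
  have cases: "(\<exists>c<length ps. i = ps ! c) \<or> (\<exists>k<f. i = fs ! k)" if "i < m" for i
  proof -
    have "i \<in> set ps \<or> i \<in> set fs" using that by (auto simp: fs_def)
    then show ?thesis unfolding in_set_conv_nth f_def by metis
  qed
  define K where "K = mat m f (\<lambda>(i,k). if i \<in> set ps then - (R $$ (length (takeWhile (\<lambda>j. j \<noteq> i) ps), fs ! k))
      else if i = fs ! k then 1 else 0)"
  have K: "K \<in> carrier_mat m f" by (simp add: K_def)
  have K_ps: "K $$ (ps ! c, k) = - (R $$ (c, fs ! k))" if "c < length ps" "k < f" for c k
  proof -
    have "ps ! c \<in> set ps" using that by simp
    moreover from this have "ps ! c < m" using ps(2) by auto
    ultimately show ?thesis using that ps(1) by (simp add: K_def length_takeWhile_nth)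
  qed
  have K_fs: "K $$ (fs ! k', k) = (if k = k' then 1 else 0)" if "k < f" "k' < f" for k k'
    using that fs_m[of k'] dfs by (auto simp: K_def f_def nth_eq_iff_index_eq)
  have fN: "f \<le> N" using f N by simp
  have "computes (mat_run m f (\<lambda>i k. if i \<in> set ps
        then sub 0 (R $$ (length (takeWhile (\<lambda>j. j \<noteq> i) ps), fs ! k))
        else ret (if i = fs ! k then 1 else 0))) K (1 * N ^ 2)"
    by (rule mat_run_cost) (use K N fN in \<open>auto simp: K_def computes_def\<close>)
  moreover have "N ^ 2 \<le> N ^ 3" by (cases "N = 0") (auto intro: power_increasing)
  ultimately have "computes (kernel_basis A) K (5 * N ^ 3)"
    unfolding kernel_basis_def f_def fs_def carrier_matD(2)[OF A] Let_def
    by (intro computes_bind[OF g(1), of _ _ "N ^ 2"]) simp_all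
  moreover have "left_inv K"
  proof (rule left_invI[OF _ _ K])
    \<comment> \<open>Selecting the free rows inverts \<open>K\<close>, because \<open>K\<close> is
      the identity there.\<close>
    let ?L = "mat f m (\<lambda>(k,i). if i = fs ! k then 1 else 0 :: 'a)"
    show "?L * K = 1\<^sub>m f"
    proof (rule eq_matI)
      fix k k' assume kk: "k < dim_row (1\<^sub>m f)" "k' < dim_col (1\<^sub>m f)"
      then have "(?L * K) $$ (k,k') = (\<Sum>i = 0..<m. (if i = fs ! k then 1 else 0) * K $$ (i,k'))"
        using K by (simp add: scalar_prod_def)
      also have "\<dots> = (\<Sum>i = 0..<m. if i = fs ! k then K $$ (fs ! k, k') else 0)" by (rule sum.cong) auto
      also have "\<dots> = K $$ (fs ! k, k')" using fs_m[of k] kk by (simp add: sum.delta)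
      finally show "(?L * K) $$ (k,k') = 1\<^sub>m f $$ (k,k')" using kk K_fs by auto
    qed (use K in auto)
  qed simp
  moreover have "A * K = 0\<^sub>m n f"
  proof -
    have "R * K = 0\<^sub>m n f"
    proof (rule eq_matI)
      fix i j assume "i < dim_row (0\<^sub>m n f)" "j < dim_col (0\<^sub>m n f)"
      then have ij: "i < n" "j < f" by auto
      have "(\<Sum>k<length fs. R $$ (i, fs ! k) * K $$ (fs ! k, j)) = (\<Sum>k<f. if k = j then R $$ (i, fs ! j) else 0)"
        unfolding f_def[symmetric] by (rule sum.cong) (auto simp: K_fs ij)
      also have "\<dots> = R $$ (i, fs ! j)" using ij by (simp add: sum.delta)
      finally show "(R * K) $$ (i,j) = 0\<^sub>m n f $$ (i,j)"
        unfolding index_reduced_mult[OF g(3) R K ij fs_def] using ij K_ps by simp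
    qed (use R K in auto)
    then have "Q * (R * K) = 0\<^sub>m n f" using Q by simp
    then show ?thesis using assoc_mult_mat[OF Q R K] AQ by simp
  qed
  moreover have "\<exists>Y \<in> carrier_mat f t. X = K * Y" if X: "X \<in> carrier_mat m t" and AX: "A * X = 0\<^sub>m n t" for X t
  proof -
    have "P * (A * X) = 0\<^sub>m n t" using P unfolding AX by simp
    then have RX: "R * X = 0\<^sub>m n t" using assoc_mult_mat[OF P A X] RP by simp
    define Y where "Y = mat f t (\<lambda>(k,j). X $$ (fs ! k, j))"
    have Y: "Y \<in> carrier_mat f t" by (simp add: Y_def)
    have "X = K * Y"
    proof (rule eq_matI)
      fix i j assume "i < dim_row (K * Y)" "j < dim_col (K * Y)"
      then have ij: "i < m" "j < t" using K Y by auto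
      have KY: "(K * Y) $$ (i,j) = (\<Sum>k<f. K $$ (i,k) * X $$ (fs ! k, j))"
        using ij K Y by (simp add: scalar_prod_def Y_def atLeast0LessThan)
      show "X $$ (i,j) = (K * Y) $$ (i,j)"
      proof (cases "\<exists>c<length ps. i = ps ! c")
        case True
        then obtain c where c: "c < length ps" "i = ps ! c" by blast
        have "c < n" using c ps by simp
        then have "X $$ (ps ! c, j) + (\<Sum>k<f. R $$ (c, fs ! k) * X $$ (fs ! k, j)) = 0"
          using index_reduced_mult[OF g(3) R X _ ij(2) fs_def, of c] c ij RX by (simp add: f_def)
        then have "X $$ (i,j) = - (\<Sum>k<f. R $$ (c, fs ! k) * X $$ (fs ! k, j))"
          unfolding c(2) by (simp add: eq_neg_iff_add_eq_0)
        also have "\<dots> = (\<Sum>k<f. K $$ (i,k) * X $$ (fs ! k, j))"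
          unfolding c(2) by (simp add: K_ps c(1) sum_negf)
        finally show ?thesis unfolding KY .
      next
        case False
        then obtain k0 where k0: "k0 < f" "i = fs ! k0" using cases[OF ij(1)] by blast
        have "(\<Sum>k<f. K $$ (i,k) * X $$ (fs ! k, j)) = (\<Sum>k<f. if k = k0 then X $$ (i,j) else 0)"
          unfolding k0(2) by (rule sum.cong) (auto simp: K_fs k0)
        then show ?thesis unfolding KY using k0(1) by (simp add: sum.delta)
      qed
    qed (use X K Y in auto)
    with Y show ?thesis by blast
  qed
  ultimately show thesis using K ps_m unfolding f g(4) by (intro that) blast+
qed

text \<open>If the columns of \<open>[T; T']\<close> span the kernel of \<open>[A B]\<close>, then
  \<open>A * T = B * (- T')\<close>, and every common value \<open>A * Y = B * Z\<close> factors
  through \<open>A * T\<close>. The last clause is this universal property of the intersection. The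
  width w is still unknown at this point. The cost 11 is 5 for the kernel, 2 for the product and 4
  for the basis.\<close>

lemma inter_basis_spec:
  assumes A: "A \<in> carrier_mat n a" and B: "B \<in> carrier_mat n b" and N: "n \<le> N" "a + b \<le> N"
  obtains W w where "computes (inter_basis A B) W (11 * N ^ 3)" "W \<in> carrier_mat n w" "left_inv W" "w \<le> n"
    "\<exists>X \<in> carrier_mat a w. W = A * X" "\<exists>X \<in> carrier_mat b w. W = B * X"
    "\<forall>t. \<forall>Y \<in> carrier_mat a t. \<forall>Z \<in> carrier_mat b t. A * Y = B * Z \<longrightarrow> (\<exists>G \<in> carrier_mat w t. A * Y = W * G)"
proof -
  have H: "hcat A B \<in> carrier_mat n (a + b)" using A B by simp
  define k where "k = a + b - vec_space.rank n (hcat A B)"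
  obtain K where K: "computes (kernel_basis (hcat A B)) K (5 * N ^ 3)" "K \<in> carrier_mat (a + b) k"
    "left_inv K" "hcat A B * K = 0\<^sub>m n k" "vec_space.rank n (hcat A B) \<le> a + b"
    "\<forall>t. \<forall>X \<in> carrier_mat (a + b) t. hcat A B * X = 0\<^sub>m n t \<longrightarrow> (\<exists>Y \<in> carrier_mat k t. X = K * Y)"
    using kernel_basis_spec[OF H N, folded k_def] .
  have k: "k \<le> N" using N by (simp add: k_def)
  let ?T = "sub_rows K 0 a" and ?B = "sub_rows K a b"
  have T: "?T \<in> carrier_mat a k" and T': "?B \<in> carrier_mat b k" using K(2) by auto
  have KT: "K = vcat ?T ?B" using vcat_sub_rows[OF K(2)] by simp
  have S: "A * ?T \<in> carrier_mat n k" using A T by simp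
  have "A * ?T + B * ?B = 0\<^sub>m n k" using hcat_mult_vcat[OF A B T T'] K(4) KT by simp
  then have ABT: "A * ?T = B * (- ?B)"
    using A B T T' by (simp add: mat_eq_iff) (simp add: eq_neg_iff_add_eq_0)
  obtain W where W: "computes (image_basis (A * ?T)) W (4 * N ^ 3)"
    "W \<in> carrier_mat n (vec_space.rank n (A * ?T))" "left_inv W"
    "vec_space.col_space n W = vec_space.col_space n (A * ?T)" "vec_space.rank n (A * ?T) \<le> n"
    using image_basis_spec[OF S N(1) k] .
  define w where "w = vec_space.rank n (A * ?T)"
  note W = W[folded w_def]
  obtain G where G: "G \<in> carrier_mat k w" "W = (A * ?T) * G"
    using col_space_subset_iff[OF W(2) S] W(4) by auto
  obtain G' where G': "G' \<in> carrier_mat w k" "A * ?T = W * G'"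
    using col_space_subset_iff[OF S W(2)] W(4) by auto
  have "computes (inter_basis A B) W (11 * N ^ 3)"
    unfolding inter_basis_def
  proof (rule computes_bind[OF K(1), of _ _ "6 * N ^ 3"])
    show "computes (mat_mul A (sub_rows K 0 (dim_col A)) \<bind> image_basis) W (6 * N ^ 3)"
      using A T N k W(1) by (intro computes_bind[OF computes_mat_mul[of A n a _ k N]]) auto
  qed simp
  moreover have "W = A * (?T * G)" "W = B * ((- ?B) * G)"
    using G(2) assoc_mult_mat[OF A T G(1)]
      assoc_mult_mat[OF B uminus_carrier_mat[OF T'] G(1)] ABT by simp_all
  moreover have "?T * G \<in> carrier_mat a w" "(- ?B) * G \<in> carrier_mat b w" using T T' G(1) by auto
  moreover have "\<exists>G \<in> carrier_mat w t. A * Y = W * G"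
    if Y: "Y \<in> carrier_mat a t" and Z: "Z \<in> carrier_mat b t" and eq: "A * Y = B * Z" for Y Z t
  proof -
    have "A * Y + B * (- Z) = 0\<^sub>m n t" unfolding eq using B Z by (simp add: mat_eq_iff)
    then have "hcat A B * vcat Y (- Z) = 0\<^sub>m n t" using hcat_mult_vcat[OF A B Y, of "- Z"] Z by simp
    moreover have "vcat Y (- Z) \<in> carrier_mat (a + b) t" using Y Z by simp
    ultimately obtain E where E: "E \<in> carrier_mat k t" "vcat Y (- Z) = K * E" using K(6) by blast
    have "vcat Y (- Z) = vcat (?T * E) (?B * E)" using E(2) KT vcat_mult[OF T T' E(1)] by simp
    then have "Y = ?T * E" using vcat_eq_iff[OF Y _ mult_carrier_mat[OF T E(1)] mult_carrier_mat[OF T' E(1)], of "- Z"] Z by simp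
    then have "A * Y = W * (G' * E)" using assoc_mult_mat[OF A T E(1)] G'(2) assoc_mult_mat[OF W(2) G'(1) E(1)] by simp
    then show ?thesis using G'(1) E(1) by (meson mult_carrier_mat)
  qed
  ultimately show thesis using W(2,3,5) by (intro that) blast+
qed

lemma mult_uminus_eq_iff:
  fixes A :: "'a::field mat"
  assumes "A \<in> carrier_mat n a" "B \<in> carrier_mat n b" "X \<in> carrier_mat a t" "Y \<in> carrier_mat b t"
  shows "A * X = B * Y \<longleftrightarrow> hcat A B * vcat X (- Y) = 0\<^sub>m n t"
proof -
  have "hcat A B * vcat X (- Y) = A * X - B * Y"
    using hcat_mult_vcat[OF assms(1,2,3), of "- Y"] assms by (simp add: minus_add_uminus_mat[of _ n t])
  moreover have "A * X = B * Y \<longleftrightarrow> A * X - B * Y = 0\<^sub>m n t"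
    using assms by (auto simp: mat_eq_iff)
  ultimately show ?thesis by simp
qed

lemma uminus_uminus_mat: "- (- A) = (A :: 'a::field mat)"
  by (rule eq_matI) auto

text \<open>The kernel of \<open>[U V]\<close>, for factors \<open>U\<close>, \<open>V\<close> of \<open>A\<close>, \<open>B\<close> with independent columns, projects
  isomorphically onto the intersection of the images.\<close>

lemma intersection_dimension:
  fixes A :: "'a::field mat"
  assumes A: "A \<in> carrier_mat n a" and B: "B \<in> carrier_mat n b" and W: "W \<in> carrier_mat n w" "left_inv W"
    and WA: "X \<in> carrier_mat a w" "W = A * X" and WB: "X' \<in> carrier_mat b w" "W = B * X'"
    and univ: "\<forall>t. \<forall>Y \<in> carrier_mat a t. \<forall>Z \<in> carrier_mat b t. A * Y = B * Z \<longrightarrow> (\<exists>G \<in> carrier_mat w t. A * Y = W * G)"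
  shows "w + vec_space.rank n (hcat A B) = vec_space.rank n A + vec_space.rank n B"
proof -
  define ra rb where "ra = vec_space.rank n A" and "rb = vec_space.rank n B"
  obtain U X1 Y1 where U: "U \<in> carrier_mat n ra" "X1 \<in> carrier_mat ra a" "Y1 \<in> carrier_mat a ra" "left_inv U"
    "A = U * X1" "X1 * Y1 = 1\<^sub>m ra" "U = A * Y1" "vec_space.col_space n U = vec_space.col_space n A"
    using rank_factorization[OF A, folded ra_def] .
  obtain V X2 Y2 where V: "V \<in> carrier_mat n rb" "X2 \<in> carrier_mat rb b" "Y2 \<in> carrier_mat b rb" "left_inv V"
    "B = V * X2" "X2 * Y2 = 1\<^sub>m rb" "V = B * Y2" "vec_space.col_space n V = vec_space.col_space n B"
    using rank_factorization[OF B, folded rb_def] .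
  have H: "hcat U V \<in> carrier_mat n (ra + rb)" using U(1) V(1) by simp
  have rH: "vec_space.rank n (hcat U V) = vec_space.rank n (hcat A B)"
    by (rule rank_cong_col_space) (simp add: col_space_hcat[OF U(1) V(1)] col_space_hcat[OF A B] U(8) V(8))
  define k where "k = ra + rb - vec_space.rank n (hcat U V)"
  have N: "n \<le> n + (ra + rb)" "ra + rb \<le> n + (ra + rb)" by simp_all
  obtain K where K: "computes (kernel_basis (hcat U V)) K (5 * (n + (ra + rb)) ^ 3)" "K \<in> carrier_mat (ra + rb) k"
    "left_inv K" "hcat U V * K = 0\<^sub>m n k" "vec_space.rank n (hcat U V) \<le> ra + rb"
    "\<forall>t. \<forall>X \<in> carrier_mat (ra + rb) t. hcat U V * X = 0\<^sub>m n t \<longrightarrow> (\<exists>Y \<in> carrier_mat k t. X = K * Y)"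
    using kernel_basis_spec[OF H N, folded k_def] .
  define T T' where "T = sub_rows K 0 ra" and "T' = - sub_rows K ra rb"
  have T: "T \<in> carrier_mat ra k" "T' \<in> carrier_mat rb k" using K(2) by (auto simp: T_def T'_def)
  have KT: "K = vcat T (- T')" using vcat_sub_rows[OF K(2)] by (simp add: T_def T'_def uminus_uminus_mat)
  have UT: "U * T = V * T'" using mult_uminus_eq_iff[OF U(1) V(1) T] K(4) KT by simp
  define S where "S = U * T"
  have S: "S \<in> carrier_mat n k" using U(1) T(1) by (simp add: S_def)
  obtain L1 where L1: "L1 \<in> carrier_mat ra n" "L1 * U = 1\<^sub>m ra" using left_invE[OF U(4,1)] .
  obtain L2 where L2: "L2 \<in> carrier_mat rb n" "L2 * V = 1\<^sub>m rb" using left_invE[OF V(4,1)] .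
  obtain L where L: "L \<in> carrier_mat k (ra + rb)" "L * K = 1\<^sub>m k" using left_invE[OF K(3,2)] .
  have 1: "L1 * S = T" using assoc_mult_mat[OF L1(1) U(1) T(1)] L1(2) T(1) by (simp add: S_def)
  have 2: "L2 * S = T'" using assoc_mult_mat[OF L2(1) V(1) T(2)] L2(2) T(2) by (simp add: S_def UT)
  have LL: "vcat L1 (- L2) \<in> carrier_mat (ra + rb) n" using L1(1) L2(1) by simp
  \<comment> \<open>The kernel basis is recovered from \<open>S\<close> by reading off the
    coordinates with respect to \<open>U\<close> and \<open>V\<close>, so \<open>S\<close> inherits
    a left inverse from \<open>K\<close>.\<close>
  have "vcat L1 (- L2) * S = K"
    using vcat_mult[OF L1(1) _ S, of "- L2"] L2(1) S 1 2 KT by simp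
  then have "(L * vcat L1 (- L2)) * S = 1\<^sub>m k" using assoc_mult_mat[OF L(1) LL S] L(2) by simp
  then have Sinv: "left_inv S" by (rule left_invI[OF _ mult_carrier_mat[OF L(1) LL] S])
  have SA: "S = A * (Y1 * T)" using assoc_mult_mat[OF A U(3) T(1)] U(7) by (simp add: S_def)
  have SB: "S = B * (Y2 * T')" using assoc_mult_mat[OF B V(3) T(2)] V(7) UT by (simp add: S_def)
  have "\<exists>G \<in> carrier_mat w k. S = W * G"
    using univ[rule_format, of "Y1 * T" k "Y2 * T'"] SA SB mult_carrier_mat[OF U(3) T(1)] mult_carrier_mat[OF V(3) T(2)]
    by metis
  then have sub1: "vec_space.col_space n S \<subseteq> vec_space.col_space n W" using col_space_subset_iff[OF S W(1)] by simp
  have XX: "X1 * X \<in> carrier_mat ra w" "X2 * X' \<in> carrier_mat rb w" using U(2) V(2) WA(1) WB(1) by auto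
  have WU: "W = U * (X1 * X)" using assoc_mult_mat[OF U(1,2) WA(1)] WA(2) U(5) by simp
  have WV: "W = V * (X2 * X')" using assoc_mult_mat[OF V(1,2) WB(1)] WB(2) V(5) by simp
  have "hcat U V * vcat (X1 * X) (- (X2 * X')) = 0\<^sub>m n w"
    using mult_uminus_eq_iff[OF U(1) V(1) XX] WU WV by metis
  moreover have "vcat (X1 * X) (- (X2 * X')) \<in> carrier_mat (ra + rb) w" using XX by simp
  ultimately obtain E where E: "E \<in> carrier_mat k w" "vcat (X1 * X) (- (X2 * X')) = K * E" using K(6) by blast
  have T2: "- T' \<in> carrier_mat rb k" using T by simp
  have "vcat (X1 * X) (- (X2 * X')) = vcat (T * E) (- T' * E)" using E(2) KT vcat_mult[OF T(1) T2 E(1)] by simp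
  then have "X1 * X = T * E"
    using vcat_eq_iff[OF XX(1) _ mult_carrier_mat[OF T(1) E(1)] mult_carrier_mat[OF T2 E(1)], of "- (X2 * X')"] XX(2) by simp
  then have "W = S * E" using WU assoc_mult_mat[OF U(1) T(1) E(1)] by (simp add: S_def)
  then have "vec_space.col_space n W \<subseteq> vec_space.col_space n S" using col_space_subset_iff[OF W(1) S] E(1) by blast
  then have "vec_space.rank n W = vec_space.rank n S" using sub1 by (intro rank_cong_col_space) simp
  then have "w = k" using left_inv_imp_indpt(3)[OF W(2,1)] left_inv_imp_indpt(3)[OF Sinv S] by simp
  then show ?thesis using K(5) rH unfolding k_def ra_def rb_def by simp
qed

section \<open>Linear systems\<close>

lemma filter_eq_self_if_length: "length (filter P xs) = length xs \<Longrightarrow> filter P xs = xs"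
  by (metis filter_True length_filter_less less_irrefl)

text \<open>With independent columns every column of \<open>A\<close> is a pivot, so elimination
  turns \<open>A\<close> into the identity above zero rows. The right-hand side becomes
  \<open>X\<close> above zero rows: the consistency test passes and \<open>X\<close> can be read
  off.\<close>

lemma computes_solve:
  assumes A: "A \<in> carrier_mat n k" "left_inv A" and X: "X \<in> carrier_mat k b" and N: "n \<le> N" "k + b \<le> N"
  shows "computes (solve A (A * X)) X (5 * N ^ 3)"
proof -
  have B: "A * X \<in> carrier_mat n b" using A(1) X by simp
  obtain R S ps P where g: "computes (gauss_jordan_run (hcat A (A * X)) [] [0..<k]) (hcat R S, ps) (4 * N ^ 3)"
    "R \<in> carrier_mat n k" "S \<in> carrier_mat n b" "P \<in> carrier_mat n n" "R = P * A" "S = P * (A * X)"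
    "row_equiv A R" "reduced_on R ps {..<k}" "\<exists>Q. ps = filter Q [0..<k]"
    "length ps = vec_space.rank n A"
    using gauss_jordan_run_hcat[OF A(1) B N] .
  have len: "length ps = k" using g(10) left_inv_imp_indpt(3)[OF A(2,1)] by simp
  \<comment> \<open>A filtered list of full length is the whole list, so pivot k sits in column
    k.\<close>
  then have ps: "ps = [0..<k]" using g(9) filter_eq_self_if_length by (metis diff_zero length_upt)
  have kn: "k \<le> n" using g(2,8) len unfolding reduced_on_def by auto
  have R: "R $$ (i,c) = (if i = c then 1 else 0)" if "i < n" "c < k" for i c
    using g(2,8) that unfolding reduced_on_def ps by auto
  have "S = R * X" using g(5,6) assoc_mult_mat[OF g(4) A(1) X] by simp
  then have S: "S $$ (i,j) = (if i < k then X $$ (i,j) else 0)" if "i < n" "j < b" for i j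
  proof -
    have "S $$ (i,j) = (\<Sum>c = 0..<k. (if i = c then 1 else 0) * X $$ (c,j))"
      unfolding \<open>S = R * X\<close> using that g(2) X by (simp add: scalar_prod_def R)
    also have "\<dots> = (\<Sum>c = 0..<k. if i = c then X $$ (i,j) else 0)" by (rule sum.cong) auto
    finally show ?thesis by (simp add: sum.delta)
  qed
  have RS: "hcat R S $$ (i, k + j) = (if i < k then X $$ (i,j) else 0)" if "i < n" "j < b" for i j
    using that g(2,3) S by (simp add: hcat_def)
  have "\<forall>i\<in>set [length ps..<n]. \<forall>j\<in>set [k..<k + b]. hcat R S $$ (i,j) = 0"
  proof (intro ballI)
    fix i j assume "i \<in> set [length ps..<n]" "j \<in> set [k..<k + b]"
    then show "hcat R S $$ (i,j) = 0" using RS[of i "j - k"] len by auto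
  qed
  then have z: "computes (all_zero (hcat R S) [length ps..<n] [k..<k + b]) True (N ^ 2)"
    using computes_all_zero[of "[length ps..<n]" N "[k..<k + b]" "hcat R S"] N by simp
  have res: "mat k b (\<lambda>(i,j). hcat R S $$ (i, k + j)) = X"
    using X RS kn by (intro eq_matI) auto
  have "N ^ 2 \<le> N ^ 3" by (cases "N = 0") (auto intro: power_increasing)
  then show ?thesis
    unfolding solve_def Let_def carrier_matD[OF A(1)] carrier_matD[OF B]
    by (intro computes_bind[OF g(1), of _ _ "N ^ 2"])
      (use z in \<open>auto simp: len res computes_def\<close>)
qed

lemma run_ensures_solve:
  assumes A: "A \<in> carrier_mat n k" and B: "B \<in> carrier_mat n b" and N: "n \<le> N" "k + b \<le> N"
  shows "run_ensures (solve A B) (5 * N ^ 3) (\<lambda>X. X \<in> carrier_mat k b)"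
proof -
  obtain R S ps where g: "computes (gauss_jordan_run (hcat A B) [] [0..<k]) (hcat R S, ps) (4 * N ^ 3)"
    using gauss_jordan_run_hcat[OF A B N] by metis
  have z: "computes (all_zero (hcat R S) [length ps..<n] [k..<k + b])
      (\<forall>i\<in>set [length ps..<n]. \<forall>j\<in>set [k..<k + b]. hcat R S $$ (i,j) = 0) (N ^ 2)"
    using N by (intro computes_all_zero) auto
  have "N ^ 2 \<le> N ^ 3" by (cases "N = 0") (auto intro: power_increasing)
  then show ?thesis
    unfolding solve_def Let_def carrier_matD[OF A] carrier_matD[OF B]
    by (intro run_ensures_computes[OF g, of _ "N ^ 2"])
      (auto intro!: run_ensures_computes[OF z, of _ 0] run_ensures_require run_ensures_ret)
qed

text \<open>Transposition turns the right inverse of \<open>C\<close> into the left inverse that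
  \<open>computes_solve\<close> asks for.\<close>

lemma computes_solve_left:
  assumes C: "C \<in> carrier_mat s m" and X: "X \<in> carrier_mat t s" and Y: "Y \<in> carrier_mat m s" "C * Y = 1\<^sub>m s"
    and N: "m \<le> N" "s + t \<le> N"
  shows "computes (solve_left C (X * C)) X (5 * N ^ 3)"
proof -
  have CT: "transpose_mat C \<in> carrier_mat m s" and XT: "transpose_mat X \<in> carrier_mat s t"
    and YT: "transpose_mat Y \<in> carrier_mat s m" using C X Y by auto
  have "transpose_mat Y * transpose_mat C = 1\<^sub>m s"
    using transpose_mult[OF C Y(1)] Y(2) by (simp add: transpose_one)
  then have "left_inv (transpose_mat C)" by (rule left_invI[OF _ YT CT])
  from computes_solve[OF CT this XT N]
  have "computes (solve (transpose_mat C) (transpose_mat (X * C))) (transpose_mat X) (5 * N ^ 3)"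
    by (simp add: transpose_mult[OF X C])
  then show ?thesis unfolding solve_left_def by (intro computes_bind[where b = 0]) auto
qed

lemma run_ensures_solve_left:
  assumes C: "C \<in> carrier_mat s m" and B: "B \<in> carrier_mat t m" and N: "m \<le> N" "s + t \<le> N"
  shows "run_ensures (solve_left C B) (5 * N ^ 3) (\<lambda>X. X \<in> carrier_mat t s)"
  unfolding solve_left_def
  by (rule run_ensures_bind[OF run_ensures_solve[of _ m s _ t N], where b = 0])
    (use assms in \<open>auto intro: run_ensures_ret\<close>)

text \<open>The system has matrix \<open>[U -V]\<close>, and the sign passes to the coordinate map
  of \<open>V\<close>: a left inverse is \<open>[L1; -L2]\<close>.\<close>

lemma computes_solve_diff:
  assumes U: "U \<in> carrier_mat n u" and V: "V \<in> carrier_mat n v"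
    and X: "X \<in> carrier_mat u m" and Y: "Y \<in> carrier_mat v m"
    and L: "L1 \<in> carrier_mat u n" "L2 \<in> carrier_mat v n"
      "L1 * U = 1\<^sub>m u" "L1 * V = 0\<^sub>m u v" "L2 * U = 0\<^sub>m v u" "L2 * V = 1\<^sub>m v"
    and N: "n \<le> N" "u + v + m \<le> N"
  shows "computes (solve_diff U V (U * X - V * Y)) (X, Y) (6 * N ^ 3)"
proof -
  have V': "- V \<in> carrier_mat n v" and L2': "- L2 \<in> carrier_mat v n" using V L by auto
  have H: "hcat U (- V) \<in> carrier_mat n (u + v)" and XY: "vcat X Y \<in> carrier_mat (u + v) m" using U V X Y by auto
  have "vcat L1 (- L2) * hcat U (- V) = 1\<^sub>m (u + v)"
    unfolding vcat_mult_hcat_eq_one_iff[OF L(1) L2' U V'] using L U V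
    by (auto simp: uminus_uminus_mat)
  then have inv: "left_inv (hcat U (- V))" by (rule left_invI[OF _ vcat_carrier[OF L(1) L2'] H])
  have "hcat U (- V) * vcat X Y = U * X - V * Y"
    using hcat_mult_vcat[OF U V' X Y] U V X Y by (simp add: minus_add_uminus_mat[of _ n m])
  then have 1: "computes (solve (hcat U (- V)) (U * X - V * Y)) (vcat X Y) (5 * N ^ 3)"
    using computes_solve[OF H inv XY N(1)] N(2) by simp
  have 2: "computes (mat_neg V) (- V) (N ^ 3)" using computes_mat_neg[OF V] N by simp
  show ?thesis unfolding solve_diff_def carrier_matD[OF U] carrier_matD[OF V]
    by (rule computes_bind[OF 2, where b = "5 * N ^ 3"], rule computes_bind[OF 1, where b = 0])
      (use X Y in auto)
qed

lemma run_ensures_solve_diff: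
  assumes U: "U \<in> carrier_mat n u" and V: "V \<in> carrier_mat n v" and M: "M \<in> carrier_mat n m"
    and N: "n \<le> N" "u + v + m \<le> N"
  shows "run_ensures (solve_diff U V M) (6 * N ^ 3) (\<lambda>(X, Y). X \<in> carrier_mat u m \<and> Y \<in> carrier_mat v m)"
proof -
  have 2: "computes (mat_neg V) (- V) (N ^ 3)" using computes_mat_neg[OF V] N by simp
  have V': "- V \<in> carrier_mat n v" using V by simp
  show ?thesis unfolding solve_diff_def carrier_matD[OF U] carrier_matD[OF V]
    by (rule run_ensures_computes[OF 2, where b = "5 * N ^ 3"],
        rule run_ensures_bind[OF run_ensures_solve[OF hcat_carrier[OF U V'] M N], where b = 0])
      (auto intro!: run_ensures_ret)
qed

lemma computes_split_diff:
  assumes U: "U \<in> carrier_mat n u" and V: "V \<in> carrier_mat n v"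
    and X: "X \<in> carrier_mat u m" and Y: "Y \<in> carrier_mat v m"
    and L: "L1 \<in> carrier_mat u n" "L2 \<in> carrier_mat v n"
      "L1 * U = 1\<^sub>m u" "L1 * V = 0\<^sub>m u v" "L2 * U = 0\<^sub>m v u" "L2 * V = 1\<^sub>m v"
    and N: "n \<le> N" "u + v + m \<le> N"
  shows "computes (split_diff U V (U * X - V * Y)) (U * X, V * Y) (10 * N ^ 3)"
proof -
  note 1 = computes_solve_diff[OF assms]
  have 2: "computes (mat_mul U X) (U * X) (2 * N ^ 3)" "computes (mat_mul V Y) (V * Y) (2 * N ^ 3)"
    using U V X Y N by (auto intro!: computes_mat_mul)
  show ?thesis unfolding split_diff_def
    by (rule computes_bind[OF 1, where b = "4 * N ^ 3"], simp, rule computes_bind[OF 2(1), where b = "2 * N ^ 3"],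
        rule computes_bind[OF 2(2), where b = 0]) auto
qed

lemma run_ensures_split_diff:
  fixes U :: "'a::field mat"
  assumes U: "U \<in> carrier_mat n u" and V: "V \<in> carrier_mat n v" and M: "M \<in> carrier_mat n m"
    and N: "n \<le> N" "u + v + m \<le> N"
  shows "run_ensures (split_diff U V M) (10 * N ^ 3) (\<lambda>(P, Q). P \<in> carrier_mat n m \<and> Q \<in> carrier_mat n m)"
  unfolding split_diff_def
proof (rule run_ensures_bind[OF run_ensures_solve_diff[OF assms], where b = "4 * N ^ 3"], clarify)
  fix X Y :: "'a mat" assume X: "X \<in> carrier_mat u m" and Y: "Y \<in> carrier_mat v m"
  have 2: "computes (mat_mul U X) (U * X) (2 * N ^ 3)" "computes (mat_mul V Y) (V * Y) (2 * N ^ 3)"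
    using U V X Y N by (auto intro!: computes_mat_mul)
  show "run_ensures (mat_mul U X \<bind> (\<lambda>P. mat_mul V Y \<bind> (\<lambda>Q. ret (P, Q)))) (4 * N ^ 3)
      (\<lambda>(P, Q). P \<in> carrier_mat n m \<and> Q \<in> carrier_mat n m)"
    by (rule run_ensures_computes[OF 2(1), where b = "2 * N ^ 3"],
        rule run_ensures_computes[OF 2(2), where b = 0]) (use U V X Y in \<open>auto intro!: run_ensures_ret\<close>)
qed simp

section \<open>The three-matrix procedure\<close>

lemma basis_matrix_left_inv:
  assumes "left_inv W" "W \<in> carrier_mat n s"
  shows "basis_matrix n W (vec_space.col_space n W)"
  using left_inv_imp_indpt[OF assms] assms(2) unfolding basis_matrix_def by auto

text \<open>Whatever basis is chosen in Step 1, comparing ranks forces its number of columns, and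
  full column rank supplies a left inverse.\<close>

lemma left_inv_basis_matrix:
  fixes B :: "'a::field mat"
  assumes B: "basis_matrix n B (vec_space.col_space n W)" and W: "left_inv W" "W \<in> carrier_mat n s"
  shows "left_inv B" "B \<in> carrier_mat n s"
proof -
  have c: "B \<in> carrier_mat n (dim_col B)" using B by (auto simp: basis_matrix_def)
  have "vec_space.rank n B = dim_col B"
    using vec_space.lin_indpt_full_rank[OF c] B unfolding basis_matrix_def by blast
  moreover have "vec_space.rank n B = vec_space.rank n W"
    using B by (intro rank_cong_col_space) (simp add: basis_matrix_def)
  ultimately have "dim_col B = s" using left_inv_imp_indpt(3)[OF W] by simp
  with c show c': "B \<in> carrier_mat n s" by simp
  with \<open>vec_space.rank n B = dim_col B\<close> show "left_inv B" by (intro left_inv_if_full_rank[of _ n s]) auto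
qed

text \<open>Each matrix factors through the other, and cancelling \<open>B\<close> makes the two
  square factors mutually inverse.\<close>

lemma change_of_basis:
  assumes W: "left_inv W" "W \<in> carrier_mat n s" and B: "left_inv B" "B \<in> carrier_mat n s"
    and eq: "vec_space.col_space n W = vec_space.col_space n B"
  obtains G H where "G \<in> carrier_mat s s" "H \<in> carrier_mat s s" "W = B * G" "G * H = 1\<^sub>m s" "H * G = 1\<^sub>m s"
proof -
  obtain G where G: "G \<in> carrier_mat s s" "W = B * G" using col_space_subset_iff[OF W(2) B(2)] eq by auto
  obtain H where H: "H \<in> carrier_mat s s" "B = W * H" using col_space_subset_iff[OF B(2) W(2)] eq by auto
  have "B * (G * H) = B * 1\<^sub>m s" using assoc_mult_mat[OF B(2) G(1) H(1)] G(2) H(2) B(2) by (metis right_mult_one_mat)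
  then have GH: "G * H = 1\<^sub>m s"
    by (rule left_inv_cancel[OF B mult_carrier_mat[OF G(1) H(1)] one_carrier_mat])
  show thesis by (rule that[OF G(1) H(1) G(2) GH mat_mult_left_right_inverse[OF G(1) H(1) GH]])
qed

text \<open>The matrix is \<open>[B' -B] * [C; C']\<close> with inner size 2s, so rank 2s gives
  \<open>[C; C']\<close> a right inverse. Its column blocks separate the two factors:
  \<open>Y\<close> sees only \<open>C\<close>, and \<open>Y'\<close> only \<open>C'\<close>.\<close>

lemma right_inv_of_full_rank:
  fixes B :: "'a::field mat"
  assumes B: "B \<in> carrier_mat n s" "B' \<in> carrier_mat n s" and C: "C \<in> carrier_mat s m" "C' \<in> carrier_mat s m"
    and r: "vec_space.rank n (B' * C - B * C') = 2 * s"
  obtains Y Y' where "Y \<in> carrier_mat m s" "Y' \<in> carrier_mat m s" "C * Y = 1\<^sub>m s" "C * Y' = 0\<^sub>m s s"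
    "C' * Y = 0\<^sub>m s s" "C' * Y' = 1\<^sub>m s"
proof -
  have B': "- B \<in> carrier_mat n s" using B by simp
  have "hcat B' (- B) * vcat C C' = B' * C - B * C'"
    using hcat_mult_vcat[OF B(2) B' C] B C by (simp add: minus_add_uminus_mat[of _ n m])
  then have "vec_space.rank n (hcat B' (- B) * vcat C C') = s + s" using r by simp
  then obtain Z where Z: "Z \<in> carrier_mat m (s + s)" "vcat C C' * Z = 1\<^sub>m (s + s)"
    using full_rank_factors(2)[OF hcat_carrier[OF B(2) B'] vcat_carrier[OF C]] by blast
  define Y Y' where "Y = mat m s (\<lambda>(i,j). Z $$ (i,j))" and "Y' = mat m s (\<lambda>(i,j). Z $$ (i,s + j))"
  have Y: "Y \<in> carrier_mat m s" "Y' \<in> carrier_mat m s" by (auto simp: Y_def Y'_def)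
  have "Z = hcat Y Y'" using Z(1) by (auto simp: hcat_def Y_def Y'_def intro!: eq_matI)
  then show thesis using Z(2) vcat_mult_hcat_eq_one_iff[OF C Y] that[OF Y] by metis
qed

text \<open>Dual bases: the rows of \<open>L\<close> and \<open>M\<close> are the coordinate
  functionals of the columns of \<open>U\<close> and \<open>V\<close>, so the columns of
  \<open>[U V]\<close> are independent.\<close>

definition dual :: "nat \<Rightarrow> nat \<Rightarrow> 'a::field mat \<Rightarrow> 'a mat \<Rightarrow> 'a mat \<Rightarrow> 'a mat \<Rightarrow> bool" where
  "dual n s U V L M \<longleftrightarrow> U \<in> carrier_mat n s \<and> V \<in> carrier_mat n s \<and> L \<in> carrier_mat s n \<and> M \<in> carrier_mat s n \<and>
     L * U = 1\<^sub>m s \<and> L * V = 0\<^sub>m s s \<and> M * U = 0\<^sub>m s s \<and> M * V = 1\<^sub>m s"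

lemma dual_commute: "dual n s U V L M \<Longrightarrow> dual n s V U M L"
  by (auto simp: dual_def)

text \<open>One inclusion: some \<open>Y\<close> kills \<open>C1\<close> and inverts
  \<open>C2\<close>, so \<open>K * Y = - B1\<close>, and likewise for \<open>K'\<close>. The other:
  applied to a common element, \<open>L2\<close> gives \<open>C1 * X\<close> when it is read as
  \<open>K * X\<close>, but 0 when it is read as \<open>K' * X'\<close>; hence
  \<open>C1 * X = 0\<close> and only the \<open>B1\<close> term survives.\<close>

lemma image_inter_of_full_rank:
  fixes B1 :: "'a::field mat"
  assumes d: "dual n s B2 B1 L2 L1" "dual n s B2 B3 L2 L3"
    and C: "C1 \<in> carrier_mat s n" "C2 \<in> carrier_mat s n" "C3 \<in> carrier_mat s n"
    and K: "K = B2 * C1 - B1 * C2" "K' = B3 * C1 - B1 * C3"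
    and r: "vec_space.rank n K = 2 * s" "vec_space.rank n K' = 2 * s" and N: "2 * n \<le> N"
  obtains W where "computes (inter_basis K K') W (11 * N ^ 3)" "W \<in> carrier_mat n s" "left_inv W"
    "vec_space.col_space n W = vec_space.col_space n B1"
proof -
  note c = d[unfolded dual_def]
  have B1: "B1 \<in> carrier_mat n s" and B2: "B2 \<in> carrier_mat n s" and B3: "B3 \<in> carrier_mat n s"
    and L1: "L1 \<in> carrier_mat s n" and L2: "L2 \<in> carrier_mat s n" using c by auto
  have KK: "K \<in> carrier_mat n n" "K' \<in> carrier_mat n n" using B1 B2 B3 C unfolding K by (auto simp: minus_carrier_mat)
  have expand: "(B * E - B1 * F) * X = B * (E * X) - B1 * (F * X)"
    if "B \<in> carrier_mat n s" "E \<in> carrier_mat s n" "F \<in> carrier_mat s n" "X \<in> carrier_mat n t" for B E F X t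
    using that B1 by (simp add: minus_mult_distrib_mat[of _ n n] assoc_mult_mat[of _ n s _ n _ t])
  obtain Y where Y: "Y \<in> carrier_mat n s" "C1 * Y = 0\<^sub>m s s" "C2 * Y = 1\<^sub>m s"
    using right_inv_of_full_rank[OF B1 B2 C(1,2)] r(1) unfolding K by metis
  obtain Y' where Y': "Y' \<in> carrier_mat n s" "C1 * Y' = 0\<^sub>m s s" "C3 * Y' = 1\<^sub>m s"
    using right_inv_of_full_rank[OF B1 B3 C(1,3)] r(2) unfolding K by metis
  have KY: "K * Y = - B1" unfolding K(1) expand[OF B2 C(1,2) Y(1)] Y(2,3) using B1 B2 by (auto simp: mat_eq_iff)
  have KY': "K' * Y' = - B1" unfolding K(2) expand[OF B3 C(1,3) Y'(1)] Y'(2,3) using B1 B3 by (auto simp: mat_eq_iff)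
  have N': "n \<le> N" "n + n \<le> N" using N by auto
  obtain W w where W: "computes (inter_basis K K') W (11 * N ^ 3)" "W \<in> carrier_mat n w" "left_inv W" "w \<le> n"
    "\<exists>X \<in> carrier_mat n w. W = K * X" "\<exists>X \<in> carrier_mat n w. W = K' * X"
    "\<forall>t. \<forall>Y \<in> carrier_mat n t. \<forall>Z \<in> carrier_mat n t. K * Y = K' * Z \<longrightarrow> (\<exists>G \<in> carrier_mat w t. K * Y = W * G)"
    using inter_basis_spec[OF KK N'] .
  obtain G where G: "G \<in> carrier_mat w s" "- B1 = W * G" using W(7) Y(1) Y'(1) KY KY' by metis
  have "B1 = W * (- G)" using G W(2) by (metis uminus_uminus_mat uminus_mult_right_mat carrier_matD)
  then have sub1: "vec_space.col_space n B1 \<subseteq> vec_space.col_space n W"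
    using col_space_subset_iff[OF B1 W(2)] G(1) by (metis uminus_carrier_iff_mat)
  obtain X X' where X: "X \<in> carrier_mat n w" "W = K * X" and X': "X' \<in> carrier_mat n w" "W = K' * X'"
    using W(5,6) by blast
  have annih: "L2 * (B2 * M - B1 * M') = M" "L2 * (B3 * M - B1 * M') = 0\<^sub>m s w"
    if M: "M \<in> carrier_mat s w" "M' \<in> carrier_mat s w" for M M'
  proof -
    have z: "L2 * (B * M) = L2 * B * M" "L2 * (B * M') = L2 * B * M'" if "B \<in> carrier_mat n s" for B
      using assoc_mult_mat[OF L2 that M(1)] assoc_mult_mat[OF L2 that M(2)] by simp_all
    have "L2 * (B2 * M - B1 * M') = L2 * (B2 * M) - L2 * (B1 * M')"
      by (rule mult_minus_distrib_mat[OF L2 mult_carrier_mat[OF B2 M(1)] mult_carrier_mat[OF B1 M(2)]])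
    then have "L2 * (B2 * M - B1 * M') = M - 0\<^sub>m s w" using d M unfolding z(2)[OF B1] z(1)[OF B2] dual_def by simp
    then show "L2 * (B2 * M - B1 * M') = M" using M by (auto simp: mat_eq_iff)
    have "L2 * (B3 * M - B1 * M') = L2 * (B3 * M) - L2 * (B1 * M')"
      by (rule mult_minus_distrib_mat[OF L2 mult_carrier_mat[OF B3 M(1)] mult_carrier_mat[OF B1 M(2)]])
    then have "L2 * (B3 * M - B1 * M') = 0\<^sub>m s w - 0\<^sub>m s w" using d M unfolding z(2)[OF B1] z(1)[OF B3] dual_def by simp
    then show "L2 * (B3 * M - B1 * M') = 0\<^sub>m s w" by (auto simp: mat_eq_iff)
  qed
  have WX: "W = B2 * (C1 * X) - B1 * (C2 * X)" using X(2) expand[OF B2 C(1,2) X(1)] unfolding K by simp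
  have WX': "W = B3 * (C1 * X') - B1 * (C3 * X')" using X'(2) expand[OF B3 C(1,3) X'(1)] unfolding K by simp
  have "L2 * W = C1 * X" unfolding WX by (rule annih(1)[OF mult_carrier_mat[OF C(1) X(1)] mult_carrier_mat[OF C(2) X(1)]])
  moreover have "L2 * W = 0\<^sub>m s w" unfolding WX' by (rule annih(2)[OF mult_carrier_mat[OF C(1) X'(1)] mult_carrier_mat[OF C(3) X'(1)]])
  ultimately have CX: "C1 * X = 0\<^sub>m s w" by simp
  have CX2: "C2 * X \<in> carrier_mat s w" using C X by simp
  have "W = - (B1 * (C2 * X))" using WX unfolding CX using B1 B2 CX2 by (auto simp: mat_eq_iff)
  also have "\<dots> = B1 * (- (C2 * X))"
    using carrier_matD(2)[OF B1] carrier_matD(1)[OF CX2] by (intro uminus_mult_right_mat[symmetric]) metis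
  finally have "vec_space.col_space n W \<subseteq> vec_space.col_space n B1"
    using col_space_subset_iff[OF W(2) B1] CX2 by (metis uminus_carrier_iff_mat)
  then have eq: "vec_space.col_space n W = vec_space.col_space n B1" using sub1 by simp
  have "left_inv B1" using c by (auto intro!: left_invI[of L1 B1 s n])
  then have "w = s" using left_inv_imp_indpt(3)[OF W(3,2)] left_inv_imp_indpt(3)[of B1 n s] B1 rank_cong_col_space[OF eq] by simp
  then show thesis using that W eq by blast
qed

text \<open>The program knows only some bases \<open>U\<close>, \<open>V\<close> of the images of
  the blocks \<open>U0\<close>, \<open>V0\<close>. The coefficients depend on that choice, but the
  two summands do not: with \<open>U = U0 * G\<close> and H the inverse of G,
  \<open>U * (H * X) = U0 * X\<close>.\<close>

lemma computes_split_diff_change: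
  assumes d: "dual n s U0 V0 L M" and U: "left_inv U" "U \<in> carrier_mat n s" "vec_space.col_space n U = vec_space.col_space n U0"
    and V: "left_inv V" "V \<in> carrier_mat n s" "vec_space.col_space n V = vec_space.col_space n V0"
    and X: "X \<in> carrier_mat s m" and Y: "Y \<in> carrier_mat s m"
    and N: "n \<le> N" "2 * s + m \<le> N"
  shows "computes (split_diff U V (U0 * X - V0 * Y)) (U0 * X, V0 * Y) (10 * N ^ 3)"
proof -
  have c: "U0 \<in> carrier_mat n s" "V0 \<in> carrier_mat n s" "L \<in> carrier_mat s n" "M \<in> carrier_mat s n"
     "L * U0 = 1\<^sub>m s" "L * V0 = 0\<^sub>m s s" "M * U0 = 0\<^sub>m s s" "M * V0 = 1\<^sub>m s"
    using d unfolding dual_def by auto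
  obtain G H where G: "G \<in> carrier_mat s s" "H \<in> carrier_mat s s" "U = U0 * G" "G * H = 1\<^sub>m s" "H * G = 1\<^sub>m s"
    using change_of_basis[OF U(1,2) left_invI[OF c(5,3,1)] c(1) U(3)] .
  obtain G' H' where G': "G' \<in> carrier_mat s s" "H' \<in> carrier_mat s s" "V = V0 * G'" "G' * H' = 1\<^sub>m s" "H' * G' = 1\<^sub>m s"
    using change_of_basis[OF V(1,2) left_invI[OF c(8,4,2)] c(2) V(3)] .
  have mid: "(P * Q) * (R * T) = P * (Q * R) * T"
    if "P \<in> carrier_mat s s" "Q \<in> carrier_mat s n" "R \<in> carrier_mat n s" "T \<in> carrier_mat s s" for P Q R T :: "'a mat"
    using that by (simp add: assoc_mult_mat[of _ s s _ n _ s] assoc_mult_mat[of _ s n _ s _ s] assoc_mult_mat[of _ s s _ s _ s])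
  have inv: "P * E * (F * X) = P * X" if "P \<in> carrier_mat n s" "E \<in> carrier_mat s s" "F \<in> carrier_mat s s"
    "E * F = 1\<^sub>m s" "X \<in> carrier_mat s m" for P E F X :: "'a mat"
    using that assoc_mult_mat[OF that(2,3,5)]
    by (simp add: assoc_mult_mat[OF that(1,2) mult_carrier_mat[OF that(3,5)]])
  have UX: "U * (H * X) = U0 * X" unfolding G(3) by (rule inv[OF c(1) G(1,2,4) X])
  have VY: "V * (H' * Y) = V0 * Y" unfolding G'(3) by (rule inv[OF c(2) G'(1,2,4) Y])
  have "computes (split_diff U V (U * (H * X) - V * (H' * Y))) (U * (H * X), V * (H' * Y)) (10 * N ^ 3)"
  proof (rule computes_split_diff[OF U(2) V(2) mult_carrier_mat[OF G(2) X] mult_carrier_mat[OF G'(2) Y]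
        mult_carrier_mat[OF G(2) c(3)] mult_carrier_mat[OF G'(2) c(4)]])
    show "H * L * U = 1\<^sub>m s" unfolding G(3) mid[OF G(2) c(3,1) G(1)] c(5) using G by simp
    show "H * L * V = 0\<^sub>m s s" unfolding G'(3) mid[OF G(2) c(3,2) G'(1)] c(6) using G(2) G'(1) by simp
    show "H' * M * U = 0\<^sub>m s s" unfolding G(3) mid[OF G'(2) c(4,1) G(1)] c(7) using G(1) G'(2) by simp
    show "H' * M * V = 1\<^sub>m s" unfolding G'(3) mid[OF G'(2) c(4,2) G'(1)] c(8) using G' by simp
  qed (use N in auto)
  then show ?thesis unfolding UX VY .
qed

lemma commutator_swap:
  fixes A :: "'a::field mat"
  assumes "A \<in> carrier_mat n n" "A' \<in> carrier_mat n n" "B \<in> carrier_mat n s" "B' \<in> carrier_mat n s"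
    "C \<in> carrier_mat s n" "C' \<in> carrier_mat s n" "commutator A A' = B' * C - B * C'"
  shows "commutator A' A = B * C' - B' * C"
proof -
  have "commutator A' A = - commutator A A'" using assms(1,2) by (auto simp: commutator_def mat_eq_iff)
  also have "\<dots> = B * C' - B' * C" unfolding assms(7) using assms(3-6) by (auto simp: mat_eq_iff)
  finally show ?thesis .
qed

text \<open>The two commutators side by side equal \<open>[B1 B2 B3]\<close> times the 3s x 2n
  matrix with block rows \<open>(-C2, -C3)\<close>, \<open>(C1, 0)\<close>, \<open>(0, C1)\<close>.
  Rank 3s therefore makes \<open>[B1 B2 B3]\<close> left invertible, and the three row blocks of a
  left inverse serve all three pairs at once.\<close>

lemma dual_of_full_rank:
  fixes B1 :: "'a::field mat"
  assumes B: "B1 \<in> carrier_mat n s" "B2 \<in> carrier_mat n s" "B3 \<in> carrier_mat n s"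
    and C: "C1 \<in> carrier_mat s n" "C2 \<in> carrier_mat s n" "C3 \<in> carrier_mat s n"
    and r: "vec_space.rank n (hcat (B2 * C1 - B1 * C2) (B3 * C1 - B1 * C3)) = 3 * s"
  obtains L1 L2 L3 where "dual n s B1 B2 L1 L2" "dual n s B1 B3 L1 L3" "dual n s B2 B3 L2 L3"
proof -
  let ?C = "vcat (hcat (- C2) (- C3)) (vcat (hcat C1 (0\<^sub>m s n)) (hcat (0\<^sub>m s n) C1))"
  let ?B = "hcat B1 (hcat B2 B3)"
  have C': "- C2 \<in> carrier_mat s n" "- C3 \<in> carrier_mat s n" using C by auto
  have z: "0\<^sub>m s n \<in> carrier_mat s n" by simp
  have Bc: "?B \<in> carrier_mat n (s + (s + s))" and Cc: "?C \<in> carrier_mat (s + (s + s)) (n + n)" using B C by auto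
  have "?B * ?C = B1 * hcat (- C2) (- C3) + (B2 * hcat C1 (0\<^sub>m s n) + B3 * hcat (0\<^sub>m s n) C1)"
    using hcat_mult_vcat[OF B(1) hcat_carrier[OF B(2,3)] hcat_carrier[OF C'] vcat_carrier[OF hcat_carrier[OF C(1) z] hcat_carrier[OF z C(1)]]]
      hcat_mult_vcat[OF B(2,3) hcat_carrier[OF C(1) z] hcat_carrier[OF z C(1)]] by simp
  also have "\<dots> = hcat (B2 * C1 - B1 * C2) (B3 * C1 - B1 * C3)"
    unfolding mult_hcat[OF B(1) C'] mult_hcat[OF B(2) C(1) z] mult_hcat[OF B(3) z C(1)]
    using B C by (intro eq_matI) (auto simp: hcat_def)
  finally have "vec_space.rank n (?B * ?C) = s + (s + s)" using r by simp
  then have "left_inv ?B" by (rule full_rank_factors(1)[OF Bc Cc])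
  then obtain L where L: "L \<in> carrier_mat (s + (s + s)) n" "L * ?B = 1\<^sub>m (s + (s + s))" using left_invE[OF _ Bc] by blast
  define L1 M where "L1 = sub_rows L 0 s" and "M = sub_rows L s (s + s)"
  define L2 L3 where "L2 = sub_rows M 0 s" and "L3 = sub_rows M s s"
  have c: "L1 \<in> carrier_mat s n" "M \<in> carrier_mat (s + s) n" "L2 \<in> carrier_mat s n" "L3 \<in> carrier_mat s n"
    using L(1) by (auto simp: L1_def M_def L2_def L3_def sub_rows_def)
  have LM: "L = vcat L1 M" and M: "M = vcat L2 L3"
    using vcat_sub_rows[OF L(1)] vcat_sub_rows[OF c(2)] by (auto simp: L1_def M_def L2_def L3_def)
  have 1: "L1 * B1 = 1\<^sub>m s" "L1 * hcat B2 B3 = 0\<^sub>m s (s + s)" "M * B1 = 0\<^sub>m (s + s) s" "M * hcat B2 B3 = 1\<^sub>m (s + s)"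
    using L(2) vcat_mult_hcat_eq_one_iff[OF c(1,2) B(1) hcat_carrier[OF B(2,3)]] unfolding LM by auto
  have 2: "L2 * B2 = 1\<^sub>m s" "L2 * B3 = 0\<^sub>m s s" "L3 * B2 = 0\<^sub>m s s" "L3 * B3 = 1\<^sub>m s"
    using 1(4) vcat_mult_hcat_eq_one_iff[OF c(3,4) B(2,3)] unfolding M by auto
  have zz: "0\<^sub>m s s \<in> carrier_mat s s" by simp
  have zero: "hcat (0\<^sub>m s s) (0\<^sub>m s s) = (0\<^sub>m s (s + s) :: 'a mat)" "vcat (0\<^sub>m s s) (0\<^sub>m s s) = (0\<^sub>m (s + s) s :: 'a mat)"
    by (auto simp: hcat_def vcat_def intro!: eq_matI)
  have "hcat (L1 * B2) (L1 * B3) = hcat (0\<^sub>m s s) (0\<^sub>m s s)"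
    unfolding zero using 1(2) mult_hcat[OF c(1) B(2,3)] by simp
  then have 3: "L1 * B2 = 0\<^sub>m s s" "L1 * B3 = 0\<^sub>m s s"
    using hcat_eq_iff[OF mult_carrier_mat[OF c(1) B(2)] mult_carrier_mat[OF c(1) B(3)] zz zz] by auto
  have "vcat (L2 * B1) (L3 * B1) = vcat (0\<^sub>m s s) (0\<^sub>m s s)"
    unfolding zero using 1(3) vcat_mult[OF c(3,4) B(1)] unfolding M by simp
  then have 4: "L2 * B1 = 0\<^sub>m s s" "L3 * B1 = 0\<^sub>m s s"
    using vcat_eq_iff[OF mult_carrier_mat[OF c(3) B(1)] mult_carrier_mat[OF c(4) B(1)] zz zz] by auto
  show thesis by (rule that[of L1 L2 L3]) (use B c 1 2 3 4 in \<open>simp_all add: dual_def\<close>)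
qed

section \<open>The rank hypothesis for three matrices and its effect on Steps 1-8\<close>

definition triple_ranks :: "nat \<Rightarrow> nat \<Rightarrow> 'a::field mat \<Rightarrow> 'a mat \<Rightarrow> 'a mat \<Rightarrow> bool" where
  "triple_ranks n s A1 A2 A3 \<longleftrightarrow>
     vec_space.rank n (commutator A1 A2) = 2 * s \<and>
     vec_space.rank n (commutator A1 A3) = 2 * s \<and>
     vec_space.rank n (commutator A2 A3) = 2 * s \<and>
     vec_space.rank n (hcat (commutator A1 A2) (commutator A1 A3)) = 3 * s \<and>
     vec_space.rank n (hcat (commutator A2 A1) (commutator A2 A3)) = 3 * s \<and>
     vec_space.rank n (hcat (commutator A3 A1) (commutator A3 A2)) = 3 * s"

lemma hyp_H_iff_triple_ranks:
  assumes "A k \<in> carrier_mat n n" "A l \<in> carrier_mat n n" "A m \<in> carrier_mat n n"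
  shows "hyp_H n r A k l m \<longleftrightarrow> triple_ranks n (r - n) (A k) (A l) (A m)"
  using assms unfolding hyp_H_def triple_ranks_def Im_comm_def
  by (simp add: sum_dim_col_space[of _ n n _ n] rank_eq_subspace_dim[symmetric])

lemma rank_le_dim_row: "A \<in> carrier_mat n m \<Longrightarrow> vec_space.rank n A \<le> n"
  by (rule image_basis_spec[of A n m "n + m"]) auto

text \<open>Bounds the number of added rows by the given size, so that every cost can be expressed
  without r.\<close>

lemma triple_ranks_size:
  assumes "triple_ranks n s A1 A2 A3" "A1 \<in> carrier_mat n n" "A2 \<in> carrier_mat n n"
  shows "2 * s \<le> n"
  using rank_le_dim_row[of "commutator A1 A2" n n] assms by (simp add: triple_ranks_def)

lemma rank_commutator_swap:
  fixes A :: "'a::field mat"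
  assumes A: "A \<in> carrier_mat n n" and B: "B \<in> carrier_mat n n"
  shows "vec_space.rank n (commutator B A) = vec_space.rank n (commutator A B)"
proof (rule rank_cong_col_space)
  have sub: "vec_space.col_space n (commutator B A) \<subseteq> vec_space.col_space n (commutator A B)"
    if A: "A \<in> carrier_mat n n" and B: "B \<in> carrier_mat n n" for A B :: "'a mat"
  proof -
    have "commutator B A = - commutator A B" using A B by (auto simp: commutator_def mat_eq_iff)
    also have "\<dots> = commutator A B * (- 1\<^sub>m n)" using commutator_carrier[OF A B] by simp
    finally show ?thesis
      using col_space_subset_iff[OF commutator_carrier[OF B A] commutator_carrier[OF A B]] by auto
  qed
  show "vec_space.col_space n (commutator B A) = vec_space.col_space n (commutator A B)"
    using sub[OF A B] sub[OF B A] by simp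
qed

text \<open>No extension is assumed: the width of \<open>B1\<close> comes from the dimension
  formula, 2s + 2s - 3s = s, and soundness depends on this. The elimination basis \<open>W\<close>
  is exposed so that, when an extension exists, the image of \<open>B1\<close> can later be
  identified with that of its first block.\<close>

lemma step1_spec:
  assumes A: "A1 \<in> carrier_mat n n" "A2 \<in> carrier_mat n n" "A3 \<in> carrier_mat n n"
    and r: "triple_ranks n s A1 A2 A3" and bas: "basis_choice n bas" and N: "2 * n \<le> N"
  obtains B1 W where "computes (step1 bas A1 A2 A3) B1 (21 * N ^ 3)" "B1 \<in> carrier_mat n s" "left_inv B1"
    "computes (inter_basis (commutator A1 A2) (commutator A1 A3)) W (11 * N ^ 3)"
    "vec_space.col_space n B1 = vec_space.col_space n W"
proof -
  let ?K = "commutator A1 A2" and ?K' = "commutator A1 A3"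
  have K: "?K \<in> carrier_mat n n" "?K' \<in> carrier_mat n n" using A by auto
  have N': "n \<le> N" "n + n \<le> N" using N by auto
  obtain W w where W: "computes (inter_basis ?K ?K') W (11 * N ^ 3)" "W \<in> carrier_mat n w" "left_inv W" "w \<le> n"
    "\<exists>X \<in> carrier_mat n w. W = ?K * X" "\<exists>X \<in> carrier_mat n w. W = ?K' * X"
    "\<forall>t. \<forall>Y \<in> carrier_mat n t. \<forall>Z \<in> carrier_mat n t. ?K * Y = ?K' * Z \<longrightarrow> (\<exists>G \<in> carrier_mat w t. ?K * Y = W * G)"
    using inter_basis_spec[OF K N'] .
  obtain X X' where X: "X \<in> carrier_mat n w" "W = ?K * X" "X' \<in> carrier_mat n w" "W = ?K' * X'" using W(5,6) by blast
  have "w + vec_space.rank n (hcat ?K ?K') = vec_space.rank n ?K + vec_space.rank n ?K'"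
    by (rule intersection_dimension[OF K W(2,3) X W(7)])
  then have w: "w = s" using r by (simp add: triple_ranks_def)
  have b: "basis_matrix n (bas W) (vec_space.col_space n W)"
    using bas basis_matrix_left_inv[OF W(3,2)] unfolding basis_choice_def by blast
  note B = left_inv_basis_matrix[OF b W(3,2)[unfolded w]]
  have "computes (step1 bas A1 A2 A3) (bas W) (21 * N ^ 3)" unfolding step1_def
    by (rule computes_bind[OF computes_mat_comm[OF A(1,2) N'(1)], where b = "16 * N ^ 3"],
        rule computes_bind[OF computes_mat_comm[OF A(1,3) N'(1)], where b = "11 * N ^ 3"],
        rule computes_bind[OF W(1), where b = 0]) auto
  moreover have "vec_space.col_space n (bas W) = vec_space.col_space n W" using b by (simp add: basis_matrix_def)
  ultimately show thesis using that B W(1) by blast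
qed

text \<open>Only the block relations of a commuting triple enter. Independence of the
  \<open>B\<close> blocks makes each decomposition unique, and right inverses of \<open>C2\<close>,
  \<open>C3\<close> make the left-sided systems unique. The further conclusions serve the change of
  basis before the run (\<open>B1\<close> and the image of \<open>W\<close>) and Step 8
  (\<open>B2\<close>).\<close>

lemma steps2_7_complete:
  fixes A1 :: "'a::field mat"
  assumes A: "A1 \<in> carrier_mat n n" "A2 \<in> carrier_mat n n" "A3 \<in> carrier_mat n n"
    and B: "B1 \<in> carrier_mat n s" "B2 \<in> carrier_mat n s" "B3 \<in> carrier_mat n s"
    and C: "C1 \<in> carrier_mat s n" "C2 \<in> carrier_mat s n" "C3 \<in> carrier_mat s n"
    and D: "D2 \<in> carrier_mat s s" "D3 \<in> carrier_mat s s"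
    and a12: "commutator A1 A2 = B2 * C1 - B1 * C2" and a13: "commutator A1 A3 = B3 * C1 - B1 * C3"
    and a23: "commutator A2 A3 = B3 * C2 - B2 * C3" and b23: "A2 * B3 - A3 * B2 = B3 * D2 - B2 * D3"
    and r: "triple_ranks n s A1 A2 A3" and C1: "C1_known = None \<or> C1_known = Some C1"
  shows "outcome (steps2_7 A1 A2 A3 B1 C1_known) = Some (C1, (B2, C2, D2), (B3, C3, D3))"
    and "left_inv B1" "left_inv B2"
    and "\<And>W N. computes (inter_basis (commutator A1 A2) (commutator A1 A3)) W N \<Longrightarrow>
      vec_space.col_space n W = vec_space.col_space n B1"
proof -
  define N where "N = 3 * n"
  have s: "2 * s \<le> n" by (rule triple_ranks_size[OF r A(1,2)])
  have N: "2 * n \<le> N" "n \<le> N" "2 * s + n \<le> N" "s + n \<le> N" "s + s + s \<le> N" using s by (auto simp: N_def)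
  note a21 = commutator_swap[OF A(1,2) B(1,2) C(1,2) a12]
    and a31 = commutator_swap[OF A(1,3) B(1,3) C(1,3) a13]
    and a32 = commutator_swap[OF A(2,3) B(2,3) C(2,3) a23]
  have rk: "vec_space.rank n (commutator A1 A2) = 2 * s" "vec_space.rank n (commutator A1 A3) = 2 * s"
    "vec_space.rank n (commutator A2 A3) = 2 * s" "vec_space.rank n (commutator A2 A1) = 2 * s"
    "vec_space.rank n (commutator A3 A1) = 2 * s" "vec_space.rank n (commutator A3 A2) = 2 * s"
    using r rank_commutator_swap[OF A(1,2)] rank_commutator_swap[OF A(1,3)] rank_commutator_swap[OF A(2,3)]
    by (auto simp: triple_ranks_def)
  have "vec_space.rank n (hcat (B2 * C1 - B1 * C2) (B3 * C1 - B1 * C3)) = 3 * s"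
    using r by (simp add: triple_ranks_def a12 a13)
  then obtain L1 L2 L3 where d: "dual n s B1 B2 L1 L2" "dual n s B1 B3 L1 L3" "dual n s B2 B3 L2 L3"
    using dual_of_full_rank[OF B C] by metis
  note d' = d[THEN dual_commute]
  have inv: "left_inv B1" "left_inv B2" "left_inv B3"
    using d unfolding dual_def by (auto intro: left_invI[of L1 B1 s n] left_invI[of L2 B2 s n] left_invI[of L3 B3 s n])
  show "left_inv B1" "left_inv B2" by (rule inv)+
  \<comment> \<open>Right inverses of \<open>C2\<close> and \<open>C3\<close> are what the systems
    \<open>B3 * C2 = N3\<close> and \<open>B2 * C3 = N2\<close> require.\<close>
  obtain Y2 where Y2: "Y2 \<in> carrier_mat n s" "C2 * Y2 = 1\<^sub>m s"
    using right_inv_of_full_rank[OF B(1,2) C(1,2) rk(1)[unfolded a12]] by metis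
  obtain Y3 where Y3: "Y3 \<in> carrier_mat n s" "C3 * Y3 = 1\<^sub>m s"
    using right_inv_of_full_rank[OF B(1,3) C(1,3) rk(2)[unfolded a13]] by metis
  obtain V1 where V1: "computes (inter_basis (commutator A1 A2) (commutator A1 A3)) V1 (11 * N ^ 3)"
    "V1 \<in> carrier_mat n s" "left_inv V1" "vec_space.col_space n V1 = vec_space.col_space n B1"
    using image_inter_of_full_rank[OF d'(1) d(3) C(1,2,3) a12 a13 rk(1,2) N(1)] .
  show "vec_space.col_space n W = vec_space.col_space n B1"
    if "computes (inter_basis (commutator A1 A2) (commutator A1 A3)) W N" for W N
    using V1(1,4) that by (simp add: computes_def)
  \<comment> \<open>The intersection result again, with the roles of the indices permuted.
    \<open>V2\<close> and \<open>V3\<close> need only have the images of \<open>B2\<close> and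
    \<open>B3\<close>.\<close>
  obtain V2 where V2: "computes (inter_basis (commutator A2 A1) (commutator A2 A3)) V2 (11 * N ^ 3)"
    "V2 \<in> carrier_mat n s" "left_inv V2" "vec_space.col_space n V2 = vec_space.col_space n B2"
    using image_inter_of_full_rank[OF d(1,2) C(2,1,3) a21 a23 rk(4,3) N(1)] .
  obtain V3 where V3: "computes (inter_basis (commutator A3 A1) (commutator A3 A2)) V3 (11 * N ^ 3)"
    "V3 \<in> carrier_mat n s" "left_inv V3" "vec_space.col_space n V3 = vec_space.col_space n B3"
    using image_inter_of_full_rank[OF d(2) d(1) C(3,1,2) a31 a32 rk(5,6) N(1)] .
  note split = computes_split_diff_change[THEN computes_outcome]
  have o_comm: "outcome (mat_comm X Y) = Some (commutator X Y)" if "X \<in> carrier_mat n n" "Y \<in> carrier_mat n n" for X Y :: "'a mat"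
    by (rule computes_outcome[OF computes_mat_comm[OF that order.refl]])
  have o1: "outcome (split_diff V2 B1 (commutator A1 A2)) = Some (B2 * C1, B1 * C2)"
    unfolding a12 by (rule split[OF d'(1) V2(3,2,4) inv(1) B(1) refl C(1,2) N(2,3)])
  have o2: "outcome (split_diff V3 V2 (commutator A2 A3)) = Some (B3 * C2, B2 * C3)"
    unfolding a23 by (rule split[OF d'(3) V3(3,2,4) V2(3,2,4) C(2,3) N(2,3)])
  have o3: "outcome (split_diff V3 B1 (commutator A1 A3)) = Some (B3 * C1, B1 * C3)"
    unfolding a13 by (rule split[OF d'(2) V3(3,2,4) inv(1) B(1) refl C(1,3) N(2,3)])
  have o4: "outcome (solve B1 (B1 * C2)) = Some C2" "outcome (solve B3 (B3 * C1)) = Some C1"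
    "outcome (solve B1 (B1 * C3)) = Some C3"
    using computes_solve[OF _ _ _ N(2,4), THEN computes_outcome] inv B C by blast+
  have o5: "outcome (solve_left C2 (B3 * C2)) = Some B3" "outcome (solve_left C3 (B2 * C3)) = Some B2"
    using computes_solve_left[OF C(2) B(3) Y2 N(2,4), THEN computes_outcome]
      computes_solve_left[OF C(3) B(2) Y3 N(2,4), THEN computes_outcome] by auto
  have o6: "outcome (mat_mul A2 B3) = Some (A2 * B3)" "outcome (mat_mul A3 B2) = Some (A3 * B2)"
    using computes_mat_mul[of _ n n _ s N, THEN computes_outcome] A B N by auto
  have o7: "outcome (mat_sub (A2 * B3) (A3 * B2)) = Some (A2 * B3 - A3 * B2)"
    using computes_mat_sub[of "A2 * B3" n s "A3 * B2" N, THEN computes_outcome] A B N by auto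
  have o8: "outcome (solve_diff B3 B2 (A2 * B3 - A3 * B2)) = Some (D2, D3)"
    unfolding b23 using d'(3) unfolding dual_def
    by (intro computes_solve_diff[OF B(3,2) D, of L3 L2, OF _ _ _ _ _ _ N(2,5), THEN computes_outcome]) auto
  have o9: "outcome (case C1_known of None \<Rightarrow> solve B3 (B3 * C1) | Some C \<Rightarrow> ret C) = Some C1"
    using C1 o4 by auto
  show "outcome (steps2_7 A1 A2 A3 B1 C1_known) = Some (C1, (B2, C2, D2), (B3, C3, D3))"
    unfolding steps2_7_def
    by (simp only: outcome_bind option.case prod.case o_comm[OF A(1,2)] o_comm[OF A(2,1)] o_comm[OF A(2,3)]
      o_comm[OF A(3,1)] o_comm[OF A(3,2)] o_comm[OF A(1,3)] computes_outcome[OF V2(1)] computes_outcome[OF V3(1)]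
      o1 o2 o3 o4 o5 o6 o7 o8 o9 outcome_ret)
qed

text \<open>Bookkeeping by remaining budget: each step subtracts its price, so a long chain leaves
  only subtractions of numerals.\<close>

lemma run_ensures_budget:
  assumes "run_ensures f (a * M) P" "\<And>x. P x \<Longrightarrow> run_ensures (g x) ((c - a) * M) Q" "a \<le> c"
  shows "run_ensures (bind_run f g) (c * M) Q"
  by (rule run_ensures_bind[OF assms(1,2)]) (simp_all add: assms(3) flip: add_mult_distrib)

lemma computes_budget:
  assumes "computes f x (a * M)" "run_ensures (g x) ((c - a) * M) Q" "a \<le> c"
  shows "run_ensures (bind_run f g) (c * M) Q"
  by (rule run_ensures_computes[OF assms(1), where g = g, OF assms(2)])
    (simp add: assms(3) flip: add_mult_distrib)

text \<open>Sizes and cost without any solvability. The constant 118 is six commutators at 5, two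
  intersections at 11, three decompositions at 10, five systems at 5, two products at 2, one
  subtraction at 1 and the system of Step 7 at 6.\<close>

lemma run_ensures_steps2_7:
  fixes A1 :: "'a::field mat"
  assumes A: "A1 \<in> carrier_mat n n" "A2 \<in> carrier_mat n n" "A3 \<in> carrier_mat n n"
    and B1: "B1 \<in> carrier_mat n s" and C1: "\<And>C. C1_known = Some C \<Longrightarrow> C \<in> carrier_mat s n"
    and N: "3 * n \<le> N" and s: "s \<le> n"
  shows "run_ensures (steps2_7 A1 A2 A3 B1 C1_known) (118 * N ^ 3)
    (\<lambda>(C1, (B2, C2, D2), (B3, C3, D3)). C1 \<in> carrier_mat s n \<and>
       B2 \<in> carrier_mat n s \<and> C2 \<in> carrier_mat s n \<and> D2 \<in> carrier_mat s s \<and>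
       B3 \<in> carrier_mat n s \<and> C3 \<in> carrier_mat s n \<and> D3 \<in> carrier_mat s s)"
proof -
  have N1: "n \<le> N" "n + n \<le> N" "s \<le> N" "s + n \<le> N" "s + s + s \<le> N" using N s by auto
  have N2: "v + s + n \<le> N" if "v \<le> n" for v using that N s by simp
  \<comment> \<open>Here the intersection bases are only known to have at most n columns each. With
    the n columns of the right-hand side, the widest augmented system has 3n columns, which explains
    the bound \<open>3 * n \<le> N\<close>.\<close>
  have N3: "v + w + n \<le> N" if "v \<le> n" "w \<le> n" for v w using that N by simp
  note K = computes_mat_comm[OF _ _ N1(1)]
  have inter: "\<exists>V v. computes (inter_basis (commutator X Y) (commutator X Z)) V (11 * N ^ 3) \<and> V \<in> carrier_mat n v \<and> v \<le> n"
    if "X \<in> carrier_mat n n" "Y \<in> carrier_mat n n" "Z \<in> carrier_mat n n" for X Y Z :: "'a mat"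
    using inter_basis_spec[OF commutator_carrier[OF that(1,2)] commutator_carrier[OF that(1,3)] N1(1,2)] by metis
  obtain V2 v2 where V2: "computes (inter_basis (commutator A2 A1) (commutator A2 A3)) V2 (11 * N ^ 3)"
    "V2 \<in> carrier_mat n v2" "v2 \<le> n" using inter[OF A(2,1,3)] by blast
  obtain V3 v3 where V3: "computes (inter_basis (commutator A3 A1) (commutator A3 A2)) V3 (11 * N ^ 3)"
    "V3 \<in> carrier_mat n v3" "v3 \<le> n" using inter[OF A(3,1,2)] by blast
  note split = run_ensures_split_diff[OF _ _ _ N1(1)]
  show ?thesis
    unfolding steps2_7_def
    apply (rule computes_budget[OF K[OF A(1,2)]])
    apply (rule computes_budget[OF K[OF A(2,1)]])
    apply (rule computes_budget[OF K[OF A(2,3)]])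
    apply (rule computes_budget[OF V2(1)])
    apply (rule run_ensures_budget[OF split[OF V2(2) B1 commutator_carrier[OF A(1,2)] N2[OF V2(3)]]], clarify)
    apply (rule run_ensures_budget[OF run_ensures_solve[OF B1 _ N1(1,4)]], assumption)
    apply (rule computes_budget[OF K[OF A(3,1)]])
    apply (rule computes_budget[OF K[OF A(3,2)]])
    apply (rule computes_budget[OF V3(1)])
    apply (rule run_ensures_budget[OF split[OF V3(2) V2(2) commutator_carrier[OF A(2,3)] N3[OF V3(3) V2(3)]]], clarify)
    apply (rule run_ensures_budget[OF run_ensures_solve_left[OF _ _ N1(1,4)]], assumption, assumption)
    apply (rule computes_budget[OF K[OF A(1,3)]])
    apply (rule run_ensures_budget[OF split[OF V3(2) B1 commutator_carrier[OF A(1,3)] N2[OF V3(3)]]], clarify)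
    \<comment> \<open>One price for both cases: solving for \<open>C1\<close>, or passing on the
      known block for free.\<close>
    apply (rule run_ensures_budget[where a = 5 and P = "\<lambda>C. C \<in> carrier_mat s n"])
    subgoal using C1 run_ensures_solve[OF _ _ N1(1,4)]
      by (cases C1_known) (auto intro!: run_ensures_ret)
    apply (rule run_ensures_budget[OF run_ensures_solve[OF B1 _ N1(1,4)]], assumption)
    apply (rule run_ensures_budget[OF run_ensures_solve_left[OF _ _ N1(1,4)]], assumption, assumption)
    apply (rule computes_budget[OF computes_mat_mul[OF A(2) _ N1(1,3,1)]], assumption)
    apply (rule computes_budget[OF computes_mat_mul[OF A(3) _ N1(1,3,1)]], assumption)
    apply (rule computes_budget[where a = 1], simp,
        rule computes_mat_sub[OF mult_carrier_mat[OF A(2)] mult_carrier_mat[OF A(3)] N1(1,3)], assumption, assumption)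
    apply (rule run_ensures_budget[OF run_ensures_solve_diff[OF _ _
            minus_carrier_mat[OF mult_carrier_mat[OF A(3)]] N1(1,5)]], assumption, assumption, assumption, clarify)
    apply (rule run_ensures_ret, simp)
    apply simp_all
    done
qed

lemma step8_complete:
  fixes A1 :: "'a::field mat"
  assumes A: "A1 \<in> carrier_mat n n" "A2 \<in> carrier_mat n n"
    and B: "B1 \<in> carrier_mat n s" "B2 \<in> carrier_mat n s" "left_inv B2"
    and D: "D1 \<in> carrier_mat s s" "D2 \<in> carrier_mat s s"
    and b12: "A1 * B2 - A2 * B1 = B2 * D1 - B1 * D2"
  shows "outcome (step8 A1 A2 B1 B2 D2) = Some D1"
proof -
  define N where "N = n + s + s"
  have N: "n \<le> N" "s \<le> N" "s + s \<le> N" by (auto simp: N_def)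
  have "A1 * B2 - A2 * B1 + B1 * D2 = B2 * D1" unfolding b12 using B D by (auto simp: mat_eq_iff)
  then have "outcome (solve B2 (A1 * B2 - A2 * B1 + B1 * D2)) = Some D1"
    using computes_solve[OF B(2,3) D(1) N(1,3), THEN computes_outcome] by simp
  moreover have "outcome (mat_mul A1 B2) = Some (A1 * B2)" "outcome (mat_mul A2 B1) = Some (A2 * B1)"
    "outcome (mat_mul B1 D2) = Some (B1 * D2)"
    using computes_mat_mul[THEN computes_outcome, of _ _ _ _ _ N] A B D N by blast+
  moreover have "outcome (mat_sub (A1 * B2) (A2 * B1)) = Some (A1 * B2 - A2 * B1)"
    using computes_mat_sub[of "A1 * B2" n s "A2 * B1" N, THEN computes_outcome] A B N by auto
  moreover have "outcome (mat_add (A1 * B2 - A2 * B1) (B1 * D2)) = Some (A1 * B2 - A2 * B1 + B1 * D2)"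
    using computes_mat_add[of "A1 * B2 - A2 * B1" n s "B1 * D2" N, THEN computes_outcome] A B D N
    by (auto simp: minus_carrier_mat)
  ultimately show ?thesis unfolding step8_def by (simp only: outcome_bind option.case)
qed

lemma run_ensures_step8:
  fixes A1 :: "'a::field mat"
  assumes A: "A1 \<in> carrier_mat n n" "A2 \<in> carrier_mat n n"
    and B: "B1 \<in> carrier_mat n s" "B2 \<in> carrier_mat n s" and D: "D2 \<in> carrier_mat s s"
    and N: "n \<le> N" "s + s \<le> N"
  shows "run_ensures (step8 A1 A2 B1 B2 D2) (13 * N ^ 3) (\<lambda>D1. D1 \<in> carrier_mat s s)"
proof -
  have s: "s \<le> N" using N by simp
  note c = mult_carrier_mat[OF A(1) B(2)] mult_carrier_mat[OF A(2) B(1)] mult_carrier_mat[OF B(1) D]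
  show ?thesis
    unfolding step8_def
    apply (rule computes_budget[OF computes_mat_mul[OF A(1) B(2) N(1) s N(1)]])
    apply (rule computes_budget[OF computes_mat_mul[OF A(2) B(1) N(1) s N(1)]])
    apply (rule computes_budget[where a = 1], simp, rule computes_mat_sub[OF c(1,2) N(1) s])
    apply (rule computes_budget[OF computes_mat_mul[OF B(1) D N(1) s s]])
    apply (rule computes_budget[where a = 1], simp,
        rule computes_mat_add[OF minus_carrier_mat[OF c(2)] c(3) N(1) s])
    apply (rule run_ensures_mono[OF run_ensures_solve[OF B(2) add_carrier_mat[OF c(3)] N]])
    apply simp_all
    done
qed

section \<open>Commuting extensions\<close>

lemma four_block_mat_eq_vcat:
  assumes "A \<in> carrier_mat n n" "B \<in> carrier_mat n s" "C \<in> carrier_mat s n" "D \<in> carrier_mat s s"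
  shows "four_block_mat A B C D = vcat (hcat A B) (hcat C D)"
  using assms by (intro eq_matI) (auto simp: vcat_def hcat_def)

lemma four_block_mat_eqD:
  assumes "A \<in> carrier_mat n n" "B \<in> carrier_mat n s" "C \<in> carrier_mat s n" "D \<in> carrier_mat s s"
    and "A' \<in> carrier_mat n n" "B' \<in> carrier_mat n s" "C' \<in> carrier_mat s n" "D' \<in> carrier_mat s s"
    and "four_block_mat A B C D = four_block_mat A' B' C' D'"
  shows "A = A'" "B = B'"
  using assms(9) vcat_eq_iff[of "hcat A B" n "n + s" "hcat C D" s "hcat A' B'" "hcat C' D'"]
    hcat_eq_iff[OF assms(1,2,5,6)]
  unfolding four_block_mat_eq_vcat[OF assms(1-4)] four_block_mat_eq_vcat[OF assms(5-8)]
  using assms(1-8) by auto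

text \<open>The two relations are the upper left and the upper right block of the commutation
  equation, with the terms sorted by side.\<close>

lemma commuting_blocks:
  fixes A :: "'a::field mat"
  assumes c: "A \<in> carrier_mat n n" "B \<in> carrier_mat n s" "C \<in> carrier_mat s n" "D \<in> carrier_mat s s"
    and c': "A' \<in> carrier_mat n n" "B' \<in> carrier_mat n s" "C' \<in> carrier_mat s n" "D' \<in> carrier_mat s s"
    and eq: "four_block_mat A B C D * four_block_mat A' B' C' D' = four_block_mat A' B' C' D' * four_block_mat A B C D"
  shows "commutator A A' = B' * C - B * C'" "A * B' - A' * B = B' * D - B * D'"
proof -
  have "A * A' + B * C' = A' * A + B' * C" "A * B' + B * D' = A' * B + B' * D"
    using eq unfolding mult_four_block_mat[OF c c'] mult_four_block_mat[OF c' c]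
    by (rule four_block_mat_eqD[rotated 8, where n = n and s = s]; use c c' in \<open>auto simp: add_carrier_mat\<close>)+
  moreover have "P - Q = R - T" if "P + T = Q + R" "P \<in> carrier_mat a b" "Q \<in> carrier_mat a b"
    "R \<in> carrier_mat a b" "T \<in> carrier_mat a b" for P Q R T :: "'a mat" and a b
  proof (rule eq_matI)
    fix i j assume "i < dim_row (R - T)" "j < dim_col (R - T)"
    then show "(P - Q) $$ (i,j) = (R - T) $$ (i,j)"
      using arg_cong[OF that(1), of "\<lambda>M. M $$ (i,j)"] that(2-) by (simp add: algebra_simps)
  qed (use that in auto)
  ultimately show "commutator A A' = B' * C - B * C'" "A * B' - A' * B = B' * D - B * D'"
    unfolding commutator_def using c c' by (meson mult_carrier_mat)+
qed

definition extension_block :: "nat \<Rightarrow> nat \<Rightarrow> 'a::field mat \<Rightarrow> 'a mat \<Rightarrow> bool" where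
  "extension_block n s A M \<longleftrightarrow> (\<exists>B C D. B \<in> carrier_mat n s \<and> C \<in> carrier_mat s n \<and> D \<in> carrier_mat s s \<and>
     M = four_block_mat A B C D)"

lemma commuting_extension_alt:
  "commuting_extension n r p A Z \<longleftrightarrow>
     (\<forall>i\<in>{1..p}. \<forall>j\<in>{1..p}. Z i * Z j = Z j * Z i) \<and> (\<forall>i\<in>{1..p}. extension_block n (r - n) (A i) (Z i))"
  unfolding commuting_extension_def extension_block_def ..

lemma extension_blockI:
  "B \<in> carrier_mat n s \<Longrightarrow> C \<in> carrier_mat s n \<Longrightarrow> D \<in> carrier_mat s s \<Longrightarrow>
    extension_block n s A (four_block_mat A B C D)"
  unfolding extension_block_def by blast

lemma extension_block_carrier:
  "extension_block n s A M \<Longrightarrow> A \<in> carrier_mat n n \<Longrightarrow> M \<in> carrier_mat (n + s) (n + s)"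
  unfolding extension_block_def by (auto intro!: four_block_carrier_mat)

text \<open>Block-diagonal conjugation keeps the upper left block and replaces \<open>B\<close> by
  \<open>B * G\<close>; this is exactly the freedom in choosing the basis of Step 1.\<close>

lemma conjugate_four_block:
  fixes A :: "'a::field mat"
  assumes c: "A \<in> carrier_mat n n" "B \<in> carrier_mat n s" "C \<in> carrier_mat s n" "D \<in> carrier_mat s s"
    and G: "G \<in> carrier_mat s s" "H \<in> carrier_mat s s"
  shows "four_block_mat (1\<^sub>m n) (0\<^sub>m n s) (0\<^sub>m s n) H * four_block_mat A B C D * four_block_mat (1\<^sub>m n) (0\<^sub>m n s) (0\<^sub>m s n) G
    = four_block_mat A (B * G) (H * C) (H * D * G)"
proof -
  have z: "1\<^sub>m n \<in> carrier_mat n n" "0\<^sub>m n s \<in> carrier_mat n s" "0\<^sub>m s n \<in> carrier_mat s n" by auto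
  have 1: "four_block_mat (1\<^sub>m n) (0\<^sub>m n s) (0\<^sub>m s n) H * four_block_mat A B C D = four_block_mat A B (H * C) (H * D)"
    unfolding mult_four_block_mat[OF z G(2) c] using c G by simp
  have 2: "H * C \<in> carrier_mat s n" "H * D \<in> carrier_mat s s" using c G by auto
  show ?thesis unfolding 1 mult_four_block_mat[OF c(1,2) 2 z G(1)] using c G 2 by simp
qed

text \<open>In the product of the two conjugates the inner \<open>P * Q\<close> cancels, leaving the
  conjugate of \<open>X * Y\<close>.\<close>

lemma conjugate_commute:
  fixes X :: "'a::field mat"
  assumes "X \<in> carrier_mat m m" "Y \<in> carrier_mat m m" "P \<in> carrier_mat m m" "Q \<in> carrier_mat m m"
    and "P * Q = 1\<^sub>m m" "X * Y = Y * X"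
  shows "(Q * X * P) * (Q * Y * P) = (Q * Y * P) * (Q * X * P)"
proof -
  have "(Q * X * P) * (Q * Y * P) = Q * (X * Y) * P" if "X \<in> carrier_mat m m" "Y \<in> carrier_mat m m" for X Y :: "'a mat"
  proof -
    have "(Q * X * P) * (Q * Y * P) = Q * X * ((P * Q) * (Y * P))"
      using that assms(3,4) by (simp add: assoc_mult_mat[of _ m m _ m _ m])
    then show ?thesis using that assms(3-5) by (simp add: assoc_mult_mat[of _ m m _ m _ m])
  qed
  then show ?thesis using assms by simp
qed

section \<open>The algorithm\<close>

lemma computes_bind_budget:
  assumes "computes f x (a * M)" "computes (g x) y ((c - a) * M)" "a \<le> c"
  shows "computes (bind_run f g) y (c * M)"
  by (rule computes_bind[OF assms(1), where g = g, OF assms(2)]) (simp add: assms(3) flip: add_mult_distrib)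

text \<open>The constant 54 is six commutators at 5 and six ranks at 4.\<close>

lemma computes_test_H:
  assumes A: "A k \<in> carrier_mat n n" "A l \<in> carrier_mat n n" "A m \<in> carrier_mat n n" and N: "2 * n \<le> N"
  shows "computes (test_H n r A k l m) (hyp_H n r A k l m) (54 * N ^ 3)"
proof -
  have N1: "n \<le> N" "n + n \<le> N" using N by auto
  note K = computes_mat_comm[OF _ _ N1(1)] and c = commutator_carrier
  show ?thesis unfolding test_H_def hyp_H_iff_triple_ranks[of A, OF A]
    apply (rule computes_bind_budget[OF K[OF A(1,2)]])
    apply (rule computes_bind_budget[OF K[OF A(1,3)]])
    apply (rule computes_bind_budget[OF K[OF A(2,1)]])
    apply (rule computes_bind_budget[OF K[OF A(2,3)]])
    apply (rule computes_bind_budget[OF K[OF A(3,1)]])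
    apply (rule computes_bind_budget[OF K[OF A(3,2)]])
    apply (rule computes_bind_budget[OF computes_mat_rank[OF c[OF A(1,2)] N1(1,1)]])
    apply (rule computes_bind_budget[OF computes_mat_rank[OF c[OF A(1,3)] N1(1,1)]])
    apply (rule computes_bind_budget[OF computes_mat_rank[OF c[OF A(2,3)] N1(1,1)]])
    apply (rule computes_bind_budget[OF computes_mat_rank[OF hcat_carrier[OF c[OF A(1,2)] c[OF A(1,3)]] N1(1,2)]])
    apply (rule computes_bind_budget[OF computes_mat_rank[OF hcat_carrier[OF c[OF A(2,1)] c[OF A(2,3)]] N1(1,2)]])
    apply (rule computes_bind_budget[OF computes_mat_rank[OF hcat_carrier[OF c[OF A(3,1)] c[OF A(3,2)]] N1(1,2)]])
    apply (simp_all add: triple_ranks_def)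
    done
qed

lemma find_m_spec:
  assumes A: "\<forall>i\<in>{1..p}. A i \<in> carrier_mat n n" and l: "l \<in> {2..p}"
    and ex: "\<exists>m\<in>{1..p} - {1, l}. hyp_H n r A 1 l m" and pick: "index_choice pick" and N: "2 * n \<le> N"
  obtains m where "m \<in> {1..p} - {1, l}" "hyp_H n r A 1 l m" "computes (find_m pick n r p A l) m (p * (54 * N ^ 3))"
proof -
  let ?xs = "filter (\<lambda>m. m \<notin> {1, l}) [1..<p + 1]"
  let ?ms = "filter (hyp_H n r A 1 l) ?xs"
  have xs: "set ?xs = {1..p} - {1, l}" by (auto simp del: upt_Suc)
  have "computes (test_H n r A 1 l m) (hyp_H n r A 1 l m) (54 * N ^ 3)" if "m \<in> set ?xs" for m
    using A l that unfolding xs by (intro computes_test_H[OF _ _ _ N]) auto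
  then have "computes (filter_run (\<lambda>m. test_H n r A 1 l m) ?xs) ?ms (length ?xs * (54 * N ^ 3))"
    by (rule computes_filter_run)
  moreover have "length ?xs \<le> p" by (rule order_trans[OF length_filter_le]) simp
  ultimately have run: "computes (filter_run (\<lambda>m. test_H n r A 1 l m) ?xs) ?ms (p * (54 * N ^ 3))"
    by (rule computes_mono[OF _ mult_le_mono1])
  have "?ms \<noteq> []" using ex xs unfolding filter_empty_conv by blast
  then have m: "pick l ?ms \<in> set ?ms" using pick unfolding index_choice_def by blast
  have "computes (find_m pick n r p A l) (pick l ?ms) (p * (54 * N ^ 3))" unfolding find_m_def
    by (rule computes_bind[OF run, where b = 0]) (use \<open>?ms \<noteq> []\<close> in \<open>simp_all add: computes_def\<close>)
  moreover have "pick l ?ms \<in> {1..p} - {1, l}" "hyp_H n r A 1 l (pick l ?ms)"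
    using m unfolding set_filter[of "hyp_H n r A 1 l"] xs by blast+
  ultimately show thesis using that by blast
qed

text \<open>Per index, the search for m costs at most \<open>54 * p\<close> units and Steps 2-7 cost
  118. Besides the block shape, the postcondition tracks which indices are defined, so that the
  final test may apply \<open>the\<close> to every entry.\<close>

lemma run_ensures_extend_run:
  fixes A :: "nat \<Rightarrow> 'a::field mat"
  assumes A: "\<forall>i\<in>{1..p}. A i \<in> carrier_mat n n" and ex: "\<forall>l\<in>{2..p}. \<exists>m\<in>{1..p} - {1, l}. hyp_H n r A 1 l m"
    and pick: "index_choice pick" and N: "3 * n \<le> N" and s: "s \<le> n"
    and B1: "B1 \<in> carrier_mat n s" and C1: "C1 \<in> carrier_mat s n"
    and "set ls \<subseteq> {2..p}" "\<forall>i M. Z i = Some M \<longrightarrow> extension_block n s (A i) M"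
  shows "run_ensures (extend_run pick n r p A B1 C1 ls Z) (length ls * ((54 * p + 118) * N ^ 3))
    (\<lambda>Z'. (\<forall>i M. Z' i = Some M \<longrightarrow> extension_block n s (A i) M) \<and>
      (\<forall>i. Z i \<noteq> None \<or> i \<in> set ls \<longrightarrow> Z' i \<noteq> None))"
  using assms(8-)
proof (induction ls arbitrary: Z)
  case Nil
  then show ?case by (auto intro: run_ensures_ret)
next
  case (Cons l ls)
  show ?case
  proof (cases "Z l = None")
    case False
    then show ?thesis using Cons.IH[of Z] Cons.prems
      by (auto elim!: run_ensures_mono)
  next
    case True
    have l: "l \<in> {2..p}" using Cons.prems by simp
    have N': "2 * n \<le> N" using N by simp
    obtain m where m: "m \<in> {1..p} - {1, l}" "hyp_H n r A 1 l m"
      "computes (find_m pick n r p A l) m (p * (54 * N ^ 3))"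
      using find_m_spec[OF A l bspec[OF ex l] pick N'] .
    have c: "A 1 \<in> carrier_mat n n" "A l \<in> carrier_mat n n" "A m \<in> carrier_mat n n" using A l m by auto
    show ?thesis
      apply (simp only: extend_run.simps True simp_thms if_False)
      apply (rule run_ensures_computes[OF m(3), where b = "118 * N ^ 3 + length ls * ((54 * p + 118) * N ^ 3)"])
       apply (rule run_ensures_bind[OF run_ensures_steps2_7[OF c B1 _ N s], where b = "length ls * ((54 * p + 118) * N ^ 3)"])
      using C1 apply simp
        apply clarify
      subgoal for _ Bl Cl Dl Bm Cm Dm
        by (rule run_ensures_mono[OF Cons.IH]) (use Cons.prems in \<open>auto intro!: extension_blockI\<close>)
      by (simp_all add: algebra_simps)
  qed
qed

text \<open>A later step may recompute and overwrite \<open>Z m\<close> for an index already done.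
  This is harmless: every stored matrix is the one of the fixed extension, so the overwriting value
  is the same.\<close>

lemma extend_run_complete:
  fixes A :: "nat \<Rightarrow> 'a::field mat"
  assumes A: "\<forall>i\<in>{1..p}. A i \<in> carrier_mat n n" and ex: "\<forall>l\<in>{2..p}. \<exists>m\<in>{1..p} - {1, l}. hyp_H n r A 1 l m"
    and pick: "index_choice pick"
    and c: "\<forall>i\<in>{1..p}. B i \<in> carrier_mat n (r - n) \<and> C i \<in> carrier_mat (r - n) n \<and> D i \<in> carrier_mat (r - n) (r - n)"
    and rel: "\<forall>i\<in>{1..p}. \<forall>j\<in>{1..p}. commutator (A i) (A j) = B j * C i - B i * C j \<and>
      A i * B j - A j * B i = B j * D i - B i * D j"
    and "set ls \<subseteq> {2..p}" "\<forall>i M. Z i = Some M \<longrightarrow> M = four_block_mat (A i) (B i) (C i) (D i)"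
  shows "\<exists>Z'. outcome (extend_run pick n r p A (B 1) (C 1) ls Z) = Some Z' \<and>
    (\<forall>i M. Z' i = Some M \<longrightarrow> M = four_block_mat (A i) (B i) (C i) (D i))"
  using assms(6-)
proof (induction ls arbitrary: Z)
  case (Cons l ls)
  show ?case
  proof (cases "Z l = None")
    case False
    then show ?thesis using Cons.IH[of Z] Cons.prems by auto
  next
    case True
    have l: "l \<in> {2..p}" using Cons.prems by simp
    obtain m where m: "m \<in> {1..p} - {1, l}" "hyp_H n r A 1 l m"
      "computes (find_m pick n r p A l) m (p * (54 * (2 * n) ^ 3))"
      using find_m_spec[OF A l bspec[OF ex l] pick order.refl] .
    have i: "1 \<in> {1..p}" "l \<in> {1..p}" "m \<in> {1..p}" using l m by auto
    have "outcome (steps2_7 (A 1) (A l) (A m) (B 1) (Some (C 1))) = Some (C 1, (B l, C l, D l), (B m, C m, D m))"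
      using A c rel i m(2) hyp_H_iff_triple_ranks[of A 1 n l m r] by (intro steps2_7_complete(1)) auto
    then have "outcome (extend_run pick n r p A (B 1) (C 1) (l # ls) Z) =
      outcome (extend_run pick n r p A (B 1) (C 1) ls (Z(l \<mapsto> four_block_mat (A l) (B l) (C l) (D l),
        m \<mapsto> four_block_mat (A m) (B m) (C m) (D m))))"
      using True computes_outcome[OF m(3)] by simp
    then show ?thesis using Cons.IH Cons.prems by auto
  qed
qed simp

lemma computes_commute_run:
  fixes X :: "'a::field mat"
  assumes X: "X \<in> carrier_mat m m" and Y: "Y \<in> carrier_mat m m" and N: "m \<le> N"
  shows "computes (commute_run X Y) (X * Y = Y * X) (6 * N ^ 3)"
proof -
  let ?K = "commutator X Y"
  have K: "?K \<in> carrier_mat m m" using X Y by simp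
  have "(\<forall>i\<in>set [0..<m]. \<forall>j\<in>set [0..<m]. ?K $$ (i,j) = 0) \<longleftrightarrow> X * Y = Y * X"
    unfolding commutator_def using X Y by (auto simp: mat_eq_iff)
  moreover have "N ^ 2 \<le> N ^ 3" by (cases "N = 0") (auto intro: power_increasing)
  ultimately have "computes (all_zero ?K [0..<m] [0..<m]) (X * Y = Y * X) (1 * N ^ 3)"
    using computes_all_zero[of "[0..<m]" N "[0..<m]" ?K] N by (auto elim!: computes_mono)
  then show ?thesis unfolding commute_run_def
    using K by (intro computes_bind_budget[OF computes_mat_comm[OF X Y N]]) (auto elim!: computes_mono)
qed

lemma Ball_concat_map:
  "(\<forall>c\<in>set (concat (map (\<lambda>i. map (f i) ys) xs)). c) \<longleftrightarrow> (\<forall>i\<in>set xs. \<forall>j\<in>set ys. f i j)"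
  by auto

text \<open>Soundness and cost together. In units of \<open>p * p * N ^ 3\<close>, the constant 384
  is 54 (search) + 21 (Step 1) + 118 (Steps 2-7) + 13 (Step 8) + 172 (remaining indices) + 6
  (commutation tests).\<close>

lemma run_ensures_algorithm:
  fixes A :: "nat \<Rightarrow> 'a::field mat"
  assumes p: "2 \<le> p" and A: "\<forall>i\<in>{1..p}. A i \<in> carrier_mat n n"
    and ex: "\<forall>l\<in>{2..p}. \<exists>m\<in>{1..p} - {1, l}. hyp_H n r A 1 l m"
    and bas: "basis_choice n bas" and pick: "index_choice pick" and N: "3 * n \<le> N"
  shows "run_ensures (algorithm bas pick n r p A) (384 * (p * p * N ^ 3)) (commuting_extension n r p A)"
proof -
  define s where "s = r - n"
  define M where "M = p * p * N ^ 3"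
  have pp: "1 \<le> p" "p \<le> p * p" "1 \<le> p * p" using p by (auto simp: le_square)
  have NM: "k * N ^ 3 \<le> k * M" for k using pp(3) by (simp add: M_def)
  have N': "2 * n \<le> N" "n \<le> N" using N by auto
  have two: "2 \<in> {2..p}" using p by simp
  obtain m where m: "m \<in> {1..p} - {1, 2}" "hyp_H n r A 1 2 m" "computes (find_m pick n r p A 2) m (p * (54 * N ^ 3))"
    using find_m_spec[OF A two bspec[OF ex two] pick N'(1)] .
  have "p * (54 * N ^ 3) \<le> 54 * M" using pp(2) by (simp add: M_def mult_ac)
  then have run_m: "computes (find_m pick n r p A 2) m (54 * M)" by (rule computes_mono[OF m(3)])
  have c: "A 1 \<in> carrier_mat n n" "A 2 \<in> carrier_mat n n" "A m \<in> carrier_mat n n" using A p m(1) by auto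
  have r: "triple_ranks n s (A 1) (A 2) (A m)" using m(2) hyp_H_iff_triple_ranks[of A, OF c] by (simp add: s_def)
  have s: "2 * s \<le> n" by (rule triple_ranks_size[OF r c(1,2)])
  then have s': "s \<le> n" "s + s \<le> N" "n + s \<le> N" using N by auto
  obtain B1 where B1: "computes (step1 bas (A 1) (A 2) (A m)) B1 (21 * N ^ 3)" "B1 \<in> carrier_mat n s"
    using step1_spec[OF c r bas N'(1)] by metis
  let ?ls = "[3..<p + 1]" and ?ps = "[1..<p + 1]"
  have ls: "set ?ls \<subseteq> {2..p}" "length ?ls \<le> p" by (auto simp del: upt_Suc)
  have ps: "set ?ps = {1..p}" "length ?ps = p" by (auto simp del: upt_Suc)
  \<comment> \<open>Rounding 118 up to \<open>118 * p\<close> makes the total quadratic in p, with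
    coefficient 172 = 54 + 118.\<close>
  have "length ?ls * ((54 * p + 118) * N ^ 3) \<le> p * ((54 * p + 118 * p) * N ^ 3)"
    using ls(2) pp(1) by (intro mult_le_mono add_mono) auto
  then have ext_cost: "length ?ls * ((54 * p + 118) * N ^ 3) \<le> 172 * M"
    by (simp add: M_def algebra_simps)
  have check: "run_ensures (map_run (\<lambda>i. map_run (\<lambda>j. commute_run (the (Z i)) (the (Z j))) ?ps) ?ps \<bind>
      (\<lambda>cs. require (\<forall>c\<in>set (concat cs). c) \<bind> (\<lambda>_. ret (\<lambda>i. the (Z i))))) (6 * M) (commuting_extension n r p A)"
    if Z: "\<forall>i M. Z i = Some M \<longrightarrow> extension_block n s (A i) M" "\<forall>i\<in>{1..p}. Z i \<noteq> None" for Z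
  proof -
    have blk: "extension_block n s (A i) (the (Z i))" if "i \<in> {1..p}" for i using Z that by force
    have "computes (map_run (\<lambda>i. map_run (\<lambda>j. commute_run (the (Z i)) (the (Z j))) ?ps) ?ps)
        (map (\<lambda>i. map (\<lambda>j. the (Z i) * the (Z j) = the (Z j) * the (Z i)) ?ps) ?ps)
        (length ?ps * (length ?ps * (6 * N ^ 3)))"
      using A by (intro computes_map_run computes_commute_run[of _ "n + s"] s'(3))
        (auto simp only: ps intro!: extension_block_carrier[OF blk])
    moreover have "length ?ps * (length ?ps * (6 * N ^ 3)) = 6 * M" by (simp only: ps M_def mult_ac)
    ultimately have "computes (map_run (\<lambda>i. map_run (\<lambda>j. commute_run (the (Z i)) (the (Z j))) ?ps) ?ps)
        (map (\<lambda>i. map (\<lambda>j. the (Z i) * the (Z j) = the (Z j) * the (Z i)) ?ps) ?ps) (6 * M)" by metis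
    then show ?thesis
    proof (rule run_ensures_computes[where b = 0])
      show "run_ensures (require (\<forall>c\<in>set (concat (map (\<lambda>i. map (\<lambda>j. the (Z i) * the (Z j) = the (Z j) * the (Z i)) ?ps) ?ps)). c)
          \<bind> (\<lambda>_. ret (\<lambda>i. the (Z i)))) 0 (commuting_extension n r p A)"
        unfolding Ball_concat_map ps
        by (intro run_ensures_require run_ensures_ret)
          (use blk in \<open>simp add: commuting_extension_alt s_def del: atLeastAtMost_iff One_nat_def\<close>)
    qed simp
  qed
  show ?thesis
    unfolding algorithm_def M_def[symmetric]
    apply (rule computes_budget[OF run_m])
    apply (rule computes_budget[OF computes_mono[OF B1(1) NM]])
    apply (rule run_ensures_budget[OF run_ensures_weaken[OF run_ensures_steps2_7[OF c B1(2) _ N s'(1)] NM]])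
    apply simp
    apply clarify
    subgoal for C1 B2 C2 D2 Bm Cm Dm
      apply (rule run_ensures_budget[OF run_ensures_weaken[OF run_ensures_step8[OF c(1,2) B1(2) _ _ N'(2) s'(2)] NM]])
      apply assumption
      apply assumption
      apply (rule run_ensures_budget[OF run_ensures_weaken[OF
              run_ensures_extend_run[OF A ex pick N s'(1) B1(2) _ ls(1)] ext_cost]])
      apply assumption
      apply (use B1(2) in \<open>auto intro!: extension_blockI\<close>)[1]
      apply (rule run_ensures_weaken[OF check])
      apply (simp_all del: upt_Suc)
      subgoal premises prems for D1 Z'
      proof
        fix i assume "i \<in> {Suc 0..p}"
        \<comment> \<open>Indices 1 and 2 are defined by the initial map, all others because the
          loop visits them.\<close>
        then have "i = 1 \<or> i = 2 \<or> i \<in> set [3..<p + 1]" by (auto simp del: upt_Suc)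
        then show "\<exists>y. Z' i = Some y" using prems by (auto simp del: upt_Suc)
      qed
      done
    apply simp_all
    done
qed

text \<open>The analysis of Steps 2-7 is applied twice: to the given extension, to learn that its
  first block has the same image as the chosen basis, and then to the extension conjugated so that
  its first block is that basis, whose blocks the actual run returns.\<close>

lemma algorithm_complete:
  fixes A :: "nat \<Rightarrow> 'a::field mat"
  assumes p: "2 \<le> p" and A: "\<forall>i\<in>{1..p}. A i \<in> carrier_mat n n"
    and ex: "\<forall>l\<in>{2..p}. \<exists>m\<in>{1..p} - {1, l}. hyp_H n r A 1 l m"
    and bas: "basis_choice n bas" and pick: "index_choice pick" and Z: "commuting_extension n r p A Z"
  shows "outcome (algorithm bas pick n r p A) \<noteq> None"
proof -
  define s where "s = r - n"
  have "\<forall>i\<in>{1..p}. extension_block n s (A i) (Z i)" using Z unfolding commuting_extension_alt s_def by blast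
  then obtain B C D where c: "\<And>i. i \<in> {1..p} \<Longrightarrow> B i \<in> carrier_mat n s" "\<And>i. i \<in> {1..p} \<Longrightarrow> C i \<in> carrier_mat s n"
     "\<And>i. i \<in> {1..p} \<Longrightarrow> D i \<in> carrier_mat s s"
     and ZB: "\<And>i. i \<in> {1..p} \<Longrightarrow> Z i = four_block_mat (A i) (B i) (C i) (D i)"
    unfolding extension_block_def by metis
  have Zcomm: "Z i * Z j = Z j * Z i" if "i \<in> {1..p}" "j \<in> {1..p}" for i j
    using Z that unfolding commuting_extension_alt by blast
  have two: "2 \<in> {2..p}" using p by simp
  define N where "N = 3 * n"
  have N: "2 * n \<le> N" "3 * n \<le> N" by (auto simp: N_def)
  obtain m where m: "m \<in> {1..p} - {1, 2}" "hyp_H n r A 1 2 m" "computes (find_m pick n r p A 2) m (p * (54 * N ^ 3))"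
    using find_m_spec[OF A two bspec[OF ex two] pick N(1)] .
  have i: "1 \<in> {1..p}" "2 \<in> {1..p}" "m \<in> {1..p}" using p m(1) by auto
  note cA = bspec[OF A i(1)] bspec[OF A i(2)] bspec[OF A i(3)]
  have r: "triple_ranks n s (A 1) (A 2) (A m)" using m(2) hyp_H_iff_triple_ranks[of A, OF cA] by (simp add: s_def)
  have s: "s \<le> n" using triple_ranks_size[OF r cA(1,2)] by simp
  obtain B1 W where B1: "computes (step1 bas (A 1) (A 2) (A m)) B1 (21 * N ^ 3)" "B1 \<in> carrier_mat n s" "left_inv B1"
    "computes (inter_basis (commutator (A 1) (A 2)) (commutator (A 1) (A m))) W (11 * N ^ 3)"
    "vec_space.col_space n B1 = vec_space.col_space n W"
    using step1_spec[OF cA r bas N(1)] .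
  have rel: "commutator (A i) (A j) = B j * C i - B i * C j" "A i * B j - A j * B i = B j * D i - B i * D j"
    if "i \<in> {1..p}" "j \<in> {1..p}" for i j
    using commuting_blocks[OF bspec[OF A that(1)] c(1-3)[OF that(1)] bspec[OF A that(2)] c(1-3)[OF that(2)]]
      Zcomm[OF that] ZB that by auto
  \<comment> \<open>Concerns a run from the extension's own \<open>B 1\<close>, which need not be
    the chosen basis; it is consulted for the left inverse of \<open>B 1\<close> and for its
    image.\<close>
  note compl = steps2_7_complete[OF cA c(1)[OF i(1)] c(1)[OF i(2)] c(1)[OF i(3)] c(2)[OF i(1)] c(2)[OF i(2)] c(2)[OF i(3)]
      c(3)[OF i(2)] c(3)[OF i(3)] rel(1)[OF i(1,2)] rel(1)[OF i(1,3)] rel(1)[OF i(2,3)] rel(2)[OF i(2,3)] r disjI1[OF refl]]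
  have "vec_space.col_space n B1 = vec_space.col_space n (B 1)" using B1(5) compl(4)[OF B1(4)] by simp
  then obtain G H where G: "G \<in> carrier_mat s s" "H \<in> carrier_mat s s" "B1 = B 1 * G" "G * H = 1\<^sub>m s" "H * G = 1\<^sub>m s"
    using change_of_basis[OF B1(3,2) compl(2) c(1)[OF i(1)]] by metis
  define B' C' D' where "B' i = B i * G" and "C' i = H * C i" and "D' i = H * D i * G" for i
  have c': "\<forall>i\<in>{1..p}. B' i \<in> carrier_mat n s \<and> C' i \<in> carrier_mat s n \<and> D' i \<in> carrier_mat s s"
    unfolding B'_def C'_def D'_def using c G(1,2) by (meson mult_carrier_mat)
  define Z' where "Z' i = four_block_mat (A i) (B' i) (C' i) (D' i)" for i
  have Z'comm: "Z' i * Z' j = Z' j * Z' i" if "i \<in> {1..p}" "j \<in> {1..p}" for i j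
  proof -
    let ?P = "four_block_mat (1\<^sub>m n) (0\<^sub>m n s) (0\<^sub>m s n) G" and ?Q = "four_block_mat (1\<^sub>m n) (0\<^sub>m n s) (0\<^sub>m s n) H"
    have conj: "Z' i = ?Q * Z i * ?P" if "i \<in> {1..p}" for i
      using conjugate_four_block[OF bspec[OF A that] c(1-3)[OF that] G(1,2)] ZB[OF that]
      by (simp add: Z'_def B'_def C'_def D'_def)
    have "?P * ?Q = four_block_mat (1\<^sub>m n) (0\<^sub>m n s) (0\<^sub>m s n) (1\<^sub>m s)"
      using G by (subst mult_four_block_mat[of _ n n _ s _ s _ _ n _ s]) auto
    then have PQ: "?P * ?Q = 1\<^sub>m (n + s)" by (simp add: four_block_one_mat)
    have Zc: "Z i \<in> carrier_mat (n + s) (n + s)" if "i \<in> {1..p}" for i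
      using ZB[OF that] c(3)[OF that] A that by simp
    have "?P \<in> carrier_mat (n + s) (n + s)" "?Q \<in> carrier_mat (n + s) (n + s)" using G(1,2) by simp_all
    then show ?thesis unfolding conj[OF that(1)] conj[OF that(2)]
      by (rule conjugate_commute[OF Zc[OF that(1)] Zc[OF that(2)] _ _ PQ Zcomm[OF that]])
  qed
  have rel': "\<forall>i\<in>{1..p}. \<forall>j\<in>{1..p}. commutator (A i) (A j) = B' j * C' i - B' i * C' j \<and>
      A i * B' j - A j * B' i = B' j * D' i - B' i * D' j"
  proof (intro ballI)
    fix i j assume ij: "i \<in> {1..p}" "j \<in> {1..p}"
    show "commutator (A i) (A j) = B' j * C' i - B' i * C' j \<and> A i * B' j - A j * B' i = B' j * D' i - B' i * D' j"
      using commuting_blocks[of "A i" n "B' i" s "C' i" "D' i" "A j" "B' j" "C' j" "D' j"] c' A ij Z'comm[OF ij]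
      unfolding Z'_def by blast
  qed
  have B'1: "B' 1 = B1" using G(3) by (simp add: B'_def)
  have o2: "outcome (steps2_7 (A 1) (A 2) (A m) B1 None) = Some (C' 1, (B' 2, C' 2, D' 2), (B' m, C' m, D' m))"
    and inv: "left_inv (B' 2)"
    unfolding B'1[symmetric] using c' rel' i cA r by (intro steps2_7_complete(1,3)[of _ n _ _ _ s]; blast)+
  have o8: "outcome (step8 (A 1) (A 2) B1 (B' 2) (D' 2)) = Some (D' 1)"
    unfolding B'1[symmetric] using c' rel' i cA inv by (intro step8_complete[of _ n _ _ s]) blast+
  let ?Z0 = "[1 \<mapsto> four_block_mat (A 1) B1 (C' 1) (D' 1), 2 \<mapsto> four_block_mat (A 2) (B' 2) (C' 2) (D' 2),
    m \<mapsto> four_block_mat (A m) (B' m) (C' m) (D' m)]"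
  have ls: "set [3..<p + 1] \<subseteq> {2..p}" by (auto simp del: upt_Suc)
  have Z0: "\<forall>i M. ?Z0 i = Some M \<longrightarrow> M = four_block_mat (A i) (B' i) (C' i) (D' i)" using B'1 by auto
  obtain Z1 where Z1: "outcome (extend_run pick n r p A B1 (C' 1) [3..<p + 1] ?Z0) = Some Z1"
    "\<forall>i M. Z1 i = Some M \<longrightarrow> M = Z' i"
    using extend_run_complete[OF A ex pick c'[unfolded s_def] rel' ls Z0] unfolding B'1 Z'_def by blast
  have c1: "C' 1 \<in> carrier_mat s n" using c' i by blast
  have "\<forall>i M. ?Z0 i = Some M \<longrightarrow> extension_block n s (A i) M"
  proof (intro allI impI)
    fix k M assume M: "?Z0 k = Some M"
    then have "k = 1 \<or> k = 2 \<or> k = m" by (auto simp: fun_upd_def split: if_splits)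
    then have "k \<in> {1..p}" using i by blast
    then show "extension_block n s (A k) M" using c' Z0 M extension_blockI by metis
  qed
  \<comment> \<open>The exact-outcome result says that every stored matrix is right, but not which
    indices are stored; definedness is taken from the size-and-cost result about the same
    run.\<close>
  from run_ensures_extend_run[OF A ex pick N(2) s B1(2) c1 ls this]
  have dom: "Z1 i \<noteq> None" if "?Z0 i \<noteq> None \<or> i \<in> set [3..<p + 1]" for i
    using Z1(1) that unfolding run_ensures_def by blast
  have "Z1 i = Some (Z' i)" if "i \<in> {1..p}" for i
  proof -
    have "i = 1 \<or> i = 2 \<or> i \<in> set [3..<p + 1]" using that by (auto simp del: upt_Suc)
    then have "Z1 i \<noteq> None" using dom[of i] by (auto simp del: upt_Suc)
    then show ?thesis using Z1(2) by auto
  qed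
  then have Z1': "the (Z1 i) = Z' i" if "i \<in> {1..p}" for i using that by simp
  let ?ps = "[1..<p + 1]"
  have ps: "set ?ps = {1..p}" by (auto simp del: upt_Suc)
  have "computes (map_run (\<lambda>i. map_run (\<lambda>j. commute_run (the (Z1 i)) (the (Z1 j))) ?ps) ?ps)
      (map (\<lambda>i. map (\<lambda>j. True) ?ps) ?ps) (length ?ps * (length ?ps * (6 * (n + s) ^ 3)))"
  proof (intro computes_map_run)
    fix i j assume "i \<in> set ?ps" "j \<in> set ?ps"
    then have ij: "i \<in> {1..p}" "j \<in> {1..p}" using ps by blast+
    have "Z' i \<in> carrier_mat (n + s) (n + s)" if "i \<in> {1..p}" for i
      unfolding Z'_def using that c' A by (intro four_block_carrier_mat) auto
    then show "computes (commute_run (the (Z1 i)) (the (Z1 j))) True (6 * (n + s) ^ 3)"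
      using computes_commute_run[of "Z' i" "n + s" "Z' j" "n + s"] ij Z'comm[OF ij] by (simp add: Z1' del: atLeastAtMost_iff)
  qed
  note oc = computes_outcome[OF this]
  have all: "(\<forall>c\<in>set (concat (map (\<lambda>i. map (\<lambda>j. True) ?ps) ?ps)). c) = True"
    unfolding Ball_concat_map by simp
  have "outcome (algorithm bas pick n r p A) = Some (\<lambda>i. the (Z1 i))"
    unfolding algorithm_def
    by (simp only: outcome_bind option.case prod.case computes_outcome[OF m(3)] computes_outcome[OF B1(1)] o2 o8 Z1(1) oc
        all outcome_require if_True outcome_ret)
  then show ?thesis by simp
qed

theorem theorem5:
  shows "\<exists>c d :: nat. \<forall>(A :: nat \<Rightarrow> 'k::field mat) n r p bas pick.
    n \<le> r \<longrightarrow> 4 \<le> p \<longrightarrow>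
    (\<forall>i\<in>{1..p}. A i \<in> carrier_mat n n) \<longrightarrow>
    (\<forall>l\<in>{2..p}. \<exists>m\<in>{1..p} - {1, l}. hyp_H n r A 1 l m) \<longrightarrow>
    basis_choice n bas \<longrightarrow> index_choice pick \<longrightarrow>
      ops (algorithm bas pick n r p A) \<le> c * (n + p) ^ d \<and>
      (if \<exists>Z. commuting_extension n r p A Z
       then \<exists>Z. outcome (algorithm bas pick n r p A) = Some Z \<and> commuting_extension n r p A Z
       else outcome (algorithm bas pick n r p A) = None)"
proof (rule exI[of _ "384 * 27"], rule exI[of _ 5], intro allI impI)
  fix A :: "nat \<Rightarrow> 'k mat" and n r p and bas :: "'k mat \<Rightarrow> 'k mat" and pick
  assume p: "4 \<le> p" and A: "\<forall>i\<in>{1..p}. A i \<in> carrier_mat n n"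
    and ex: "\<forall>l\<in>{2..p}. \<exists>m\<in>{1..p} - {1, l}. hyp_H n r A 1 l m"
    and bas: "basis_choice n bas" and pick: "index_choice pick"
  have p2: "2 \<le> p" using p by simp
  \<comment> \<open>Taking N = 3(n + p) instead of 3n gives a bound in the single quantity n + p:
    the cube contributes 27 and degree 3, and \<open>p * p\<close> contributes the remaining degree
    2.\<close>
  have "3 * n \<le> 3 * (n + p)" by simp
  from run_ensures_algorithm[OF p2 A ex bas pick this]
  have cost: "ops (algorithm bas pick n r p A) \<le> 384 * (p * p * (3 * (n + p)) ^ 3)"
    and sound: "\<And>Z. outcome (algorithm bas pick n r p A) = Some Z \<Longrightarrow> commuting_extension n r p A Z"
    by (auto simp: run_ensures_def)
  have "384 * (p * p * (3 * (n + p)) ^ 3) \<le> 384 * ((n + p) * (n + p) * (3 * (n + p)) ^ 3)"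
    by (intro mult_le_mono) auto
  also have "\<dots> = 384 * 27 * (n + p) ^ 5"
  proof -
    have "x * x * (3 * x) ^ 3 = 27 * x ^ 5" for x :: nat
      by (simp add: power_mult_distrib mult.left_commute[of x] mult.assoc flip: power_Suc)
    from this[of "n + p"] show ?thesis by (simp only: mult.assoc)
  qed
  finally have "ops (algorithm bas pick n r p A) \<le> 384 * 27 * (n + p) ^ 5" using cost by simp
  moreover have "if \<exists>Z. commuting_extension n r p A Z
       then \<exists>Z. outcome (algorithm bas pick n r p A) = Some Z \<and> commuting_extension n r p A Z
       else outcome (algorithm bas pick n r p A) = None"
  proof (cases "\<exists>Z. commuting_extension n r p A Z")
    case True
    then show ?thesis using sound algorithm_complete[OF p2 A ex bas pick] by (metis option.exhaust)
  next
    case False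
    then show ?thesis using sound by (cases "outcome (algorithm bas pick n r p A)") auto
  qed
  ultimately show "ops (algorithm bas pick n r p A) \<le> 384 * 27 * (n + p) ^ 5 \<and>
      (if \<exists>Z. commuting_extension n r p A Z
       then \<exists>Z. outcome (algorithm bas pick n r p A) = Some Z \<and> commuting_extension n r p A Z
       else outcome (algorithm bas pick n r p A) = None)" ..
qed

end
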